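(* For all ordered subsets $I,J$ of $\{1,\dots,n\}$ one has $\xi^I_J=\eta^I_J$ in $\mathcal F_R(M(n))$.
   Context: Setting. $n$ is a positive integer and $q$ is the deformation parameter, on which no condition is stated beyond what is needed for the formulas below to make sense. Identify $\mathfrak h\cong\mathfrak h^*\cong\mathbb C^n$ with unit vectors $e_i$, put $\omega(i)=e_i$. $M_{\mathfrak h^*}$ is the field of meromorphic functions on $\mathfrak h^*$ (in $\underline\lambda=(\lambda_1,\dots,\lambda_n)$). Put $h_0(z)=\frac{q^{-1}-q}{q^{-2z}-1}$, $g(z)=\frac{(q^{-2z}-q^{-2})(q^{-2z}-q^2)}{(q^{-2z}-1)^2}$, $h(z)=q-h_0(z)=q\frac{q^{-2z}-q^{-2}}{q^{-2z}-1}$. The algebra $\mathcal F_R(M(n))$. It is obtained by applying the generalized FRST-construction to the $R$-matrix whose nonzero entries are $R^{aa}_{aa}=q$; $R^{ab}_{ab}(\underline\lambda)=1$ if $a<b$ and $g(\lambda_a-\lambda_b)$ if $a>b$; $R^{ab}_{ba}(\underline\lambda)=h_0(\lambda_a-\lambda_b)$ if $a\ne b$. That is, it is the unital associative $\mathbb C$-algebra generated by $t_{ij}$ ($1\le i,j\le n$) and two commuting copies of $M_{\mathfrak h^*}$, written $f(\underline\lambda)=\mu_l(f)$ and $f(\underline\mu)=\mu_r(f)$, with relations $f(\underline\lambda)t_{ij}=t_{ij}f(\underline\lambda+\omega(i))$, $f(\underline\mu)t_{ij}=t_{ij}f(\underline\mu+\omega(j))$ and the RLL-relations $\sum_{x,y}R^{xy}_{ac}(\underline\lambda)t_{xb}t_{yd}=\sum_{x,y}R^{bd}_{xy}(\underline\mu)t_{cy}t_{ax}$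 for all $a,b,c,d$. Among the latter are: $h(\mu_b-\mu_d)t_{ab}t_{ad}=t_{ad}t_{ab}$ for $b<d$; $h(\lambda_c-\lambda_a)t_{cb}t_{ab}=t_{ab}t_{cb}$ for $a<c$; and, for $a<c$, $b<d$, $t_{ab}t_{cd}=t_{cd}t_{ab}+[h(\lambda_c-\lambda_a)-h(\mu_b-\mu_d)]t_{cb}t_{ad}$ and $g(\mu_b-\mu_d)t_{ab}t_{cd}=g(\lambda_a-\lambda_c)t_{cd}t_{ab}+[h(\mu_d-\mu_b)-h(\lambda_a-\lambda_c)]t_{ad}t_{cb}$. The algebra is bigraded by $\mathfrak h^*$: $t_{ij}$ has bidegree $(\omega(i),\omega(j))$, and $f(\underline\lambda),f(\underline\mu)$ have bidegree $(0,0)$. The elements $\xi^I_J$. $W$ is the unital associative algebra generated by $w_1,\dots,w_n$ and a copy of $M_{\mathfrak h^*}$ (elements $f(\underline\lambda)=\mu_W(f)$), with relations $w_i^2=0$, $w_jw_i=-h(\lambda_j-\lambda_i)w_iw_j$ for $i<j$, $f(\underline\lambda)w_i=w_if(\underline\lambda+\omega(i))$. For an ordered subset $I=\{i_1<\dots<i_r\}$ of $\{1,\dots,n\}$ put $w_I=w_{i_1}\cdots w_{i_r}$ ($w_\emptyset=1$), of degree $\sum_k\omega(i_k)$; the $w_I$ form an $M_{\mathfrak h^*}$-basis of $W$. $W\widetilde\otimes\mathcal F_R(M(n))=\bigoplus_{\alpha,\beta}W_\alpha\otimes\mathcal F_R(M(n))_{\alpha\beta}$ modulo $w\otimes\mu_l(f)a=\mu_W(f)w\otimes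 a$, with product $(v\otimes a)(w\otimes b)=vw\otimes ab$. There is a unique unital algebra homomorphism $R\colon W\to W\widetilde\otimes\mathcal F_R(M(n))$ with $R(w_i)=\sum_jw_j\otimes t_{ji}$ and $R(\mu_W(f)w)=(1\otimes\mu_r(f))R(w)$. Define $\xi^I_J$ for $\#I=\#J$ by $R(w_J)=\sum_{\#I=\#J}w_I\otimes\xi^I_J$ and $\xi^I_J=0$ for $\#I\ne\#J$. The elements $\eta^I_J$. $V$ is the unital associative algebra generated by $v_1,\dots,v_n$ and a copy of $M_{\mathfrak h^*}$ (elements $f(\underline\lambda)=\mu_V(f)$), with relations $v_i^2=0$, $v_iv_j=-h(\lambda_i-\lambda_j)v_jv_i$ for $i<j$, $f(\underline\lambda)v_i=v_if(\underline\lambda+\omega(i))$. For an ordered subset $I=\{i_1<\dots<i_r\}$ put $v_I=v_{i_r}\cdots v_{i_1}$ (decreasing order, $v_\emptyset=1$), of degree $\sum_k\omega(i_k)$; the $v_I$ form an $M_{\mathfrak h^*}$-basis of $V$. $\mathcal F_R(M(n))\widetilde\otimes V=\bigoplus_{\alpha,\beta}\mathcal F_R(M(n))_{\alpha\beta}\otimes V_\beta$ modulo $\mu_r(f)a\otimes v=a\otimes\mu_V(f)v$, with product $(a\otimes v)(b\otimes w)=ab\otimes vw$. There is a unique unital algebra homomorphism $L\colon V\to\mathcal F_R(M(n))\widetilde\otimes V$ with $L(v_i)=\sum_jt_{ij}\otimes v_j$ and $L(\mu_V(f)v)=(\mu_l(f)\otimes1)L(v)$. Define $\eta^I_J$ for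 $\#I=\#J$ by $L(v_I)=\sum_{\#J=\#I}\eta^I_J\otimes v_J$ and $\eta^I_J=0$ for $\#I\ne\#J$. *)

theory Defs
  imports
    "HOL-Complex_Analysis.Complex_Analysis"
    "HOL-Algebra.QuotRing"
    "HOL-Algebra.Module"
    "HOL-Library.Poly_Mapping"
begin

section \<open>Meromorphic functions on the space of tuples of complex numbers\<close>

definition holo_on :: "(complex ^ 'n) set \<Rightarrow> (complex ^ 'n \<Rightarrow> complex) \<Rightarrow> bool" where
  "holo_on U f \<longleftrightarrow>
     (\<forall>z\<in>U. \<exists>D. (f has_derivative D) (at z) \<and> (\<forall>c v. D (c *s v) = c * D v))"

definition nowhere_null_on :: "'a::topological_space set \<Rightarrow> ('a \<Rightarrow> complex) \<Rightarrow> bool" where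
  "nowhere_null_on U h \<longleftrightarrow> (\<forall>V. open V \<and> V \<noteq> {} \<and> V \<subseteq> U \<longrightarrow> (\<exists>z\<in>V. h z \<noteq> 0))"

text \<open>A meromorphic function is locally a quotient of holomorphic functions. It is represented
  by total functions; the values on the zero set of the local denominators are arbitrary,
  and two representatives are identified when they agree on a dense open set.\<close>

definition mero_fun :: "(complex ^ 'n \<Rightarrow> complex) \<Rightarrow> bool" where
  "mero_fun f \<longleftrightarrow>
     (\<forall>p. \<exists>U g h. open U \<and> p \<in> U \<and> holo_on U g \<and> holo_on U h \<and> nowhere_null_on U h \<and>
        (\<forall>z\<in>U. h z \<noteq> 0 \<longrightarrow> f z = g z / h z))"

definition agree_dense :: "('a::topological_space \<Rightarrow> complex) \<Rightarrow> ('a \<Rightarrow> complex) \<Rightarrow> bool" where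
  "agree_dense f f' \<longleftrightarrow> (\<exists>D. open D \<and> closure D = UNIV \<and> (\<forall>z\<in>D. f z = f' z))"

definition mero_rel :: "(complex ^ 'n \<Rightarrow> complex) \<Rightarrow> (complex ^ 'n \<Rightarrow> complex) \<Rightarrow> bool" where
  "mero_rel f f' \<longleftrightarrow> mero_fun f \<and> mero_fun f' \<and> agree_dense f f'"

lemma agree_dense_iff:
  "agree_dense f f' \<longleftrightarrow>
    (\<forall>V. open V \<and> V \<noteq> {} \<longrightarrow> (\<exists>V'. open V' \<and> V' \<noteq> {} \<and> V' \<subseteq> V \<and> (\<forall>z\<in>V'. f z = f' z)))"
    (is "_ \<longleftrightarrow> ?R")
proof
  assume "agree_dense f f'"
  then obtain D where D: "open D" "closure D = UNIV" "\<forall>z\<in>D. f z = f' z"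
    unfolding agree_dense_def by blast
  show ?R
  proof (intro allI impI)
    fix V :: "'a set" assume V: "open V \<and> V \<noteq> {}"
    then have "V \<inter> D \<noteq> {}"
      using D(2) open_Int_closure_eq_empty[of V D] by auto
    then show "\<exists>V'. open V' \<and> V' \<noteq> {} \<and> V' \<subseteq> V \<and> (\<forall>z\<in>V'. f z = f' z)"
      using V D by (intro exI[of _ "V \<inter> D"]) auto
  qed
next
  assume R: ?R
  define D where "D = \<Union>{V. open V \<and> (\<forall>z\<in>V. f z = f' z)}"
  have "open D" unfolding D_def by blast
  moreover have "closure D = UNIV"
  proof (rule ccontr)
    assume "closure D \<noteq> UNIV"
    then have "open (- closure D) \<and> - closure D \<noteq> {}" by auto
    then obtain V' where V': "open V'" "V' \<noteq> {}" "V' \<subseteq> - closure D" "\<forall>z\<in>V'. f z = f' z"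
      using R by meson
    then have "V' \<subseteq> D" unfolding D_def by blast
    then show False using V' closure_subset by blast
  qed
  ultimately show "agree_dense f f'"
    unfolding agree_dense_def D_def by blast
qed

lemma agree_dense_refl [simp]: "agree_dense f f"
  unfolding agree_dense_iff by blast

lemma agree_dense_sym: "agree_dense f f' \<Longrightarrow> agree_dense f' f"
  unfolding agree_dense_def by metis

lemma agree_dense_op2:
  assumes "agree_dense f f'" "agree_dense g g'"
  shows "agree_dense (\<lambda>z. F (f z) (g z)) (\<lambda>z. F (f' z) (g' z))"
  unfolding agree_dense_iff
proof (intro allI impI)
  fix V :: "'a set" assume V: "open V \<and> V \<noteq> {}"
  then obtain V1 where V1: "open V1" "V1 \<noteq> {}" "V1 \<subseteq> V" "\<forall>z\<in>V1. f z = f' z"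
    using assms(1) unfolding agree_dense_iff by meson
  then obtain V2 where V2: "open V2" "V2 \<noteq> {}" "V2 \<subseteq> V1" "\<forall>z\<in>V2. g z = g' z"
    using assms(2) unfolding agree_dense_iff by meson
  show "\<exists>V'. open V' \<and> V' \<noteq> {} \<and> V' \<subseteq> V \<and> (\<forall>z\<in>V'. F (f z) (g z) = F (f' z) (g' z))"
    using V1 V2 by (intro exI[of _ V2]) auto
qed

lemma agree_dense_trans:
  assumes "agree_dense f g" "agree_dense g h"
  shows "agree_dense f h"
  unfolding agree_dense_iff
proof (intro allI impI)
  fix V :: "'a set" assume V: "open V \<and> V \<noteq> {}"
  then obtain V1 where V1: "open V1" "V1 \<noteq> {}" "V1 \<subseteq> V" "\<forall>z\<in>V1. f z = g z"
    using assms(1) unfolding agree_dense_iff by meson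
  then obtain V2 where V2: "open V2" "V2 \<noteq> {}" "V2 \<subseteq> V1" "\<forall>z\<in>V2. g z = h z"
    using assms(2) unfolding agree_dense_iff by meson
  show "\<exists>V'. open V' \<and> V' \<noteq> {} \<and> V' \<subseteq> V \<and> (\<forall>z\<in>V'. f z = h z)"
    using V1 V2 by (intro exI[of _ V2]) auto
qed

lemma holo_on_const [simp]: "holo_on U (\<lambda>_. c)"
  unfolding holo_on_def by (auto intro!: exI[of _ "\<lambda>_. 0"])

lemma holo_on_subset: "holo_on U f \<Longrightarrow> V \<subseteq> U \<Longrightarrow> holo_on V f"
  unfolding holo_on_def by blast

lemma holo_on_add:
  assumes "holo_on U f" "holo_on U g" shows "holo_on U (\<lambda>z. f z + g z)"
  unfolding holo_on_def
proof
  fix z assume "z \<in> U"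
  then obtain D E where "(f has_derivative D) (at z)" "\<forall>c v. D (c *s v) = c * D v"
    "(g has_derivative E) (at z)" "\<forall>c v. E (c *s v) = c * E v"
    using assms unfolding holo_on_def by meson
  then show "\<exists>D. ((\<lambda>z. f z + g z) has_derivative D) (at z) \<and> (\<forall>c v. D (c *s v) = c * D v)"
    by (intro exI[of _ "\<lambda>v. D v + E v"]) (auto intro!: derivative_intros simp: algebra_simps)
qed

lemma holo_on_mult:
  assumes "holo_on U f" "holo_on U g" shows "holo_on U (\<lambda>z. f z * g z)"
  unfolding holo_on_def
proof
  fix z assume "z \<in> U"
  then obtain D E where "(f has_derivative D) (at z)" "\<forall>c v. D (c *s v) = c * D v"
    "(g has_derivative E) (at z)" "\<forall>c v. E (c *s v) = c * E v"
    using assms unfolding holo_on_def by meson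
  then show "\<exists>D. ((\<lambda>z. f z * g z) has_derivative D) (at z) \<and> (\<forall>c v. D (c *s v) = c * D v)"
    by (intro exI[of _ "\<lambda>v. f z * E v + D v * g z"])
       (auto intro!: derivative_eq_intros simp: algebra_simps)
qed

lemma holo_on_imp_continuous_on: "holo_on U f \<Longrightarrow> continuous_on U f"
  unfolding holo_on_def
  by (meson continuous_at_imp_continuous_on has_derivative_continuous)

lemma holo_on_shift:
  assumes "holo_on U f" shows "holo_on ((\<lambda>z. z + a) -` U) (\<lambda>z. f (z + a))"
  unfolding holo_on_def
proof
  fix z assume "z \<in> (\<lambda>z. z + a) -` U"
  then obtain D where D: "(f has_derivative D) (at (z + a))" "\<forall>c v. D (c *s v) = c * D v"
    using assms unfolding holo_on_def by auto
  have "((\<lambda>z. z + a) has_derivative (\<lambda>v. v)) (at z)"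
    by (auto intro!: derivative_eq_intros)
  from has_derivative_compose[OF this D(1)] D(2)
  show "\<exists>D. ((\<lambda>z. f (z + a)) has_derivative D) (at z) \<and> (\<forall>c v. D (c *s v) = c * D v)"
    by blast
qed

lemma nowhere_null_on_subset: "nowhere_null_on U h \<Longrightarrow> V \<subseteq> U \<Longrightarrow> nowhere_null_on V h"
  unfolding nowhere_null_on_def by blast

lemma nowhere_null_on_open:
  assumes "nowhere_null_on U h" "continuous_on U h" "open V" "V \<noteq> {}" "V \<subseteq> U"
  obtains V' where "open V'" "V' \<noteq> {}" "V' \<subseteq> V" "\<And>z. z \<in> V' \<Longrightarrow> h z \<noteq> 0"
proof -
  have "continuous_on V h" using assms continuous_on_subset by blast
  then have "open (V \<inter> h -` (- {0}))"
    using assms(3) by (intro continuous_open_preimage) auto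
  moreover have "V \<inter> h -` (- {0}) \<noteq> {}"
    using assms unfolding nowhere_null_on_def by fastforce
  ultimately show ?thesis by (rule that) auto
qed

lemma nowhere_null_on_mult:
  assumes "nowhere_null_on U h" "nowhere_null_on U k" "continuous_on U h"
  shows "nowhere_null_on U (\<lambda>z. h z * k z)"
  unfolding nowhere_null_on_def
proof (intro allI impI)
  fix V assume V: "open V \<and> V \<noteq> {} \<and> V \<subseteq> U"
  then obtain V' where V': "open V'" "V' \<noteq> {}" "V' \<subseteq> V" "\<And>z. z \<in> V' \<Longrightarrow> h z \<noteq> 0"
    using nowhere_null_on_open[OF assms(1,3)] by metis
  then obtain z where "z \<in> V'" "k z \<noteq> 0"
    using assms(2) V unfolding nowhere_null_on_def by (metis order.trans)
  then show "\<exists>z\<in>V. h z * k z \<noteq> 0" using V' by auto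
qed

lemma mero_fun_quotient:
  assumes "holo_on UNIV g" "holo_on UNIV h" "nowhere_null_on UNIV h"
    "\<And>z. h z \<noteq> 0 \<Longrightarrow> f z = g z / h z"
  shows "mero_fun f"
  unfolding mero_fun_def using assms by (metis UNIV_I open_UNIV)

lemma mero_fun_const [simp]: "mero_fun (\<lambda>_. c)"
  by (rule mero_fun_quotient[of "\<lambda>_. c" "\<lambda>_. 1"]) (auto simp: nowhere_null_on_def)

lemma mero_fun_op2:
  assumes "mero_fun f" "mero_fun f'"
    and op: "\<And>a b c d :: complex. b \<noteq> 0 \<Longrightarrow> d \<noteq> 0 \<Longrightarrow> F (a / b) (c / d) = N a b c d / (b * d)"
    and hol: "\<And>(U :: (complex ^ 'n) set) a b c d. holo_on U a \<Longrightarrow> holo_on U b \<Longrightarrow> holo_on U c \<Longrightarrow>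
       holo_on U d \<Longrightarrow> holo_on U (\<lambda>z. N (a z) (b z) (c z) (d z))"
  shows "mero_fun (\<lambda>z :: complex ^ 'n. F (f z) (f' z))"
  unfolding mero_fun_def
proof
  fix p
  obtain U g h where U: "open U" "p \<in> U" "holo_on U g" "holo_on U h" "nowhere_null_on U h"
    "\<forall>z\<in>U. h z \<noteq> 0 \<longrightarrow> f z = g z / h z"
    using assms(1) unfolding mero_fun_def by meson
  obtain U' g' h' where U': "open U'" "p \<in> U'" "holo_on U' g'" "holo_on U' h'"
    "nowhere_null_on U' h'" "\<forall>z\<in>U'. h' z \<noteq> 0 \<longrightarrow> f' z = g' z / h' z"
    using assms(2) unfolding mero_fun_def by meson
  let ?U = "U \<inter> U'"
  have s: "holo_on ?U g" "holo_on ?U h" "holo_on ?U g'" "holo_on ?U h'"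
    "nowhere_null_on ?U h" "nowhere_null_on ?U h'"
    using U U' holo_on_subset nowhere_null_on_subset by (metis inf_le1 inf_le2)+
  show "\<exists>U g h. open U \<and> p \<in> U \<and> holo_on U g \<and> holo_on U h \<and> nowhere_null_on U h \<and>
      (\<forall>z\<in>U. h z \<noteq> 0 \<longrightarrow> F (f z) (f' z) = g z / h z)"
    using U U' s
    by (intro exI[of _ ?U] exI[of _ "\<lambda>z. N (g z) (h z) (g' z) (h' z)"] exI[of _ "\<lambda>z. h z * h' z"])
       (auto intro!: hol holo_on_mult nowhere_null_on_mult holo_on_imp_continuous_on simp: op)
qed

lemma mero_fun_add: "mero_fun f \<Longrightarrow> mero_fun g \<Longrightarrow> mero_fun (\<lambda>z. f z + g z)"
  by (rule mero_fun_op2[where F = "(+)" and N = "\<lambda>a b c d. a * d + c * b"])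
     (auto intro!: holo_on_add holo_on_mult simp: field_simps)

lemma mero_fun_mult: "mero_fun f \<Longrightarrow> mero_fun g \<Longrightarrow> mero_fun (\<lambda>z. f z * g z)"
  by (rule mero_fun_op2[where F = "(*)" and N = "\<lambda>a b c d. a * c"])
     (auto intro!: holo_on_add holo_on_mult simp: field_simps)

lemma mero_fun_uminus: "mero_fun f \<Longrightarrow> mero_fun (\<lambda>z. - f z)"
  using mero_fun_mult[of "\<lambda>_. - 1" f] by simp

lemma mero_fun_shift:
  assumes "mero_fun f" shows "mero_fun (\<lambda>z. f (z + a))"
  unfolding mero_fun_def
proof
  fix p
  obtain U g h where U: "open U" "p + a \<in> U" "holo_on U g" "holo_on U h" "nowhere_null_on U h"
    "\<forall>z\<in>U. h z \<noteq> 0 \<longrightarrow> f z = g z / h z"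
    using assms unfolding mero_fun_def by meson
  let ?U = "(\<lambda>z. z + a) -` U"
  have "open ?U" using U(1) by (intro open_vimage continuous_intros)
  moreover have "nowhere_null_on ?U (\<lambda>z. h (z + a))"
    unfolding nowhere_null_on_def
  proof (intro allI impI)
    fix V assume V: "open V \<and> V \<noteq> {} \<and> V \<subseteq> ?U"
    then have "open ((\<lambda>z. z + a) ` V)"
      using open_translation[of V a] by (simp add: add.commute)
    then have "\<exists>z \<in> (\<lambda>z. z + a) ` V. h z \<noteq> 0"
      using V U(5) unfolding nowhere_null_on_def by blast
    then show "\<exists>z\<in>V. h (z + a) \<noteq> 0" by auto
  qed
  ultimately show "\<exists>U g h. open U \<and> p \<in> U \<and> holo_on U g \<and> holo_on U h \<and> nowhere_null_on U h \<and>
      (\<forall>z\<in>U. h z \<noteq> 0 \<longrightarrow> f (z + a) = g z / h z)"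
    using U holo_on_shift[of U _ a]
    by (intro exI[of _ ?U] exI[of _ "\<lambda>z. g (z + a)"] exI[of _ "\<lambda>z. h (z + a)"]) auto
qed

lemma agree_dense_shift:
  fixes f g :: "complex ^ 'n \<Rightarrow> complex"
  assumes "agree_dense f g" shows "agree_dense (\<lambda>z. f (z + a)) (\<lambda>z. g (z + a))"
  unfolding agree_dense_iff
proof (intro allI impI)
  fix V :: "(complex ^ 'n) set" assume V: "open V \<and> V \<noteq> {}"
  then have "open ((\<lambda>z. z + a) ` V) \<and> (\<lambda>z. z + a) ` V \<noteq> {}"
    using open_translation[of V a] by (simp add: add.commute)
  then obtain V' where V': "open V'" "V' \<noteq> {}" "V' \<subseteq> (\<lambda>z. z + a) ` V" "\<forall>z\<in>V'. f z = g z"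
    using assms unfolding agree_dense_iff by meson
  have "(\<lambda>z. z + a) -` V' \<subseteq> V" "(\<lambda>z. z + a) -` V' \<noteq> {}"
    using V' by auto
  then show "\<exists>V'. open V' \<and> V' \<noteq> {} \<and> V' \<subseteq> V \<and> (\<forall>z\<in>V'. f (z + a) = g (z + a))"
    using V' by (intro exI[of _ "(\<lambda>z. z + a) -` V'"])
      (auto intro!: open_vimage continuous_intros)
qed

lemma holo_on_line:
  fixes f :: "complex ^ 'n \<Rightarrow> complex"
  assumes "holo_on U f"
  shows "(\<lambda>c. f (a + c *s b)) holomorphic_on ((\<lambda>c. a + c *s b) -` U)"
  unfolding holomorphic_on_def
proof
  fix c assume c: "c \<in> (\<lambda>c. a + c *s b) -` U"
  then obtain D where D: "(f has_derivative D) (at (a + c *s b))" "\<forall>c v. D (c *s v) = c * D v"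
    using assms unfolding holo_on_def by auto
  have bl: "bounded_linear (\<lambda>c::complex. c *s b)"
    by (rule linear_conv_bounded_linear[THEN iffD1])
       (rule linearI; simp add: vec_eq_iff algebra_simps)
  then have "((\<lambda>c. a + c *s b) has_derivative (\<lambda>v. v *s b)) (at c)"
    by (auto intro!: derivative_eq_intros bounded_linear.has_derivative[OF bl])
  from has_derivative_compose[OF this D(1)] D(2)
  have "((\<lambda>c. f (a + c *s b)) has_derivative (\<lambda>v. D b * v)) (at c)"
    by (simp add: mult.commute)
  then show "(\<lambda>c. f (a + c *s b)) field_differentiable at c within (\<lambda>c. a + c *s b) -` U"
    unfolding field_differentiable_def has_field_derivative_def
    using has_derivative_at_withinI by blast
qed

lemma continuous_on_line [continuous_intros]:
  "continuous_on S (\<lambda>c::complex. a + c *s (b :: complex ^ 'n))"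
proof -
  have "bounded_linear (\<lambda>c::complex. c *s b)"
    by (rule linear_conv_bounded_linear[THEN iffD1])
       (rule linearI; simp add: vec_eq_iff algebra_simps)
  then show ?thesis
    by (intro continuous_intros linear_continuous_on)
qed

lemma holo_on_ball_identity:
  fixes f :: "complex ^ 'n \<Rightarrow> complex"
  assumes f: "holo_on (ball p r) f" and V: "open V" "V \<noteq> {}" "V \<subseteq> ball p r"
    and z: "\<And>z. z \<in> V \<Longrightarrow> f z = 0" and x: "x \<in> ball p r"
  shows "f x = 0"
proof -
  obtain a where a: "a \<in> V" using V by auto
  let ?l = "\<lambda>c::complex. a + c *s (x - a)"
  have lin: "linear (\<lambda>c::complex. c *s (x - a))"
    by (rule linearI; simp add: vec_eq_iff algebra_simps)
  have op: "open (?l -` S)" if "open S" for S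
    using that by (intro open_vimage continuous_intros)
  have "convex (?l -` ball p r)"
  proof (rule convexI)
    fix c d :: complex and u v :: real
    assume *: "c \<in> ?l -` ball p r" "d \<in> ?l -` ball p r" "0 \<le> u" "0 \<le> v" "u + v = 1"
    have "u *\<^sub>R ?l c + v *\<^sub>R ?l d = (u + v) *\<^sub>R a + (u *\<^sub>R c + v *\<^sub>R d) *s (x - a)"
      by (simp add: vec_eq_iff scaleR_conv_of_real[where 'a = complex] algebra_simps)
    then have "?l (u *\<^sub>R c + v *\<^sub>R d) = u *\<^sub>R ?l c + v *\<^sub>R ?l d"
      using *(5) by simp
    then show "u *\<^sub>R c + v *\<^sub>R d \<in> ?l -` ball p r"
      using convexD[OF convex_ball, of "?l c" p r "?l d" u v] * by simp
  qed
  then have "connected (?l -` ball p r)" by (rule convex_connected)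
  moreover have "0 \<in> ?l -` V" using a by simp
  then have "?l -` V \<noteq> {}" by blast
  moreover have "1 \<in> ?l -` ball p r" using x by simp
  ultimately have "f (?l 1) = 0"
    using analytic_continuation_open[of "?l -` V" "?l -` ball p r" "\<lambda>c. f (?l c)" "\<lambda>_. 0" 1]
      holo_on_line[OF f, of a "x - a"] op V z by auto
  then show ?thesis by simp
qed

lemma mero_fun_cases:
  fixes f :: "complex ^ 'n \<Rightarrow> complex"
  assumes "mero_fun f"
  obtains
    (null) h B where "\<And>p. open (B p)" "\<And>p. p \<in> B p" "\<And>p. holo_on (B p) (h p)"
      "\<And>p. nowhere_null_on (B p) (h p)" "\<And>p z. z \<in> B p \<Longrightarrow> h p z \<noteq> 0 \<Longrightarrow> f z = 0"
  | (nonnull) g h B where "\<And>p. open (B p)" "\<And>p. p \<in> B p" "\<And>p. holo_on (B p) (h p)"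
      "\<And>p. holo_on (B p) (g p)" "\<And>p. nowhere_null_on (B p) (h p)"
      "\<And>p. nowhere_null_on (B p) (g p)"
      "\<And>p z. z \<in> B p \<Longrightarrow> h p z \<noteq> 0 \<Longrightarrow> f z = g p z / h p z"
proof -
  obtain U g h where U: "\<And>p. open (U p)" "\<And>p. p \<in> U p" "\<And>p. holo_on (U p) (g p)"
    "\<And>p. holo_on (U p) (h p)" "\<And>p. nowhere_null_on (U p) (h p)"
    "\<And>p z. z \<in> U p \<Longrightarrow> h p z \<noteq> 0 \<Longrightarrow> f z = g p z / h p z"
    using assms unfolding mero_fun_def by metis
  have "\<forall>p. \<exists>r>0. ball p r \<subseteq> U p" using U(1,2) open_contains_ball by blast
  then obtain r where r: "\<And>p. r p > 0" "\<And>p. ball p (r p) \<subseteq> U p" by metis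
  define B where "B p = ball p (r p)" for p
  have B: "\<And>p. open (B p)" "\<And>p. p \<in> B p" "\<And>p. holo_on (B p) (h p)"
    "\<And>p. holo_on (B p) (g p)" "\<And>p. nowhere_null_on (B p) (h p)"
    "\<And>p z. z \<in> B p \<Longrightarrow> h p z \<noteq> 0 \<Longrightarrow> f z = g p z / h p z"
  proof -
    show "open (B p)" "p \<in> B p" for p using r(1) unfolding B_def by auto
    show "holo_on (B p) (h p)" for p using holo_on_subset[OF U(4) r(2)] unfolding B_def .
    show "holo_on (B p) (g p)" for p using holo_on_subset[OF U(3) r(2)] unfolding B_def .
    show "nowhere_null_on (B p) (h p)" for p
      using nowhere_null_on_subset[OF U(5) r(2)] unfolding B_def .
    show "f z = g p z / h p z" if "z \<in> B p" "h p z \<noteq> 0" for p z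
      using U(6)[of z p] r(2)[of p] that unfolding B_def by blast
  qed
  define A where "A = {p. \<forall>z\<in>B p. g p z = 0}"
  have key: "p \<in> A \<longleftrightarrow> p' \<in> A" if p': "p' \<in> B p" for p p'
  proof -
    have W: "open (B p \<inter> B p')" "B p \<inter> B p' \<noteq> {}" using B p' by auto
    obtain W1 where W1: "open W1" "W1 \<noteq> {}" "W1 \<subseteq> B p \<inter> B p'" "\<And>z. z \<in> W1 \<Longrightarrow> h p z \<noteq> 0"
      using nowhere_null_on_open[OF B(5)[of p] holo_on_imp_continuous_on[OF B(3)] W(1,2)] by auto
    obtain W2 where W2: "open W2" "W2 \<noteq> {}" "W2 \<subseteq> W1" "\<And>z. z \<in> W2 \<Longrightarrow> h p' z \<noteq> 0"
      using nowhere_null_on_open[OF B(5)[of p'] holo_on_imp_continuous_on[OF B(3)] W1(1,2)] W1(3)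
      by auto
    have eq: "g p z = 0 \<longleftrightarrow> g p' z = 0" if "z \<in> W2" for z
      using B(6)[of z p] B(6)[of z p'] W1 W2 that by (metis Int_iff divide_eq_0_iff subsetD)
    have id: "q \<in> A" if "\<And>z. z \<in> W2 \<Longrightarrow> g q z = 0" "W2 \<subseteq> B q" for q
      using holo_on_ball_identity[of q "r q" "g q" W2] B(4)[of q] that W2
      unfolding A_def B_def by auto
    show ?thesis
      using id[of p] id[of p'] eq W1 W2 unfolding A_def by blast
  qed
  have "open A" unfolding open_subopen[of A] using B(1,2) key by (metis subsetI)
  moreover have "open (- A)" unfolding open_subopen[of "- A"] using B(1,2) key
    by (metis ComplD ComplI subsetI)
  ultimately have "A = {} \<or> A = UNIV"
    using connected_UNIV unfolding connected_clopen
    by (metis clopen closed_open double_compl)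
  then show ?thesis
  proof
    assume "A = UNIV"
    then show ?thesis using null[of B h] B unfolding A_def by auto
  next
    assume "A = {}"
    have "nowhere_null_on (B p) (g p)" for p
      unfolding nowhere_null_on_def
    proof (intro allI impI, rule ccontr)
      fix V assume V: "open V \<and> V \<noteq> {} \<and> V \<subseteq> B p" "\<not> (\<exists>z\<in>V. g p z \<noteq> 0)"
      then have "p \<in> A"
        using holo_on_ball_identity[of p "r p" "g p" V] B(4)[of p] unfolding A_def B_def by auto
      then show False using \<open>A = {}\<close> by auto
    qed
    then show ?thesis using nonnull[of B h g] B by auto
  qed
qed

lemma agree_denseI_local:
  assumes "\<And>p. open (B p)" "\<And>p. p \<in> B p" "\<And>p. continuous_on (B p) (k p)"
    "\<And>p. nowhere_null_on (B p) (k p)" "\<And>p z. z \<in> B p \<Longrightarrow> k p z \<noteq> 0 \<Longrightarrow> f z = f' z"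
  shows "agree_dense f f'"
  unfolding agree_dense_iff
proof (intro allI impI)
  fix V :: "'a set" assume V: "open V \<and> V \<noteq> {}"
  then obtain p where p: "p \<in> V" by auto
  obtain V' where "open V'" "V' \<noteq> {}" "V' \<subseteq> V \<inter> B p" "\<And>z. z \<in> V' \<Longrightarrow> k p z \<noteq> 0"
    using nowhere_null_on_open[OF assms(4,3)[of p], of "V \<inter> B p"] assms(1,2)[of p] p V by blast
  then show "\<exists>V'. open V' \<and> V' \<noteq> {} \<and> V' \<subseteq> V \<and> (\<forall>z\<in>V'. f z = f' z)"
    using assms(5) by (intro exI[of _ V']) blast
qed

lemma mero_fun_inverse:
  assumes "mero_fun f" shows "mero_fun (\<lambda>z. inverse (f z))"
  using assms
proof (cases rule: mero_fun_cases)
  case (null h B)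
  then show ?thesis unfolding mero_fun_def
    by (intro allI, rule_tac x = "B p" in exI, rule_tac x = "\<lambda>_. 0" in exI,
        rule_tac x = "h p" in exI) auto
next
  case (nonnull g h B)
  show ?thesis unfolding mero_fun_def
  proof
    fix p
    show "\<exists>U g h. open U \<and> p \<in> U \<and> holo_on U g \<and> holo_on U h \<and> nowhere_null_on U h \<and>
        (\<forall>z\<in>U. h z \<noteq> 0 \<longrightarrow> inverse (f z) = g z / h z)"
      using nonnull
      by (intro exI[of _ "B p"] exI[of _ "\<lambda>z. h p z * h p z"] exI[of _ "\<lambda>z. g p z * h p z"])
         (auto intro!: holo_on_mult nowhere_null_on_mult holo_on_imp_continuous_on)
  qed
qed

lemma mero_fun_inverse_mult:
  assumes "mero_fun f" "\<not> agree_dense f (\<lambda>_. 0)"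
  shows "agree_dense (\<lambda>z. inverse (f z) * f z) (\<lambda>_. 1)"
  using assms(1)
proof (cases rule: mero_fun_cases)
  case (null h B)
  then have "agree_dense f (\<lambda>_. 0)"
    by (intro agree_denseI_local[of B h]) (auto intro: holo_on_imp_continuous_on)
  then show ?thesis using assms by simp
next
  case (nonnull g h B)
  then show ?thesis
    by (intro agree_denseI_local[of B "\<lambda>p z. g p z * h p z"])
       (auto intro!: holo_on_imp_continuous_on nowhere_null_on_mult holo_on_mult)
qed

quotient_type 'n mero = "complex ^ 'n \<Rightarrow> complex" / partial: mero_rel
proof (rule part_equivpI)
  show "\<exists>f :: complex ^ 'n \<Rightarrow> complex. mero_rel f f"
    by (rule exI[of _ "\<lambda>_. 0"]) (simp add: mero_rel_def)
  show "symp (mero_rel :: (complex ^ 'n \<Rightarrow> complex) \<Rightarrow> _)"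
    unfolding symp_def mero_rel_def using agree_dense_sym by blast
  show "transp (mero_rel :: (complex ^ 'n \<Rightarrow> complex) \<Rightarrow> _)"
    unfolding transp_def mero_rel_def using agree_dense_trans by blast
qed

instantiation mero :: (finite) field
begin

lift_definition zero_mero :: "'a mero" is "\<lambda>_. 0" by (simp add: mero_rel_def)
lift_definition one_mero :: "'a mero" is "\<lambda>_. 1" by (simp add: mero_rel_def)
lift_definition plus_mero :: "'a mero \<Rightarrow> 'a mero \<Rightarrow> 'a mero" is "\<lambda>f g z. f z + g z"
  by (auto simp: mero_rel_def intro: mero_fun_add agree_dense_op2)
lift_definition times_mero :: "'a mero \<Rightarrow> 'a mero \<Rightarrow> 'a mero" is "\<lambda>f g z. f z * g z"
  by (auto simp: mero_rel_def intro: mero_fun_mult agree_dense_op2)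
lift_definition uminus_mero :: "'a mero \<Rightarrow> 'a mero" is "\<lambda>f z. - f z"
  by (auto simp: mero_rel_def intro: mero_fun_uminus agree_dense_op2[where F = "\<lambda>a b. - a"])
lift_definition inverse_mero :: "'a mero \<Rightarrow> 'a mero" is "\<lambda>f z. inverse (f z)"
  by (auto simp: mero_rel_def intro: mero_fun_inverse agree_dense_op2[where F = "\<lambda>a b. inverse a"])
definition minus_mero :: "'a mero \<Rightarrow> 'a mero \<Rightarrow> 'a mero" where
  "minus_mero f g = f + - g"
definition divide_mero :: "'a mero \<Rightarrow> 'a mero \<Rightarrow> 'a mero" where
  "divide_mero f g = f * inverse g"

instance
proof
  fix a b c :: "'a mero"
  show "a * b * c = a * (b * c)"
    by transfer (auto simp: mero_rel_def mult.assoc intro: mero_fun_mult)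
  show "a * b = b * a"
    by transfer (auto simp: mero_rel_def mult.commute intro: mero_fun_mult)
  show "1 * a = a"
    by transfer (auto simp: mero_rel_def)
  show "a + b + c = a + (b + c)"
    by transfer (auto simp: mero_rel_def add.assoc intro: mero_fun_add)
  show "a + b = b + a"
    by transfer (auto simp: mero_rel_def add.commute intro: mero_fun_add)
  show "0 + a = a"
    by transfer (auto simp: mero_rel_def)
  show "- a + a = 0"
    by transfer (auto simp: mero_rel_def)
  show "a - b = a + - b"
    by (simp add: minus_mero_def)
  show "(a + b) * c = a * c + b * c"
    by transfer (auto simp: mero_rel_def distrib_right intro: mero_fun_add mero_fun_mult)
  show "(0::'a mero) \<noteq> 1"
    by transfer (force simp: mero_rel_def agree_dense_iff)
  show "a \<noteq> 0 \<Longrightarrow> inverse a * a = 1"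
    by transfer (auto simp: mero_rel_def intro: mero_fun_inverse_mult mero_fun_inverse mero_fun_mult)
  show "a div b = a * inverse b"
    by (simp add: divide_mero_def)
  show "inverse (0::'a mero) = 0"
    by transfer (auto simp: mero_rel_def)
qed

end

lift_definition mconst :: "complex \<Rightarrow> ('n::finite) mero" is "\<lambda>c _. c"
  by (simp add: mero_rel_def)

lift_definition mshift :: "complex ^ 'n \<Rightarrow> ('n::finite) mero \<Rightarrow> 'n mero" is "\<lambda>a f z. f (z + a)"
  by (auto simp: mero_rel_def intro: mero_fun_shift agree_dense_shift)


text \<open>The deformation parameter is \<open>q = exp \<tau>\<close>, and \<open>q\<^sup>z\<close> means \<open>exp (\<tau> z)\<close>: fixing \<open>\<tau>\<close> fixes the branch
  of the logarithm of \<open>q\<close>. The formulas make sense exactly when \<open>q\<^sup>-\<^sup>2\<^sup>z\<close> is not constantly 1,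
  that is, when \<open>\<tau> \<noteq> 0\<close>.\<close>

definition qpow :: "complex \<Rightarrow> complex \<Rightarrow> complex" where
  "qpow \<tau> z = exp (\<tau> * z)"

definition h0_fun :: "complex \<Rightarrow> complex \<Rightarrow> complex" where
  "h0_fun \<tau> z = (qpow \<tau> (- 1) - qpow \<tau> 1) / (qpow \<tau> (- 2 * z) - 1)"

definition g_fun :: "complex \<Rightarrow> complex \<Rightarrow> complex" where
  "g_fun \<tau> z = (qpow \<tau> (- 2 * z) - qpow \<tau> (- 2)) * (qpow \<tau> (- 2 * z) - qpow \<tau> 2)
      / (qpow \<tau> (- 2 * z) - 1)\<^sup>2"

definition h_fun :: "complex \<Rightarrow> complex \<Rightarrow> complex" where
  "h_fun \<tau> z = qpow \<tau> 1 - h0_fun \<tau> z"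

definition mdiff :: "(complex \<Rightarrow> complex) \<Rightarrow> 'n::finite \<Rightarrow> 'n \<Rightarrow> 'n mero" where
  "mdiff F a b = abs_mero (\<lambda>l. F (l $ a - l $ b))"

lemma holo_on_qpow_diff: "holo_on U (\<lambda>l :: complex ^ 'n. qpow \<tau> (- 2 * (l $ a - l $ b)))"
  unfolding holo_on_def
proof
  fix z :: "complex ^ 'n"
  have "((\<lambda>l. - 2 * \<tau> * (l $ a - l $ b)) has_derivative (\<lambda>l. - 2 * \<tau> * (l $ a - l $ b))) (at z)"
    by (intro bounded_linear_imp_has_derivative linear_conv_bounded_linear[THEN iffD1] linearI)
       (simp_all add: algebra_simps)
  moreover have "(exp has_derivative (\<lambda>v. exp (- 2 * \<tau> * (z $ a - z $ b)) * v))
      (at (- 2 * \<tau> * (z $ a - z $ b)))"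
    using DERIV_exp by (simp add: has_field_derivative_def)
  ultimately have "((\<lambda>l. exp (- 2 * \<tau> * (l $ a - l $ b))) has_derivative
      (\<lambda>v. exp (- 2 * \<tau> * (z $ a - z $ b)) * (- 2 * \<tau> * (v $ a - v $ b)))) (at z)"
    using has_derivative_compose by blast
  then show "\<exists>D. ((\<lambda>l. qpow \<tau> (- 2 * (l $ a - l $ b))) has_derivative D) (at z) \<and>
      (\<forall>c v. D (c *s v) = c * D v)"
    unfolding qpow_def by (auto simp: algebra_simps intro!: exI)
qed

lemma norm_axis_complex: "norm (axis a (x :: complex)) = norm x"
  by (simp add: norm_vec_def axis_def L2_set_def if_distrib[of norm]
      if_distrib[of "\<lambda>x. x\<^sup>2"] cong: if_cong)

lemma nowhere_null_on_qpow_diff: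
  fixes a b :: "'n::finite"
  assumes "\<tau> \<noteq> 0" "a \<noteq> b"
  shows "nowhere_null_on U (\<lambda>l. qpow \<tau> (- 2 * (l $ a - l $ b)) - 1)"
  unfolding nowhere_null_on_def
proof (intro allI impI, rule ccontr)
  fix V :: "(complex ^ 'n) set"
  assume V: "open V \<and> V \<noteq> {} \<and> V \<subseteq> U" "\<not> (\<exists>l\<in>V. qpow \<tau> (- 2 * (l $ a - l $ b)) - 1 \<noteq> 0)"
  then obtain p where p: "p \<in> V" by auto
  then obtain r where r: "r > 0" "ball p r \<subseteq> V" using V open_contains_ball by blast
  define t where "t = min (r / 2) (1 / norm \<tau>)"
  have t: "t > 0" "t < r" "t * norm \<tau> \<le> 1"
    using r assms unfolding t_def by (auto simp: min_def field_simps)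
  define p' where "p' = p + axis a (of_real t)"
  have "dist p p' = t" using t(1) by (simp add: p'_def dist_norm norm_axis_complex)
  then have "p' \<in> V" using r t by auto
  then have "exp (- 2 * \<tau> * (p $ a - p $ b)) = 1" "exp (- 2 * \<tau> * (p' $ a - p' $ b)) = 1"
    using V(2) p unfolding qpow_def by (auto simp: algebra_simps)
  moreover have "- 2 * \<tau> * (p' $ a - p' $ b) = - 2 * \<tau> * (p $ a - p $ b) + - 2 * \<tau> * of_real t"
    using assms(2) by (simp add: p'_def axis_def algebra_simps)
  ultimately have "exp (- 2 * \<tau> * of_real t) = 1" by (metis exp_add mult_1)
  then obtain n :: int where n: "Re (- 2 * \<tau> * of_real t) = 0"
    "Im (- 2 * \<tau> * of_real t) = of_int (2 * n) * pi"
    unfolding exp_eq_1 by auto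
  have "norm (- 2 * \<tau> * of_real t) \<le> 2" using t by (simp add: norm_mult algebra_simps)
  then have "\<bar>of_int (2 * n) * pi\<bar> \<le> 2" using n abs_Im_le_cmod by (metis order.trans)
  then have "\<bar>real_of_int n\<bar> * pi \<le> 1" by (simp add: abs_mult)
  have "n = 0"
  proof (rule ccontr)
    assume "n \<noteq> 0"
    then have "\<bar>real_of_int n\<bar> \<ge> 1" by linarith
    then have "\<bar>real_of_int n\<bar> * pi \<ge> 1 * 3" using pi_gt3 by (intro mult_mono) auto
    then show False using \<open>\<bar>real_of_int n\<bar> * pi \<le> 1\<close> by simp
  qed
  then have "- 2 * \<tau> * of_real t = 0" using n by (simp add: complex_eq_iff)
  then show False using assms t by simp
qed

lemma mero_fun_h0_g_h:
  fixes a b :: "'n::finite"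
  assumes "\<tau> \<noteq> 0" "a \<noteq> b"
  shows "mero_fun (\<lambda>l. h0_fun \<tau> (l $ a - l $ b))"
    and "mero_fun (\<lambda>l. g_fun \<tau> (l $ a - l $ b))"
    and "mero_fun (\<lambda>l. h_fun \<tau> (l $ a - l $ b))"
proof -
  let ?x = "\<lambda>l :: complex ^ 'n. qpow \<tau> (- 2 * (l $ a - l $ b))"
  have x: "mero_fun ?x"
    by (rule mero_fun_quotient[OF holo_on_qpow_diff[of _ \<tau> a b], where h = "\<lambda>_. 1"])
       (auto simp: nowhere_null_on_def)
  have xc: "mero_fun (\<lambda>l. ?x l + c)" for c
    by (rule mero_fun_add[OF x mero_fun_const])
  have i: "mero_fun (\<lambda>l. inverse (?x l + - 1))"
    by (rule mero_fun_inverse[OF xc])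
  show *: "mero_fun (\<lambda>l. h0_fun \<tau> (l $ a - l $ b))"
    using mero_fun_mult[OF mero_fun_const[of "qpow \<tau> (- 1) - qpow \<tau> 1"] i]
    by (simp add: h0_fun_def divide_inverse)
  show "mero_fun (\<lambda>l. g_fun \<tau> (l $ a - l $ b))"
    using mero_fun_mult[OF mero_fun_mult[OF xc[of "- qpow \<tau> (- 2)"] xc[of "- qpow \<tau> 2"]]
        mero_fun_mult[OF i i]]
    by (simp add: g_fun_def divide_inverse power2_eq_square)
  show "mero_fun (\<lambda>l. h_fun \<tau> (l $ a - l $ b))"
    using mero_fun_add[OF mero_fun_const[of "qpow \<tau> 1"] mero_fun_uminus[OF *]]
    by (simp add: h_fun_def)
qed


section \<open>Algebras given by generators and relations\<close>

definition monoid_algebra :: "('a, 'm) monoid_scheme \<Rightarrow> (complex, 'a \<Rightarrow>\<^sub>0 complex) module" where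
  "monoid_algebra G =
    \<lparr>carrier = {p. Poly_Mapping.keys p \<subseteq> carrier G},
     mult = (\<lambda>p r. \<Sum>x\<in>Poly_Mapping.keys p. \<Sum>y\<in>Poly_Mapping.keys r.
       Poly_Mapping.single (x \<otimes>\<^bsub>G\<^esub> y) (Poly_Mapping.lookup p x * Poly_Mapping.lookup r y)),
     one = Poly_Mapping.single \<one>\<^bsub>G\<^esub> 1,
     zero = 0,
     add = (+),
     smult = (\<lambda>c. Poly_Mapping.map ((*) c))\<rparr>"

lemma monoid_algebra_mult_superset:
  assumes "finite A" "Poly_Mapping.keys p \<subseteq> A" "finite B" "Poly_Mapping.keys r \<subseteq> B"
  shows "p \<otimes>\<^bsub>monoid_algebra G\<^esub> r =
    (\<Sum>x\<in>A. \<Sum>y\<in>B. Poly_Mapping.single (x \<otimes>\<^bsub>G\<^esub> y) (Poly_Mapping.lookup p x * Poly_Mapping.lookup r y))"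
proof -
  have "p \<otimes>\<^bsub>monoid_algebra G\<^esub> r = (\<Sum>x\<in>Poly_Mapping.keys p. \<Sum>y\<in>B.
      Poly_Mapping.single (x \<otimes>\<^bsub>G\<^esub> y) (Poly_Mapping.lookup p x * Poly_Mapping.lookup r y))"
    unfolding monoid_algebra_def monoid.simps using assms
    by (intro sum.cong refl sum.mono_neutral_left) (auto simp: in_keys_iff)
  also have "\<dots> = (\<Sum>x\<in>A. \<Sum>y\<in>B.
      Poly_Mapping.single (x \<otimes>\<^bsub>G\<^esub> y) (Poly_Mapping.lookup p x * Poly_Mapping.lookup r y))"
    using assms by (intro sum.mono_neutral_left) (auto simp: in_keys_iff)
  finally show ?thesis .
qed

lemma monoid_algebra_mult_add_left:
  "(p + p') \<otimes>\<^bsub>monoid_algebra G\<^esub> r = p \<otimes>\<^bsub>monoid_algebra G\<^esub> r + p' \<otimes>\<^bsub>monoid_algebra G\<^esub> r"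
proof -
  let ?A = "Poly_Mapping.keys p \<union> Poly_Mapping.keys p'" and ?B = "Poly_Mapping.keys r"
  have *: "s \<otimes>\<^bsub>monoid_algebra G\<^esub> r = (\<Sum>x\<in>?A. \<Sum>y\<in>?B.
      Poly_Mapping.single (x \<otimes>\<^bsub>G\<^esub> y) (Poly_Mapping.lookup s x * Poly_Mapping.lookup r y))"
    if "Poly_Mapping.keys s \<subseteq> ?A" for s
    using that by (intro monoid_algebra_mult_superset) auto
  show ?thesis
    by (subst (1 2 3) *)
       (use Poly_Mapping.keys_add[of p p'] in
         \<open>auto simp: lookup_add distrib_right single_add sum.distrib\<close>)
qed

lemma monoid_algebra_mult_add_right:
  "r \<otimes>\<^bsub>monoid_algebra G\<^esub> (p + p') = r \<otimes>\<^bsub>monoid_algebra G\<^esub> p + r \<otimes>\<^bsub>monoid_algebra G\<^esub> p'"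
proof -
  let ?A = "Poly_Mapping.keys p \<union> Poly_Mapping.keys p'" and ?B = "Poly_Mapping.keys r"
  have *: "r \<otimes>\<^bsub>monoid_algebra G\<^esub> s = (\<Sum>x\<in>?B. \<Sum>y\<in>?A.
      Poly_Mapping.single (x \<otimes>\<^bsub>G\<^esub> y) (Poly_Mapping.lookup r x * Poly_Mapping.lookup s y))"
    if "Poly_Mapping.keys s \<subseteq> ?A" for s
    using that by (intro monoid_algebra_mult_superset) auto
  show ?thesis
    by (subst (1 2 3) *)
       (use Poly_Mapping.keys_add[of p p'] in
         \<open>auto simp: lookup_add distrib_left single_add sum.distrib\<close>)
qed

lemma monoid_algebra_mult_zero [simp]:
  "0 \<otimes>\<^bsub>monoid_algebra G\<^esub> r = 0" "r \<otimes>\<^bsub>monoid_algebra G\<^esub> 0 = 0"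
  by (simp_all add: monoid_algebra_def)

lemma monoid_algebra_mult_single:
  "Poly_Mapping.single x a \<otimes>\<^bsub>monoid_algebra G\<^esub> Poly_Mapping.single y b =
     Poly_Mapping.single (x \<otimes>\<^bsub>G\<^esub> y) (a * b)"
  by (subst monoid_algebra_mult_superset[of "{x}" _ "{y}"]) auto

lemma monoid_algebra_induct:
  assumes "p \<in> carrier (monoid_algebra G)"
    and "P 0"
    and "\<And>x a. x \<in> carrier G \<Longrightarrow> P (Poly_Mapping.single x a)"
    and "\<And>p r. P p \<Longrightarrow> P r \<Longrightarrow> P (p + r)"
  shows "P p"
proof -
  have "finite A \<Longrightarrow> A \<subseteq> carrier G \<Longrightarrow>
      P (\<Sum>x\<in>A. Poly_Mapping.single x (Poly_Mapping.lookup p x))" for A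
    by (induction rule: finite_induct) (auto intro: assms)
  moreover have "p = (\<Sum>x\<in>Poly_Mapping.keys p. Poly_Mapping.single x (Poly_Mapping.lookup p x))"
    by (rule poly_mapping_eqI) (auto simp: lookup_sum lookup_single when_def in_keys_iff)
  ultimately show ?thesis
    using assms(1) by (metis (no_types, lifting) finite_keys mem_Collect_eq monoid_algebra_def
        partial_object.select_convs(1))
qed

text \<open>In particular \<^const>\<open>genideal\<close> does not degenerate below.\<close>

lemma monoid_algebra_ring:
  assumes "monoid G" shows "ring (monoid_algebra G)"
proof -
  interpret monoid G by fact
  let ?M = "monoid_algebra G"
  have sel: "zero ?M = 0" "add ?M = (+)" "one ?M = Poly_Mapping.single \<one>\<^bsub>G\<^esub> 1"
    "carrier ?M = {p. Poly_Mapping.keys p \<subseteq> carrier G}"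
    by (simp_all add: monoid_algebra_def)
  note ind = monoid_algebra_induct[where G = G]
  note add = monoid_algebra_mult_add_left monoid_algebra_mult_add_right
  have cl: "p + r \<in> carrier ?M" if "p \<in> carrier ?M" "r \<in> carrier ?M" for p r
    using that Poly_Mapping.keys_add[of p r] unfolding sel by blast
  show ?thesis
  proof (rule ringI)
    show "abelian_group ?M"
    proof (rule abelian_groupI)
      show "\<exists>y\<in>carrier ?M. y \<oplus>\<^bsub>?M\<^esub> x = \<zero>\<^bsub>?M\<^esub>" if "x \<in> carrier ?M" for x
        using that by (intro bexI[of _ "- x"]) (auto simp: sel)
    qed (use cl in \<open>auto simp: sel add_ac\<close>)
    show "monoid ?M"
    proof (rule monoidI)
      show "x \<otimes>\<^bsub>?M\<^esub> y \<in> carrier ?M" if "x \<in> carrier ?M" "y \<in> carrier ?M" for x y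
        using that(1)
      proof (rule ind, goal_cases)
        case (2 u a)
        show ?case using that(2)
          by (rule ind) (auto simp: add cl monoid_algebra_mult_single 2, auto simp: sel 2)
      qed (auto simp: add cl, auto simp: sel)
      show "\<one>\<^bsub>?M\<^esub> \<in> carrier ?M" by (simp add: sel)
      show "x \<otimes>\<^bsub>?M\<^esub> y \<otimes>\<^bsub>?M\<^esub> z = x \<otimes>\<^bsub>?M\<^esub> (y \<otimes>\<^bsub>?M\<^esub> z)"
        if "x \<in> carrier ?M" "y \<in> carrier ?M" "z \<in> carrier ?M" for x y z
        using that(1)
      proof (rule ind, goal_cases)
        case (2 u a)
        show ?case using that(2)
        proof (rule ind, goal_cases)
          case (2 v b)
          show ?case using that(3)
            by (rule ind)
              (auto simp: add monoid_algebra_mult_single m_assoc \<open>u \<in> carrier G\<close> 2 mult.assoc)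
        qed (auto simp: add)
      qed (auto simp: add)
      show "\<one>\<^bsub>?M\<^esub> \<otimes>\<^bsub>?M\<^esub> x = x" if "x \<in> carrier ?M" for x
        using that by (rule ind) (auto simp: add sel(3) monoid_algebra_mult_single)
      show "x \<otimes>\<^bsub>?M\<^esub> \<one>\<^bsub>?M\<^esub> = x" if "x \<in> carrier ?M" for x
        using that by (rule ind) (auto simp: add sel(3) monoid_algebra_mult_single)
    qed
  qed (auto simp: sel add)
qed

definition quot_algebra :: "(complex, 'a) module \<Rightarrow> 'a set \<Rightarrow> (complex, 'a set) module" where
  "quot_algebra A N =
     ring.extend (A Quot N) (module.fields (\<lambda>c X. \<Union>x\<in>X. N +>\<^bsub>A\<^esub> (c \<odot>\<^bsub>A\<^esub> x)))"

lemma quot_algebra_simps: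
  "carrier (quot_algebra A N) = a_rcosets\<^bsub>A\<^esub> N"
  "X \<otimes>\<^bsub>quot_algebra A N\<^esub> Y = rcoset_mult A N X Y"
  "\<one>\<^bsub>quot_algebra A N\<^esub> = N +>\<^bsub>A\<^esub> \<one>\<^bsub>A\<^esub>"
  "\<zero>\<^bsub>quot_algebra A N\<^esub> = N"
  "X \<oplus>\<^bsub>quot_algebra A N\<^esub> Y = X <+>\<^bsub>A\<^esub> Y"
  "c \<odot>\<^bsub>quot_algebra A N\<^esub> X = (\<Union>x\<in>X. N +>\<^bsub>A\<^esub> (c \<odot>\<^bsub>A\<^esub> x))"
  by (simp_all add: quot_algebra_def ring.defs module.defs FactRing_def)

definition alg_hom :: "(complex, 'a) module \<Rightarrow> (complex, 'b) module \<Rightarrow> ('a \<Rightarrow> 'b) set" where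
  "alg_hom A B = {F \<in> ring_hom A B. \<forall>c. \<forall>x\<in>carrier A. F (c \<odot>\<^bsub>A\<^esub> x) = c \<odot>\<^bsub>B\<^esub> F x}"

definition free_algebra :: "(complex, 'g list \<Rightarrow>\<^sub>0 complex) module" where
  "free_algebra = monoid_algebra \<lparr>carrier = UNIV, mult = (@), one = []\<rparr>"

abbreviation mon :: "'g list \<Rightarrow> 'g list \<Rightarrow>\<^sub>0 complex" where
  "mon xs \<equiv> Poly_Mapping.single xs 1"

text \<open>A relation is an element of the free algebra that is to become zero.\<close>

definition presented :: "('g list \<Rightarrow>\<^sub>0 complex) set \<Rightarrow> (complex, ('g list \<Rightarrow>\<^sub>0 complex) set) module"
  where "presented S = quot_algebra free_algebra (Idl\<^bsub>free_algebra\<^esub> S)"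

lemma free_algebra_ring: "ring free_algebra"
  unfolding free_algebra_def by (rule monoid_algebra_ring) (rule monoidI; simp)

definition pclass :: "('g list \<Rightarrow>\<^sub>0 complex) set \<Rightarrow> ('g list \<Rightarrow>\<^sub>0 complex) \<Rightarrow> ('g list \<Rightarrow>\<^sub>0 complex) set"
  where "pclass S p = Idl\<^bsub>free_algebra\<^esub> S +>\<^bsub>free_algebra\<^esub> p"

definition hom_component :: "('g list \<Rightarrow>\<^sub>0 complex) set \<Rightarrow> ('g \<Rightarrow> 'd::monoid_add) \<Rightarrow> 'd
    \<Rightarrow> ('g list \<Rightarrow>\<^sub>0 complex) set set" where
  "hom_component S deg d =
     {pclass S p | p. \<forall>xs\<in>Poly_Mapping.keys p. sum_list (map deg xs) = d}"

text \<open>The relations saying that \<open>c\<close> is a unital algebra homomorphism on the field of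
  meromorphic functions.\<close>

definition mero_copy_rels :: "('n::finite mero \<Rightarrow> 'g) \<Rightarrow> ('g list \<Rightarrow>\<^sub>0 complex) set" where
  "mero_copy_rels c =
     {mon [c (f + f')] - mon [c f] - mon [c f'] | f f'. True} \<union>
     {mon [c (f * f')] - mon [c f, c f'] | f f'. True} \<union>
     {mon [c (mconst k)] - Poly_Mapping.single [] k | k. True}"


inductive_set lin_span :: "('k \<Rightarrow>\<^sub>0 complex) set \<Rightarrow> ('k \<Rightarrow>\<^sub>0 complex) set"
  for S :: "('k \<Rightarrow>\<^sub>0 complex) set" where
  lin_span_zero: "0 \<in> lin_span S"
| lin_span_base: "p \<in> S \<Longrightarrow> p \<in> lin_span S"
| lin_span_add: "p \<in> lin_span S \<Longrightarrow> r \<in> lin_span S \<Longrightarrow> p + r \<in> lin_span S"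
| lin_span_scale: "p \<in> lin_span S \<Longrightarrow> Poly_Mapping.map ((*) c) p \<in> lin_span S"

text \<open>The direct sum over \<open>i\<close> of the complex tensor products of \<open>AC i \<subseteq> A\<close> and \<open>BC i \<subseteq> B\<close>, modulo
  \<open>mA f x \<otimes> y = x \<otimes> mB f y\<close>, with componentwise product. It is the quotient of the free vector
  space on the pairs of matching homogeneous elements by the subspace spanned by the
  bilinearity and balancing relations.\<close>

definition tensor_free :: "(complex, 'a) module \<Rightarrow> (complex, 'b) module \<Rightarrow> ('i \<Rightarrow> 'a set) \<Rightarrow>
    ('i \<Rightarrow> 'b set) \<Rightarrow> (complex, ('a \<times> 'b) \<Rightarrow>\<^sub>0 complex) module" where
  "tensor_free A B AC BC = monoid_algebra
     \<lparr>carrier = (\<Union>i. AC i \<times> BC i),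
      mult = (\<lambda>(x, y) (x', y'). (x \<otimes>\<^bsub>A\<^esub> x', y \<otimes>\<^bsub>B\<^esub> y')),
      one = (\<one>\<^bsub>A\<^esub>, \<one>\<^bsub>B\<^esub>)\<rparr>"

definition tensor_rels :: "(complex, 'a) module \<Rightarrow> (complex, 'b) module \<Rightarrow> ('i \<Rightarrow> 'a set) \<Rightarrow>
    ('i \<Rightarrow> 'b set) \<Rightarrow> ('f \<Rightarrow> 'a) \<Rightarrow> ('f \<Rightarrow> 'b) \<Rightarrow> (('a \<times> 'b) \<Rightarrow>\<^sub>0 complex) set" where
  "tensor_rels A B AC BC mA mB =
    (let s = (\<lambda>x y. Poly_Mapping.single (x, y) (1 :: complex)) in
     (\<Union>i. {s (x \<oplus>\<^bsub>A\<^esub> x') y - s x y - s x' y | x x' y. x \<in> AC i \<and> x' \<in> AC i \<and> y \<in> BC i} \<union>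
          {s x (y \<oplus>\<^bsub>B\<^esub> y') - s x y - s x y' | x y y'. x \<in> AC i \<and> y \<in> BC i \<and> y' \<in> BC i} \<union>
          {s (c \<odot>\<^bsub>A\<^esub> x) y - Poly_Mapping.single (x, y) c | c x y. x \<in> AC i \<and> y \<in> BC i} \<union>
          {s x (c \<odot>\<^bsub>B\<^esub> y) - Poly_Mapping.single (x, y) c | c x y. x \<in> AC i \<and> y \<in> BC i} \<union>
          {s (mA f \<otimes>\<^bsub>A\<^esub> x) y - s x (mB f \<otimes>\<^bsub>B\<^esub> y) | f x y. x \<in> AC i \<and> y \<in> BC i}))"

definition tensor :: "(complex, 'a) module \<Rightarrow> (complex, 'b) module \<Rightarrow> ('i \<Rightarrow> 'a set) \<Rightarrow>
    ('i \<Rightarrow> 'b set) \<Rightarrow> ('f \<Rightarrow> 'a) \<Rightarrow> ('f \<Rightarrow> 'b) \<Rightarrow> (complex, (('a \<times> 'b) \<Rightarrow>\<^sub>0 complex) set) module"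
  where "tensor A B AC BC mA mB =
    quot_algebra (tensor_free A B AC BC) (lin_span (tensor_rels A B AC BC mA mB))"

text \<open>Only meaningful when \<open>x\<close> and \<open>y\<close> lie in matching homogeneous components.\<close>

definition tens :: "(complex, 'a) module \<Rightarrow> (complex, 'b) module \<Rightarrow> ('i \<Rightarrow> 'a set) \<Rightarrow>
    ('i \<Rightarrow> 'b set) \<Rightarrow> ('f \<Rightarrow> 'a) \<Rightarrow> ('f \<Rightarrow> 'b) \<Rightarrow> 'a \<Rightarrow> 'b \<Rightarrow> (('a \<times> 'b) \<Rightarrow>\<^sub>0 complex) set" where
  "tens A B AC BC mA mB x y =
    lin_span (tensor_rels A B AC BC mA mB) +>\<^bsub>tensor_free A B AC BC\<^esub> Poly_Mapping.single (x, y) 1"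


section \<open>The algebra of the dynamical R-matrix\<close>

type_synonym 'n weight = "(complex, 'n) vec"

definition omega :: "'n::finite \<Rightarrow> 'n weight" where
  "omega i = axis i 1"

text \<open>\<open>Rmat \<tau> a b c d\<close> is the entry with upper indices \<open>a b\<close> and lower indices \<open>c d\<close>.\<close>

definition Rmat :: "complex \<Rightarrow> 'n::{finite,linorder} \<Rightarrow> 'n \<Rightarrow> 'n \<Rightarrow> 'n \<Rightarrow> 'n mero" where
  "Rmat \<tau> a b c d =
    (if c = a \<and> d = b then
       (if a = b then mconst (qpow \<tau> 1) else if a < b then 1 else mdiff (g_fun \<tau>) a b)
     else if c = b \<and> d = a then mdiff (h0_fun \<tau>) a b
     else 0)"

datatype (dead 'n::finite) fgen = Tgen 'n 'n | FunL "'n mero" | FunR "'n mero"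

fun fdeg :: "'n::finite fgen \<Rightarrow> 'n weight \<times> 'n weight" where
  "fdeg (Tgen i j) = (omega i, omega j)"
| "fdeg (FunL f) = 0"
| "fdeg (FunR f) = 0"

definition F_rels :: "complex \<Rightarrow> ('n::{finite,linorder} fgen list \<Rightarrow>\<^sub>0 complex) set" where
  "F_rels \<tau> =
     mero_copy_rels FunL \<union> mero_copy_rels FunR \<union>
     {mon [FunL f, FunR f'] - mon [FunR f', FunL f] | f f'. True} \<union>
     {mon [FunL f, Tgen i j] - mon [Tgen i j, FunL (mshift (omega i) f)] | f i j. True} \<union>
     {mon [FunR f, Tgen i j] - mon [Tgen i j, FunR (mshift (omega j) f)] | f i j. True} \<union>
     {(\<Sum>x\<in>UNIV. \<Sum>y\<in>UNIV. mon [FunL (Rmat \<tau> x y a c), Tgen x b, Tgen y d]) -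
      (\<Sum>x\<in>UNIV. \<Sum>y\<in>UNIV. mon [FunR (Rmat \<tau> b d x y), Tgen c y, Tgen a x]) | a b c d. True}"

definition FR :: "complex \<Rightarrow> (complex, ('n::{finite,linorder} fgen list \<Rightarrow>\<^sub>0 complex) set) module"
  where "FR \<tau> = presented (F_rels \<tau>)"

definition t_el :: "complex \<Rightarrow> 'n::{finite,linorder} \<Rightarrow> 'n \<Rightarrow> ('n fgen list \<Rightarrow>\<^sub>0 complex) set" where
  "t_el \<tau> i j = pclass (F_rels \<tau>) (mon [Tgen i j])"

definition mu_l :: "complex \<Rightarrow> 'n::{finite,linorder} mero \<Rightarrow> ('n fgen list \<Rightarrow>\<^sub>0 complex) set" where
  "mu_l \<tau> f = pclass (F_rels \<tau>) (mon [FunL f])"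

definition mu_r :: "complex \<Rightarrow> 'n::{finite,linorder} mero \<Rightarrow> ('n fgen list \<Rightarrow>\<^sub>0 complex) set" where
  "mu_r \<tau> f = pclass (F_rels \<tau>) (mon [FunR f])"

definition F_comp :: "complex \<Rightarrow> 'n weight \<times> 'n weight
    \<Rightarrow> ('n::{finite,linorder} fgen list \<Rightarrow>\<^sub>0 complex) set set" where
  "F_comp \<tau> = hom_component (F_rels \<tau>) fdeg"


section \<open>The exterior algebras\<close>

text \<open>Generators of both \<open>W\<close> and \<open>V\<close>.\<close>

datatype (dead 'n::finite) egen = Egen 'n | FunE "'n mero"

fun edeg :: "'n::finite egen \<Rightarrow> 'n weight" where
  "edeg (Egen i) = omega i"
| "edeg (FunE f) = 0"

definition W_rels :: "complex \<Rightarrow> ('n::{finite,linorder} egen list \<Rightarrow>\<^sub>0 complex) set" where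
  "W_rels \<tau> =
     mero_copy_rels FunE \<union>
     {mon [Egen i, Egen i] | i. True} \<union>
     {mon [Egen j, Egen i] + mon [FunE (mdiff (h_fun \<tau>) j i), Egen i, Egen j] | i j. i < j} \<union>
     {mon [FunE f, Egen i] - mon [Egen i, FunE (mshift (omega i) f)] | f i. True}"

definition V_rels :: "complex \<Rightarrow> ('n::{finite,linorder} egen list \<Rightarrow>\<^sub>0 complex) set" where
  "V_rels \<tau> =
     mero_copy_rels FunE \<union>
     {mon [Egen i, Egen i] | i. True} \<union>
     {mon [Egen i, Egen j] + mon [FunE (mdiff (h_fun \<tau>) i j), Egen j, Egen i] | i j. i < j} \<union>
     {mon [FunE f, Egen i] - mon [Egen i, FunE (mshift (omega i) f)] | f i. True}"

type_synonym 'n ext = "('n egen list \<Rightarrow>\<^sub>0 complex) set"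
type_synonym 'n frst = "('n fgen list \<Rightarrow>\<^sub>0 complex) set"

definition W_alg :: "complex \<Rightarrow> (complex, 'n::{finite,linorder} ext) module" where
  "W_alg \<tau> = presented (W_rels \<tau>)"

definition V_alg :: "complex \<Rightarrow> (complex, 'n::{finite,linorder} ext) module" where
  "V_alg \<tau> = presented (V_rels \<tau>)"

definition mu_W :: "complex \<Rightarrow> 'n::{finite,linorder} mero \<Rightarrow> 'n ext" where
  "mu_W \<tau> f = pclass (W_rels \<tau>) (mon [FunE f])"

definition mu_V :: "complex \<Rightarrow> 'n::{finite,linorder} mero \<Rightarrow> 'n ext" where
  "mu_V \<tau> f = pclass (V_rels \<tau>) (mon [FunE f])"

definition w_el :: "complex \<Rightarrow> 'n::{finite,linorder} \<Rightarrow> 'n ext" where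
  "w_el \<tau> i = pclass (W_rels \<tau>) (mon [Egen i])"

definition v_el :: "complex \<Rightarrow> 'n::{finite,linorder} \<Rightarrow> 'n ext" where
  "v_el \<tau> i = pclass (V_rels \<tau>) (mon [Egen i])"

text \<open>\<open>w\<^sub>I\<close> is the product in increasing order, \<open>v\<^sub>I\<close> the product in decreasing order.\<close>

definition w_set :: "complex \<Rightarrow> 'n::{finite,linorder} set \<Rightarrow> 'n ext" where
  "w_set \<tau> I = pclass (W_rels \<tau>) (mon (map Egen (sorted_list_of_set I)))"

definition v_set :: "complex \<Rightarrow> 'n::{finite,linorder} set \<Rightarrow> 'n ext" where
  "v_set \<tau> I = pclass (V_rels \<tau>) (mon (map Egen (rev (sorted_list_of_set I))))"

definition W_comp :: "complex \<Rightarrow> 'n weight \<Rightarrow> 'n::{finite,linorder} ext set" where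
  "W_comp \<tau> = hom_component (W_rels \<tau>) edeg"

definition V_comp :: "complex \<Rightarrow> 'n weight \<Rightarrow> 'n::{finite,linorder} ext set" where
  "V_comp \<tau> = hom_component (V_rels \<tau>) edeg"

definition omega_set :: "'n::finite set \<Rightarrow> 'n weight" where
  "omega_set I = (\<Sum>i\<in>I. omega i)"


section \<open>The coactions and the two families of minors\<close>

definition WF :: "complex \<Rightarrow> (complex, (('n::{finite,linorder} ext \<times> 'n frst) \<Rightarrow>\<^sub>0 complex) set) module"
  where "WF \<tau> =
    tensor (W_alg \<tau>) (FR \<tau>) (\<lambda>(\<alpha>, \<beta>). W_comp \<tau> \<alpha>) (F_comp \<tau>) (mu_W \<tau>) (mu_l \<tau>)"

definition wf_tens :: "complex \<Rightarrow> 'n::{finite,linorder} ext \<Rightarrow> 'n frst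
    \<Rightarrow> (('n ext \<times> 'n frst) \<Rightarrow>\<^sub>0 complex) set" where
  "wf_tens \<tau> =
    tens (W_alg \<tau>) (FR \<tau>) (\<lambda>(\<alpha>, \<beta>). W_comp \<tau> \<alpha>) (F_comp \<tau>) (mu_W \<tau>) (mu_l \<tau>)"

definition FV :: "complex \<Rightarrow> (complex, (('n::{finite,linorder} frst \<times> 'n ext) \<Rightarrow>\<^sub>0 complex) set) module"
  where "FV \<tau> =
    tensor (FR \<tau>) (V_alg \<tau>) (F_comp \<tau>) (\<lambda>(\<alpha>, \<beta>). V_comp \<tau> \<beta>) (mu_r \<tau>) (mu_V \<tau>)"

definition fv_tens :: "complex \<Rightarrow> 'n::{finite,linorder} frst \<Rightarrow> 'n ext
    \<Rightarrow> (('n frst \<times> 'n ext) \<Rightarrow>\<^sub>0 complex) set" where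
  "fv_tens \<tau> =
    tens (FR \<tau>) (V_alg \<tau>) (F_comp \<tau>) (\<lambda>(\<alpha>, \<beta>). V_comp \<tau> \<beta>) (mu_r \<tau>) (mu_V \<tau>)"

definition is_coaction_R :: "complex \<Rightarrow>
    ('n::{finite,linorder} ext \<Rightarrow> (('n ext \<times> 'n frst) \<Rightarrow>\<^sub>0 complex) set) \<Rightarrow> bool" where
  "is_coaction_R \<tau> R \<longleftrightarrow>
     R \<in> alg_hom (W_alg \<tau>) (WF \<tau>) \<and>
     (\<forall>i. R (w_el \<tau> i) = (\<Oplus>\<^bsub>WF \<tau>\<^esub>j\<in>UNIV. wf_tens \<tau> (w_el \<tau> j) (t_el \<tau> j i))) \<and>
     (\<forall>f. \<forall>w\<in>carrier (W_alg \<tau>).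
        R (mu_W \<tau> f \<otimes>\<^bsub>W_alg \<tau>\<^esub> w) = wf_tens \<tau> \<one>\<^bsub>W_alg \<tau>\<^esub> (mu_r \<tau> f) \<otimes>\<^bsub>WF \<tau>\<^esub> R w)"

definition is_coaction_L :: "complex \<Rightarrow>
    ('n::{finite,linorder} ext \<Rightarrow> (('n frst \<times> 'n ext) \<Rightarrow>\<^sub>0 complex) set) \<Rightarrow> bool" where
  "is_coaction_L \<tau> L \<longleftrightarrow>
     L \<in> alg_hom (V_alg \<tau>) (FV \<tau>) \<and>
     (\<forall>i. L (v_el \<tau> i) = (\<Oplus>\<^bsub>FV \<tau>\<^esub>j\<in>UNIV. fv_tens \<tau> (t_el \<tau> i j) (v_el \<tau> j))) \<and>
     (\<forall>f. \<forall>v\<in>carrier (V_alg \<tau>).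
        L (mu_V \<tau> f \<otimes>\<^bsub>V_alg \<tau>\<^esub> v) = fv_tens \<tau> (mu_l \<tau> f) \<one>\<^bsub>V_alg \<tau>\<^esub> \<otimes>\<^bsub>FV \<tau>\<^esub> L v)"

text \<open>These conditions determine the homomorphisms on the carriers of \<open>W\<close> and \<open>V\<close>; the choice
  operator only fixes irrelevant values outside.\<close>

definition coaction_R :: "complex \<Rightarrow> 'n::{finite,linorder} ext
    \<Rightarrow> (('n ext \<times> 'n frst) \<Rightarrow>\<^sub>0 complex) set" where
  "coaction_R \<tau> = (SOME R. is_coaction_R \<tau> R)"

definition coaction_L :: "complex \<Rightarrow> 'n::{finite,linorder} ext
    \<Rightarrow> (('n frst \<times> 'n ext) \<Rightarrow>\<^sub>0 complex) set" where
  "coaction_L \<tau> = (SOME L. is_coaction_L \<tau> L)"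

text \<open>In \<open>xi \<tau> I J\<close> and \<open>eta \<tau> I J\<close> the upper index is \<open>I\<close> and the lower index is \<open>J\<close>. The
  membership conditions are those under which the tensors \<open>w\<^sub>I \<otimes> \<xi>\<close> and \<open>\<eta> \<otimes> v\<^sub>J\<close> are defined.\<close>

definition xi :: "complex \<Rightarrow> 'n::{finite,linorder} set \<Rightarrow> 'n set \<Rightarrow> 'n frst" where
  "xi \<tau> = (THE \<xi>.
     (\<forall>I J. card I = card J \<longrightarrow> (\<exists>\<beta>. \<xi> I J \<in> F_comp \<tau> (omega_set I, \<beta>))) \<and>
     (\<forall>J. coaction_R \<tau> (w_set \<tau> J) =
        (\<Oplus>\<^bsub>WF \<tau>\<^esub>I\<in>{I. card I = card J}. wf_tens \<tau> (w_set \<tau> I) (\<xi> I J))) \<and>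
     (\<forall>I J. card I \<noteq> card J \<longrightarrow> \<xi> I J = \<zero>\<^bsub>FR \<tau>\<^esub>))"

definition eta :: "complex \<Rightarrow> 'n::{finite,linorder} set \<Rightarrow> 'n set \<Rightarrow> 'n frst" where
  "eta \<tau> = (THE \<eta>.
     (\<forall>I J. card I = card J \<longrightarrow> (\<exists>\<alpha>. \<eta> I J \<in> F_comp \<tau> (\<alpha>, omega_set J))) \<and>
     (\<forall>I. coaction_L \<tau> (v_set \<tau> I) =
        (\<Oplus>\<^bsub>FV \<tau>\<^esub>J\<in>{J. card J = card I}. fv_tens \<tau> (\<eta> I J) (v_set \<tau> J))) \<and>
     (\<forall>I J. card I \<noteq> card J \<longrightarrow> \<eta> I J = \<zero>\<^bsub>FR \<tau>\<^esub>))"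

end

theory Submission
  imports Defs
begin

text \<open>Both families of minors satisfy Laplace expansions because the coactions are multiplicative:
  comparing the coefficients of \<open>R(w\<^sub>j w\<^sub>J)\<close> gives an expansion of \<open>\<xi>\<close> along a column, and those of
  \<open>L(v\<^sub>i v\<^sub>I)\<close> an expansion of \<open>\<eta>\<close> along a row. Comparing coefficients is legitimate since \<open>W\<close> acts on
  the space of families of meromorphic functions indexed by subsets, and this action separates the
  \<open>w\<^sub>I\<close>; \<open>V\<close> is \<open>W\<close> for the reversed order of the indices. The equality of the minors is then proved by
  induction on their size: expanding \<open>\<xi>\<close> along its first column and \<open>\<eta>\<close> along its last row, the
  difference is a smaller minor multiplied by a scalar, which vanishes by a Hall--Littlewood
  type identity in \<open>\<lambda>\<close> and \<open>\<mu>\<close>. The argument never divides by a \<open>q\<close>-factorial, so roots of unity are allowed.\<close>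

section \<open>Complex algebras and their embedding into a type-class ring\<close>

text \<open>The algebras are quotients described by a carrier, where rewriting with finite sums is
  awkward. Each one is therefore mapped into \<open>palg\<close>, the product of all algebras on the
  same type. The map \<open>emb\<close> into one factor respects sums, products and scalars but
  forgets the unit: it becomes an idempotent, and every unit law has to be stated relative to it.
  The action used to compare coefficients is the left regular action, written in the coordinates
  that \<open>W\<close> would have if the \<open>w_I\<close> were a basis; that it respects the
  relations is a finite check which replaces a rewriting argument. The first column and the last row
  are forced. Putting the smallest index in front of \<open>w_J\<close>, or the largest in front of
  \<open>v_I\<close>, costs no factor, so the minor stands alone in its expansion and no
  \<open>h\<close> has to be inverted. The scalar sums in \<lambda> and in \<mu> live in different
  copies of the function field and run over different index sets. They can meet only because each is
  a constant determined by the number of its variables, and constants of both copies act as the same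
  scalars.\<close>

locale calg = ring A for A :: "(complex, 'a) module" (structure) +
  assumes smult_closed [simp, intro]: "x \<in> carrier A \<Longrightarrow> c \<odot> x \<in> carrier A"
    and smult_add_left: "x \<in> carrier A \<Longrightarrow> (c + d) \<odot> x = c \<odot> x \<oplus> d \<odot> x"
    and smult_add_right: "x \<in> carrier A \<Longrightarrow> y \<in> carrier A \<Longrightarrow> c \<odot> (x \<oplus> y) = c \<odot> x \<oplus> c \<odot> y"
    and smult_smult: "x \<in> carrier A \<Longrightarrow> c \<odot> (d \<odot> x) = (c * d) \<odot> x"
    and smult_one: "x \<in> carrier A \<Longrightarrow> 1 \<odot> x = x"
    and smult_mult_left: "x \<in> carrier A \<Longrightarrow> y \<in> carrier A \<Longrightarrow> (c \<odot> x) \<otimes> y = c \<odot> (x \<otimes> y)"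
    and smult_mult_right: "x \<in> carrier A \<Longrightarrow> y \<in> carrier A \<Longrightarrow> x \<otimes> (c \<odot> y) = c \<odot> (x \<otimes> y)"
begin

lemma smult_zero [simp]: "c \<odot> \<zero> = \<zero>"
  using smult_add_right[of \<zero> \<zero> c] by (metis add.l_cancel_one' smult_closed zero_closed r_zero)

end

text \<open>Scalar multiplication on the quotient is a union over all representatives of a coset.
  Stability of \<open>N\<close> under scalars makes every representative contribute the same coset,
  so the union is a single one.\<close>

lemma calg_quot_algebra:
  assumes "calg A" and N: "ideal N A" and smN: "\<And>c x. x \<in> N \<Longrightarrow> c \<odot>\<^bsub>A\<^esub> x \<in> N"
  defines "\<pi> \<equiv> \<lambda>x. N +>\<^bsub>A\<^esub> x"
  shows "calg (quot_algebra A N)"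
    and "\<pi> \<in> alg_hom A (quot_algebra A N)"
    and "carrier (quot_algebra A N) = \<pi> ` carrier A"
    and "\<And>x y. x \<in> carrier A \<Longrightarrow> y \<in> carrier A \<Longrightarrow> \<pi> x = \<pi> y \<longleftrightarrow> x \<ominus>\<^bsub>A\<^esub> y \<in> N"
proof -
  interpret calg A by fact
  interpret N: ideal N A by fact
  let ?Q = "quot_algebra A N"
  show car: "carrier ?Q = \<pi> ` carrier A"
    by (auto simp: quot_algebra_simps A_RCOSETS_def' \<pi>_def)
  have mult: "\<pi> x \<otimes>\<^bsub>?Q\<^esub> \<pi> y = \<pi> (x \<otimes>\<^bsub>A\<^esub> y)" if "x \<in> carrier A" "y \<in> carrier A" for x y
    using that by (simp add: quot_algebra_simps \<pi>_def N.rcoset_mult_add)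
  have add: "\<pi> x \<oplus>\<^bsub>?Q\<^esub> \<pi> y = \<pi> (x \<oplus>\<^bsub>A\<^esub> y)" if "x \<in> carrier A" "y \<in> carrier A" for x y
    using that by (simp add: quot_algebra_simps \<pi>_def N.a_rcos_sum)
  have one: "\<one>\<^bsub>?Q\<^esub> = \<pi> \<one>\<^bsub>A\<^esub>" and zero: "\<zero>\<^bsub>?Q\<^esub> = \<pi> \<zero>\<^bsub>A\<^esub>"
    by (simp_all add: quot_algebra_simps \<pi>_def N.a_rcos_const)
  show eq: "\<pi> x = \<pi> y \<longleftrightarrow> x \<ominus>\<^bsub>A\<^esub> y \<in> N" if "x \<in> carrier A" "y \<in> carrier A" for x y
    using that quotient_eq_iff_same_a_r_cos[OF N, of x y] by (auto simp: \<pi>_def)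
  have smult: "c \<odot>\<^bsub>?Q\<^esub> \<pi> x = \<pi> (c \<odot>\<^bsub>A\<^esub> x)" if x: "x \<in> carrier A" for c x
  proof -
    have "N +>\<^bsub>A\<^esub> (c \<odot>\<^bsub>A\<^esub> y) = \<pi> (c \<odot>\<^bsub>A\<^esub> x)" if "y \<in> \<pi> x" for y
    proof -
      from that obtain n where n: "n \<in> N" "y = n \<oplus>\<^bsub>A\<^esub> x" by (auto simp: \<pi>_def a_r_coset_def')
      have "c \<odot>\<^bsub>A\<^esub> n \<in> N" using smN n by simp
      moreover have "c \<odot>\<^bsub>A\<^esub> y = c \<odot>\<^bsub>A\<^esub> n \<oplus>\<^bsub>A\<^esub> c \<odot>\<^bsub>A\<^esub> x"
        using n x by (simp add: smult_add_right N.Icarr)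
      ultimately have "c \<odot>\<^bsub>A\<^esub> y \<in> \<pi> (c \<odot>\<^bsub>A\<^esub> x)" by (auto simp: \<pi>_def a_r_coset_def')
      then show ?thesis using x by (simp add: \<pi>_def N.a_repr_independence')
    qed
    moreover have "x \<in> \<pi> x" using x by (simp add: \<pi>_def N.a_rcos_self)
    ultimately show ?thesis by (auto simp: quot_algebra_simps)
  qed
  note hom = mult add one zero smult
  have "ring ?Q"
  proof (rule ringI)
    show "abelian_group ?Q"
    proof (rule abelian_groupI)
      fix x assume "x \<in> carrier ?Q"
      then obtain y where "y \<in> carrier A" "x = \<pi> y" by (auto simp: car)
      then show "\<exists>y\<in>carrier ?Q. y \<oplus>\<^bsub>?Q\<^esub> x = \<zero>\<^bsub>?Q\<^esub>"
        by (intro bexI[of _ "\<pi> (\<ominus>\<^bsub>A\<^esub> y)"]) (auto simp: hom car l_neg)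
    qed (auto simp: car hom a_ac)
    show "monoid ?Q" by (rule monoidI) (auto simp: car hom m_assoc)
  qed (auto simp: car hom l_distr r_distr)
  then interpret Q: ring ?Q .
  show "calg ?Q"
    by unfold_locales (auto simp: car hom smult_add_left smult_add_right smult_smult smult_one
        smult_mult_left smult_mult_right)
  show "\<pi> \<in> alg_hom A ?Q"
    by (auto simp: alg_hom_def ring_hom_def car hom)
qed

section \<open>Monoid algebras as complex algebras\<close>

lemma lookup_scale:
  "Poly_Mapping.lookup (Poly_Mapping.map ((*) (c :: complex)) p) k = c * Poly_Mapping.lookup p k"
  by (simp add: Poly_Mapping.map.rep_eq when_def)

lemma keys_scale: "Poly_Mapping.keys (Poly_Mapping.map ((*) (c :: complex)) p) \<subseteq> Poly_Mapping.keys p"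
  by (auto simp: in_keys_iff lookup_scale)

lemma scale_add:
  "Poly_Mapping.map ((*) (c :: complex)) (p + r) = Poly_Mapping.map ((*) c) p + Poly_Mapping.map ((*) c) r"
  by (rule poly_mapping_eqI) (simp add: lookup_scale lookup_add distrib_left)

lemma scale_single [simp]:
  "Poly_Mapping.map ((*) (c :: complex)) (Poly_Mapping.single k d) = Poly_Mapping.single k (c * d)"
  by (rule poly_mapping_eqI) (simp add: lookup_scale lookup_single when_def)

lemma scale_zero [simp]: "Poly_Mapping.map ((*) (c :: complex)) 0 = 0"
  by (rule poly_mapping_eqI) (simp add: lookup_scale)

lemma scale_minus_one: "Poly_Mapping.map ((*) (- 1 :: complex)) p = - p"
  by (rule poly_mapping_eqI) (simp add: lookup_scale)

lemma calg_monoid_algebra: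
  assumes "monoid G" shows "calg (monoid_algebra G)"
proof -
  interpret ring "monoid_algebra G" by (rule monoid_algebra_ring) fact
  interpret G: monoid G by fact
  let ?M = "monoid_algebra G"
  have sel: "zero ?M = 0" "add ?M = (+)" "one ?M = Poly_Mapping.single \<one>\<^bsub>G\<^esub> 1"
    "carrier ?M = {p. Poly_Mapping.keys p \<subseteq> carrier G}" "smult ?M = (\<lambda>c. Poly_Mapping.map ((*) c))"
    by (simp_all add: monoid_algebra_def)
  note lk = lookup_scale and kc = keys_scale and add = scale_add and single = scale_single and z = scale_zero
  note ind = monoid_algebra_induct[where G = G]
  note distr = monoid_algebra_mult_add_left monoid_algebra_mult_add_right
  have m: "(c \<odot>\<^bsub>?M\<^esub> x) \<otimes>\<^bsub>?M\<^esub> y = c \<odot>\<^bsub>?M\<^esub> (x \<otimes>\<^bsub>?M\<^esub> y) \<and> x \<otimes>\<^bsub>?M\<^esub> (c \<odot>\<^bsub>?M\<^esub> y) = c \<odot>\<^bsub>?M\<^esub> (x \<otimes>\<^bsub>?M\<^esub> y)"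
    if "x \<in> carrier ?M" "y \<in> carrier ?M" for c x y
    using that(1)
  proof (rule ind, goal_cases)
    case (2 u a)
    show ?case using that(2)
      by (rule ind) (simp_all add: sel distr add single z monoid_algebra_mult_single mult.assoc mult.left_commute[of a])
  qed (auto simp: sel distr add z)
  show ?thesis
  proof unfold_locales
    show "c \<odot>\<^bsub>?M\<^esub> x \<in> carrier ?M" if "x \<in> carrier ?M" for c x
      using that kc by (force simp: sel)
  qed (use m in \<open>auto simp: sel add intro!: poly_mapping_eqI simp: lk lookup_add distrib_right\<close>)
qed

text \<open>The product of all algebra structures on subsets of a type is a ring in the sense of type
  classes, and every such algebra embeds into it.\<close>

typedef 'a palg = "{f :: (complex, 'a) module \<Rightarrow> 'a.
    \<forall>A. if calg A then f A \<in> carrier A else f A = undefined}"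
proof
  show "(\<lambda>A. if calg A then \<zero>\<^bsub>A\<^esub> else undefined) \<in> {f :: (complex, 'a) module \<Rightarrow> 'a.
    \<forall>A. if calg A then f A \<in> carrier A else f A = undefined}"
    by (auto intro: abelian_monoid.zero_closed abelian_group.axioms ring.is_abelian_group calg.axioms)
qed

setup_lifting type_definition_palg

lemma calg_ring: "calg A \<Longrightarrow> ring A"
  by (simp add: calg_def)

instantiation palg :: (type) ring
begin

lift_definition zero_palg :: "'a palg" is "\<lambda>A. if calg A then \<zero>\<^bsub>A\<^esub> else undefined"
  by (auto intro: ring.ring_simprules calg_ring)
lift_definition plus_palg :: "'a palg \<Rightarrow> 'a palg \<Rightarrow> 'a palg" is
  "\<lambda>f g A. if calg A then f A \<oplus>\<^bsub>A\<^esub> g A else undefined"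
  by (auto intro: ring.ring_simprules calg_ring split: if_splits)
lift_definition times_palg :: "'a palg \<Rightarrow> 'a palg \<Rightarrow> 'a palg" is
  "\<lambda>f g A. if calg A then f A \<otimes>\<^bsub>A\<^esub> g A else undefined"
  by (auto intro: ring.ring_simprules calg_ring)
lift_definition uminus_palg :: "'a palg \<Rightarrow> 'a palg" is
  "\<lambda>f A. if calg A then \<ominus>\<^bsub>A\<^esub> f A else undefined"
  by (auto intro: ring.ring_simprules calg_ring)
definition minus_palg :: "'a palg \<Rightarrow> 'a palg \<Rightarrow> 'a palg" where
  "minus_palg f g = f + - g"

lemma palg_eqI:
  fixes x y :: "'a palg"
  assumes "\<And>A. calg A \<Longrightarrow> Rep_palg x A = Rep_palg y A"
  shows "x = y"
  using assms by transfer (rule ext, metis (full_types))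

lemma Rep_palg_closed: "calg A \<Longrightarrow> Rep_palg x A \<in> carrier A"
  by transfer (metis (full_types))

lemma Rep_palg_simps:
  assumes "calg A"
  shows "Rep_palg 0 A = \<zero>\<^bsub>A\<^esub>" "Rep_palg (x + y) A = Rep_palg x A \<oplus>\<^bsub>A\<^esub> Rep_palg y A"
    "Rep_palg (x * y) A = Rep_palg x A \<otimes>\<^bsub>A\<^esub> Rep_palg y A" "Rep_palg (- x) A = \<ominus>\<^bsub>A\<^esub> Rep_palg x A"
  using assms by (simp_all add: zero_palg.rep_eq plus_palg.rep_eq times_palg.rep_eq uminus_palg.rep_eq)

instance
proof
  fix a b c :: "'a palg"
  show "a - b = a + - b" by (simp add: minus_palg_def)
  have "Rep_palg (a * b * c) A = Rep_palg (a * (b * c)) A \<and>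
      Rep_palg (a + b + c) A = Rep_palg (a + (b + c)) A \<and> Rep_palg (a + b) A = Rep_palg (b + a) A \<and>
      Rep_palg (0 + a) A = Rep_palg a A \<and> Rep_palg (- a + a) A = Rep_palg 0 A \<and>
      Rep_palg ((a + b) * c) A = Rep_palg (a * c + b * c) A \<and>
      Rep_palg (a * (b + c)) A = Rep_palg (a * b + a * c) A"
    if A: "calg A" for A
  proof -
    interpret calg A by fact
    note c = Rep_palg_closed[OF A]
    show ?thesis
      using c[of a] c[of b] c[of c]
      by (simp add: Rep_palg_simps[OF A] m_assoc a_assoc l_neg l_distr r_distr)
         (simp add: a_comm)
  qed
  then show "a * b * c = a * (b * c)" "a + b + c = a + (b + c)" "a + b = b + a" "0 + a = a"
    "- a + a = 0" "(a + b) * c = a * c + b * c" "a * (b + c) = a * b + a * c"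
    by (blast intro: palg_eqI)+
qed

end

lift_definition scl :: "complex \<Rightarrow> 'a palg \<Rightarrow> 'a palg" is
  "\<lambda>c f A. if calg A then c \<odot>\<^bsub>A\<^esub> f A else undefined"
  by (auto intro: calg.smult_closed)

lemma Rep_palg_scl: "calg A \<Longrightarrow> Rep_palg (scl c x) A = c \<odot>\<^bsub>A\<^esub> Rep_palg x A"
  by (simp add: scl.rep_eq)

lemma scl_simps:
  "scl (c + d) x = scl c x + scl d x" "scl c (x + y) = scl c x + scl c y"
  "scl c (scl d x) = scl (c * d) x" "scl 1 x = x"
  "scl c x * y = scl c (x * y)" "x * scl c y = scl c (x * y)"
proof -
  have "Rep_palg (scl (c + d) x) A = Rep_palg (scl c x + scl d x) A \<and>
      Rep_palg (scl c (x + y)) A = Rep_palg (scl c x + scl c y) A \<and>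
      Rep_palg (scl c (scl d x)) A = Rep_palg (scl (c * d) x) A \<and> Rep_palg (scl 1 x) A = Rep_palg x A \<and>
      Rep_palg (scl c x * y) A = Rep_palg (scl c (x * y)) A \<and>
      Rep_palg (x * scl c y) A = Rep_palg (scl c (x * y)) A"
    if A: "calg A" for A
  proof -
    interpret calg A by fact
    note c = Rep_palg_closed[OF A]
    show ?thesis
      using c[of x] c[of y]
      by (simp add: Rep_palg_simps[OF A] Rep_palg_scl[OF A] smult_add_left smult_add_right
          smult_smult smult_one smult_mult_left smult_mult_right)
  qed
  then show "scl (c + d) x = scl c x + scl d x" "scl c (x + y) = scl c x + scl c y"
    "scl c (scl d x) = scl (c * d) x" "scl 1 x = x"
    "scl c x * y = scl c (x * y)" "x * scl c y = scl c (x * y)"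
    by (blast intro: palg_eqI)+
qed

lemma scl_zero [simp]: "scl c 0 = 0" "scl 0 x = 0"
  using scl_simps(2)[of c 0 0] scl_simps(1)[of 0 0 x] by simp_all

lemma scl_minus: "scl (- c) x = - scl c x" "scl c (- x) = - scl c x"
  using scl_simps(1)[of c "- c" x] scl_simps(2)[of c x "- x"]
  by (simp_all add: eq_neg_iff_add_eq_0 add.commute)

lemma scl_sum: "scl c (sum f S) = (\<Sum>x\<in>S. scl c (f x))"
  by (induction S rule: infinite_finite_induct) (simp_all add: scl_simps)

text \<open>One coordinate carries \<open>x\<close>, all others are zero. As zeros add and multiply
  to zero, the map is additive and multiplicative on the carrier, but it cannot send the unit of
  \<open>A\<close> to a unit of the whole product.\<close>

lift_definition emb :: "(complex, 'a) module \<Rightarrow> 'a \<Rightarrow> 'a palg" is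
  "\<lambda>A x B. if calg B then (if B = A \<and> x \<in> carrier A then x else \<zero>\<^bsub>B\<^esub>) else undefined"
  by (auto intro: ring.ring_simprules calg_ring)

context calg
begin

lemma Rep_palg_emb:
  "calg B \<Longrightarrow> Rep_palg (emb A x) B = (if B = A \<and> x \<in> carrier A then x else \<zero>\<^bsub>B\<^esub>)"
  by (simp add: emb.rep_eq)

lemma emb_inj: "x \<in> carrier A \<Longrightarrow> y \<in> carrier A \<Longrightarrow> emb A x = emb A y \<longleftrightarrow> x = y"
  using Rep_palg_emb[OF calg_axioms, of x] Rep_palg_emb[OF calg_axioms, of y] by metis

lemma emb_simps:
  "emb A \<zero> = 0"
  "x \<in> carrier A \<Longrightarrow> y \<in> carrier A \<Longrightarrow> emb A (x \<oplus> y) = emb A x + emb A y"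
  "x \<in> carrier A \<Longrightarrow> y \<in> carrier A \<Longrightarrow> emb A (x \<otimes> y) = emb A x * emb A y"
  "x \<in> carrier A \<Longrightarrow> emb A (c \<odot> x) = scl c (emb A x)"
proof -
  have z: "\<zero>\<^bsub>B\<^esub> \<oplus>\<^bsub>B\<^esub> \<zero>\<^bsub>B\<^esub> = \<zero>\<^bsub>B\<^esub>" "\<zero>\<^bsub>B\<^esub> \<otimes>\<^bsub>B\<^esub> \<zero>\<^bsub>B\<^esub> = \<zero>\<^bsub>B\<^esub>" "c \<odot>\<^bsub>B\<^esub> \<zero>\<^bsub>B\<^esub> = \<zero>\<^bsub>B\<^esub>"
    if "calg B" for B :: "(complex, 'a) module" and c
  proof -
    interpret B: calg B by fact
    show "\<zero>\<^bsub>B\<^esub> \<oplus>\<^bsub>B\<^esub> \<zero>\<^bsub>B\<^esub> = \<zero>\<^bsub>B\<^esub>" "\<zero>\<^bsub>B\<^esub> \<otimes>\<^bsub>B\<^esub> \<zero>\<^bsub>B\<^esub> = \<zero>\<^bsub>B\<^esub>" "c \<odot>\<^bsub>B\<^esub> \<zero>\<^bsub>B\<^esub> = \<zero>\<^bsub>B\<^esub>" by simp_all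
  qed
  show "emb A \<zero> = 0"
    by (rule palg_eqI) (simp add: Rep_palg_simps Rep_palg_emb)
  show "emb A (x \<oplus> y) = emb A x + emb A y" if "x \<in> carrier A" "y \<in> carrier A"
    by (rule palg_eqI) (use that in \<open>auto simp: Rep_palg_simps Rep_palg_emb z\<close>)
  show "emb A (x \<otimes> y) = emb A x * emb A y" if "x \<in> carrier A" "y \<in> carrier A"
    by (rule palg_eqI) (use that in \<open>auto simp: Rep_palg_simps Rep_palg_emb z\<close>)
  show "emb A (c \<odot> x) = scl c (emb A x)" if "x \<in> carrier A"
    by (rule palg_eqI) (use that in \<open>auto simp: Rep_palg_scl Rep_palg_emb z\<close>)
qed

lemma emb_finsum: "f \<in> S \<rightarrow> carrier A \<Longrightarrow> emb A (finsum A f S) = (\<Sum>x\<in>S. emb A (f x))"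
  by (induction S rule: infinite_finite_induct) (auto simp: emb_simps Pi_iff)

lemma emb_range: "0 \<in> emb A ` carrier A"
  "x \<in> emb A ` carrier A \<Longrightarrow> y \<in> emb A ` carrier A \<Longrightarrow> x + y \<in> emb A ` carrier A"
  "x \<in> emb A ` carrier A \<Longrightarrow> y \<in> emb A ` carrier A \<Longrightarrow> x * y \<in> emb A ` carrier A"
  "x \<in> emb A ` carrier A \<Longrightarrow> scl c x \<in> emb A ` carrier A"
  by (auto simp: emb_simps[symmetric] intro!: imageI)

end

section \<open>Algebras given by generators and relations\<close>

text \<open>Linear extension from the basis of keys. With values in \<open>palg\<close>, one notion
  serves all target algebras; it supplies both the homomorphisms out of presented algebras and the
  functionals on tensor products.\<close>

definition lin :: "('k \<Rightarrow> 'b palg) \<Rightarrow> ('k \<Rightarrow>\<^sub>0 complex) \<Rightarrow> 'b palg" where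
  "lin \<psi> p = (\<Sum>k\<in>Poly_Mapping.keys p. scl (Poly_Mapping.lookup p k) (\<psi> k))"

lemma lin_superset:
  assumes "finite K" "Poly_Mapping.keys p \<subseteq> K"
  shows "lin \<psi> p = (\<Sum>k\<in>K. scl (Poly_Mapping.lookup p k) (\<psi> k))"
  unfolding lin_def using assms by (intro sum.mono_neutral_left) (auto simp: in_keys_iff)

lemma lin_zero [simp]: "lin \<psi> 0 = 0"
  by (simp add: lin_def)

lemma lin_single [simp]: "lin \<psi> (Poly_Mapping.single k c) = scl c (\<psi> k)"
  by (subst lin_superset[of "{k}"]) auto

lemma lin_add [simp]: "lin \<psi> (p + r) = lin \<psi> p + lin \<psi> r"
proof -
  let ?K = "Poly_Mapping.keys p \<union> Poly_Mapping.keys r"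
  have *: "lin \<psi> s = (\<Sum>k\<in>?K. scl (Poly_Mapping.lookup s k) (\<psi> k))"
    if "Poly_Mapping.keys s \<subseteq> ?K" for s
    using that by (intro lin_superset) auto
  show ?thesis
    by (subst (1 2 3) *) (use Poly_Mapping.keys_add[of p r] in
      \<open>auto simp: lookup_add scl_simps sum.distrib\<close>)
qed

lemma lin_uminus [simp]: "lin \<psi> (- p) = - lin \<psi> p"
  using lin_add[of \<psi> p "- p"] by (simp add: eq_neg_iff_add_eq_0 add.commute)

lemma lin_minus [simp]: "lin \<psi> (p - r) = lin \<psi> p - lin \<psi> r"
  using lin_add[of \<psi> p "- r"] by simp

lemma lin_sum [simp]: "lin \<psi> (\<Sum>x\<in>S. f x) = (\<Sum>x\<in>S. lin \<psi> (f x))"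
  by (induction S rule: infinite_finite_induct) simp_all

lemma lin_scale [simp]: "lin \<psi> (Poly_Mapping.map ((*) c) p) = scl c (lin \<psi> p)"
  by (subst lin_superset[OF finite_keys keys_scale])
     (simp add: lin_def lookup_scale scl_sum scl_simps)

lemma lin_mult:
  assumes "\<And>x y. x \<in> carrier G \<Longrightarrow> y \<in> carrier G \<Longrightarrow> \<psi> (x \<otimes>\<^bsub>G\<^esub> y) = \<psi> x * \<psi> y"
    and p: "p \<in> carrier (monoid_algebra G)" and r: "r \<in> carrier (monoid_algebra G)"
  shows "lin \<psi> (p \<otimes>\<^bsub>monoid_algebra G\<^esub> r) = lin \<psi> p * lin \<psi> r"
  using p
proof (rule monoid_algebra_induct, goal_cases)
  case (2 x a)
  show ?case
    using r by (rule monoid_algebra_induct)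
      (auto simp: monoid_algebra_mult_add_right monoid_algebra_mult_single distrib_left assms(1) 2
        scl_simps mult.commute)
qed (auto simp: monoid_algebra_mult_add_left distrib_right)

lemma lin_range:
  assumes "calg B" "\<And>k. k \<in> Poly_Mapping.keys p \<Longrightarrow> \<psi> k \<in> emb B ` carrier B"
  shows "lin \<psi> p \<in> emb B ` carrier B"
proof -
  have "finite K \<Longrightarrow> K \<subseteq> Poly_Mapping.keys p \<Longrightarrow>
      (\<Sum>k\<in>K. scl (Poly_Mapping.lookup p k) (\<psi> k)) \<in> emb B ` carrier B" for K
    by (induction K rule: finite_induct) (auto intro!: calg.emb_range assms)
  then show ?thesis by (simp add: lin_def)
qed

text \<open>A linear map that kills the relations descends to the quotient by their span. This is
  how functionals on tensor products arise.\<close>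

lemma lin_span_lin_zero:
  assumes "p \<in> lin_span S" "\<And>p. p \<in> S \<Longrightarrow> lin \<psi> p = 0"
  shows "lin \<psi> p = 0"
  using assms(1) by induction (auto simp: assms(2))

lemma monoid_algebra_simps:
  "\<zero>\<^bsub>monoid_algebra G\<^esub> = 0" "p \<oplus>\<^bsub>monoid_algebra G\<^esub> r = p + r"
  "\<one>\<^bsub>monoid_algebra G\<^esub> = Poly_Mapping.single \<one>\<^bsub>G\<^esub> 1"
  "carrier (monoid_algebra G) = {p. Poly_Mapping.keys p \<subseteq> carrier G}"
  "c \<odot>\<^bsub>monoid_algebra G\<^esub> p = Poly_Mapping.map ((*) c) p"
  by (simp_all add: monoid_algebra_def)

lemma monoid_algebra_minus:
  assumes "monoid G" "p \<in> carrier (monoid_algebra G)" "r \<in> carrier (monoid_algebra G)"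
  shows "p \<ominus>\<^bsub>monoid_algebra G\<^esub> r = p - r"
proof -
  interpret ring "monoid_algebra G" by (rule monoid_algebra_ring) fact
  have "\<ominus>\<^bsub>monoid_algebra G\<^esub> r = - r"
    using assms(3) by (intro minus_equality) (auto simp: monoid_algebra_simps)
  then show ?thesis by (simp add: a_minus_def monoid_algebra_simps)
qed

text \<open>By linearity, absorption needs to be tested only against single monoid elements with
  coefficient 1. Negatives come from scaling by -1.\<close>

lemma monoid_algebra_idealI:
  assumes "monoid G" and N: "N \<subseteq> carrier (monoid_algebra G)" "0 \<in> N"
    and add: "\<And>p r. p \<in> N \<Longrightarrow> r \<in> N \<Longrightarrow> p + r \<in> N"
    and scale: "\<And>c p. p \<in> N \<Longrightarrow> Poly_Mapping.map ((*) c) p \<in> N"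
    and left: "\<And>x p. x \<in> carrier G \<Longrightarrow> p \<in> N \<Longrightarrow> Poly_Mapping.single x 1 \<otimes>\<^bsub>monoid_algebra G\<^esub> p \<in> N"
    and right: "\<And>x p. x \<in> carrier G \<Longrightarrow> p \<in> N \<Longrightarrow> p \<otimes>\<^bsub>monoid_algebra G\<^esub> Poly_Mapping.single x 1 \<in> N"
  shows "ideal N (monoid_algebra G)"
proof -
  let ?M = "monoid_algebra G"
  interpret calg ?M by (rule calg_monoid_algebra) fact
  have inv: "\<ominus>\<^bsub>?M\<^esub> p = - p" if "p \<in> carrier ?M" for p
    using that by (intro minus_equality) (auto simp: monoid_algebra_simps)
  show ?thesis
  proof (rule idealI[OF ring_axioms])
    show "subgroup N (add_monoid ?M)"
    proof (rule add.subgroupI)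
      show "\<ominus>\<^bsub>?M\<^esub> p \<in> N" if "p \<in> N" for p
        using scale[OF that, of "- 1"] that N inv by (auto simp: scale_minus_one)
    qed (use N add in \<open>auto simp: monoid_algebra_simps\<close>)
    fix a x assume a: "a \<in> N" and x: "x \<in> carrier ?M"
    then have a': "a \<in> carrier ?M" using N by auto
    have s: "Poly_Mapping.single u c = c \<odot>\<^bsub>?M\<^esub> Poly_Mapping.single u 1" for u c
      by (simp add: monoid_algebra_simps)
    show "x \<otimes>\<^bsub>?M\<^esub> a \<in> N"
      using x
    proof (rule monoid_algebra_induct, goal_cases)
      case (2 u c)
      have "Poly_Mapping.single u 1 \<in> carrier ?M" using 2 by (simp add: monoid_algebra_simps)
      then have "Poly_Mapping.single u c \<otimes>\<^bsub>?M\<^esub> a = c \<odot>\<^bsub>?M\<^esub> (Poly_Mapping.single u 1 \<otimes>\<^bsub>?M\<^esub> a)"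
        by (subst s) (rule smult_mult_left[OF _ a'])
      then show ?case using scale[OF left[OF 2 a]] by (simp add: monoid_algebra_simps)
    qed (use N in \<open>auto simp: monoid_algebra_mult_add_left add\<close>)
    show "a \<otimes>\<^bsub>?M\<^esub> x \<in> N"
      using x
    proof (rule monoid_algebra_induct, goal_cases)
      case (2 u c)
      have "Poly_Mapping.single u 1 \<in> carrier ?M" using 2 by (simp add: monoid_algebra_simps)
      then have "a \<otimes>\<^bsub>?M\<^esub> Poly_Mapping.single u c = c \<odot>\<^bsub>?M\<^esub> (a \<otimes>\<^bsub>?M\<^esub> Poly_Mapping.single u 1)"
        by (subst s) (rule smult_mult_right[OF a'])
      then show ?case using scale[OF right[OF 2 a]] by (simp add: monoid_algebra_simps)
    qed (use N in \<open>auto simp: monoid_algebra_mult_add_right add\<close>)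
  qed
qed

section \<open>Free algebras and their quotients by relations\<close>

abbreviation word_monoid :: "'g list monoid" where
  "word_monoid \<equiv> \<lparr>carrier = UNIV, mult = (@), one = []\<rparr>"

lemma monoid_words: "monoid word_monoid"
  by (rule monoidI) simp_all

lemma free_algebra_simps:
  "\<zero>\<^bsub>free_algebra\<^esub> = 0" "p \<oplus>\<^bsub>free_algebra\<^esub> r = p + r" "\<one>\<^bsub>free_algebra\<^esub> = mon []"
  "carrier free_algebra = UNIV" "c \<odot>\<^bsub>free_algebra\<^esub> p = Poly_Mapping.map ((*) c) p"
  "Poly_Mapping.single xs a \<otimes>\<^bsub>free_algebra\<^esub> Poly_Mapping.single ys b = Poly_Mapping.single (xs @ ys) (a * b)"
  "p \<ominus>\<^bsub>free_algebra\<^esub> r = p - r"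
  by (simp_all add: free_algebra_def monoid_algebra_simps monoid_algebra_mult_single
      monoid_algebra_minus monoid_words)

lemma calg_free_algebra: "calg free_algebra"
  unfolding free_algebra_def by (rule calg_monoid_algebra[OF monoid_words])

lemma ideal_Idl: "ideal (Idl\<^bsub>free_algebra\<^esub> S) free_algebra"
  by (rule ring.genideal_ideal[OF free_algebra_ring]) (simp add: free_algebra_simps)

text \<open>Scaling by \<open>c\<close> is left multiplication by \<open>c\<close> times the empty
  word, so ring ideals of the free algebra are subspaces.\<close>

lemma Idl_scale:
  assumes "p \<in> Idl\<^bsub>free_algebra\<^esub> S"
  shows "Poly_Mapping.map ((*) c) p \<in> Idl\<^bsub>free_algebra\<^esub> S"
proof -
  interpret calg free_algebra by (rule calg_free_algebra)
  have "Poly_Mapping.single [] c \<otimes>\<^bsub>free_algebra\<^esub> p = c \<odot>\<^bsub>free_algebra\<^esub> (\<one>\<^bsub>free_algebra\<^esub> \<otimes>\<^bsub>free_algebra\<^esub> p)"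
    using smult_mult_left[of "\<one>\<^bsub>free_algebra\<^esub>" p c] by (simp add: free_algebra_simps)
  then show ?thesis
    using ideal.I_l_closed[OF ideal_Idl assms, of "Poly_Mapping.single [] c"]
      l_one[of p] by (simp add: free_algebra_simps)
qed

lemma presented_quotient:
  shows calg_presented: "calg (presented S)"
    and pclass_hom: "pclass S \<in> alg_hom free_algebra (presented S)"
    and carrier_presented: "carrier (presented S) = range (pclass S)"
    and pclass_eq_iff: "pclass S p = pclass S r \<longleftrightarrow> p - r \<in> Idl\<^bsub>free_algebra\<^esub> S"
  using calg_quot_algebra[OF calg_free_algebra ideal_Idl[of S]] Idl_scale[of _ S]
  unfolding presented_def pclass_def[abs_def] by (simp_all add: free_algebra_simps)

lemma pclass_simps:
  "\<zero>\<^bsub>presented S\<^esub> = pclass S 0" "\<one>\<^bsub>presented S\<^esub> = pclass S (mon [])"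
  "pclass S p \<oplus>\<^bsub>presented S\<^esub> pclass S r = pclass S (p + r)"
  "pclass S p \<otimes>\<^bsub>presented S\<^esub> pclass S r = pclass S (p \<otimes>\<^bsub>free_algebra\<^esub> r)"
  "c \<odot>\<^bsub>presented S\<^esub> pclass S p = pclass S (Poly_Mapping.map ((*) c) p)"
  "pclass S p \<in> carrier (presented S)"
proof -
  note h = pclass_hom[of S, unfolded alg_hom_def]
  have r: "pclass S \<in> ring_hom free_algebra (presented S)" using h by auto
  show "\<zero>\<^bsub>presented S\<^esub> = pclass S 0"
    using ring_hom_zero[OF r free_algebra_ring calg_ring[OF calg_presented]]
    by (simp add: free_algebra_simps)
  show "\<one>\<^bsub>presented S\<^esub> = pclass S (mon [])" using ring_hom_one[OF r] by (simp add: free_algebra_simps)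
  show "pclass S p \<oplus>\<^bsub>presented S\<^esub> pclass S r = pclass S (p + r)"
    using ring_hom_add[OF r, of p r] by (simp add: free_algebra_simps)
  show "pclass S p \<otimes>\<^bsub>presented S\<^esub> pclass S r = pclass S (p \<otimes>\<^bsub>free_algebra\<^esub> r)"
    using ring_hom_mult[OF r, of p r] by (simp add: free_algebra_simps)
  show "c \<odot>\<^bsub>presented S\<^esub> pclass S p = pclass S (Poly_Mapping.map ((*) c) p)"
    using h by (simp add: free_algebra_simps)
  show "pclass S p \<in> carrier (presented S)" by (simp add: carrier_presented)
qed

text \<open>The kernel of a multiplicative linear map is an ideal, hence contains the ideal
  generated by any relations it contains.\<close>

lemma lin_Idl_zero:
  assumes "\<And>xs ys. \<psi> (xs @ ys) = \<psi> xs * \<psi> ys"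
    and "\<And>p. p \<in> S \<Longrightarrow> lin \<psi> p = 0" and "p \<in> Idl\<^bsub>free_algebra\<^esub> S"
  shows "lin \<psi> p = 0"
proof -
  let ?N = "{p. lin \<psi> p = 0}"
  have m: "lin \<psi> (p \<otimes>\<^bsub>free_algebra\<^esub> r) = lin \<psi> p * lin \<psi> r" for p r
    unfolding free_algebra_def by (rule lin_mult) (auto simp: assms monoid_algebra_simps)
  have "ideal ?N free_algebra"
    unfolding free_algebra_def
    by (rule monoid_algebra_idealI[OF monoid_words])
       (auto simp: monoid_algebra_simps m[unfolded free_algebra_def])
  then have "Idl\<^bsub>free_algebra\<^esub> S \<subseteq> ?N"
    by (rule ring.genideal_minimal[OF free_algebra_ring]) (use assms in auto)
  then show ?thesis using assms by auto
qed

text \<open>The universal property of a presentation. The evaluation of a word ends in the unit of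
  \<open>B\<close>, so the empty word goes to that unit and the homomorphism is unital although
  \<open>emb\<close> is not.\<close>

lemma presented_hom_exists:
  fixes B :: "(complex, 'b) module"
  assumes B: "calg B" and \<phi>: "\<And>g. \<phi> g \<in> carrier B"
    and S: "\<And>p. p \<in> S \<Longrightarrow> lin (\<lambda>xs. emb B (foldr (\<lambda>g x. \<phi> g \<otimes>\<^bsub>B\<^esub> x) xs \<one>\<^bsub>B\<^esub>)) p = 0"
  obtains C where "C \<in> alg_hom (presented S) B" "\<And>g. C (pclass S (mon [g])) = \<phi> g"
proof -
  interpret B: calg B by fact
  define w where "w xs = foldr (\<lambda>g x. \<phi> g \<otimes>\<^bsub>B\<^esub> x) xs \<one>\<^bsub>B\<^esub>" for xs
  define \<psi> where "\<psi> xs = emb B (w xs)" for xs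
  have w: "w xs \<in> carrier B" for xs
    unfolding w_def by (induction xs) (auto simp: \<phi>)
  have "w (xs @ ys) = w xs \<otimes>\<^bsub>B\<^esub> w ys" for xs ys
  proof (induction xs)
    case (Cons g xs)
    then show ?case using w[of xs] w[of ys] \<phi>[of g] B.m_assoc unfolding w_def by simp
  qed (use w[of ys] in \<open>simp add: w_def\<close>)
  then have app: "\<psi> (xs @ ys) = \<psi> xs * \<psi> ys" for xs ys
    by (simp add: \<psi>_def w B.emb_simps)
  have m: "lin \<psi> (p \<otimes>\<^bsub>free_algebra\<^esub> r) = lin \<psi> p * lin \<psi> r" for p r
    unfolding free_algebra_def by (rule lin_mult) (auto simp: app monoid_algebra_simps)
  have z: "lin \<psi> p = 0" if "p \<in> Idl\<^bsub>free_algebra\<^esub> S" for p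
    using lin_Idl_zero[OF app _ that] S by (simp add: \<psi>_def[abs_def] w_def)
  have rng: "lin \<psi> p \<in> emb B ` carrier B" for p
    by (rule lin_range[OF B]) (auto simp: \<psi>_def w)
  \<comment> \<open>Evaluate some representative and pull the value back along \<open>emb\<close>;
    by \<open>z\<close> the choice of the representative does not matter.\<close>
  define C where "C X = inv_into (carrier B) (emb B) (lin \<psi> (SOME p. pclass S p = X))" for X
  have C: "C (pclass S p) \<in> carrier B" "emb B (C (pclass S p)) = lin \<psi> p" for p
  proof -
    have "pclass S (SOME r. pclass S r = pclass S p) = pclass S p" by (rule someI) (rule refl)
    then have "lin \<psi> (SOME r. pclass S r = pclass S p) = lin \<psi> p"
      using z unfolding pclass_eq_iff by fastforce
    then show "C (pclass S p) \<in> carrier B" "emb B (C (pclass S p)) = lin \<psi> p"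
      using rng[of p] by (auto simp: C_def inv_into_into f_inv_into_f)
  qed
  have eq: "C (pclass S p) = y" if "y \<in> carrier B" "lin \<psi> p = emb B y" for p y
    using C[of p] that B.emb_inj by metis
  have "C \<in> alg_hom (presented S) B"
    unfolding alg_hom_def ring_hom_def
    by (auto simp: carrier_presented pclass_simps C intro!: eq)
       (auto simp: C B.emb_simps m \<psi>_def w_def scl_simps)
  moreover have "C (pclass S (mon [g])) = \<phi> g" for g
    by (rule eq) (auto simp: \<psi>_def w_def \<phi> scl_simps)
  ultimately show ?thesis by (rule that)
qed

text \<open>All computations with generators take place in this form: a member of \<open>S\<close>
  becomes an equation in a ring, and the class of the empty word plays the part of the unit.\<close>

definition pl :: "('g list \<Rightarrow>\<^sub>0 complex) set \<Rightarrow> ('g list \<Rightarrow>\<^sub>0 complex) \<Rightarrow> ('g list \<Rightarrow>\<^sub>0 complex) set palg"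
  where "pl S p = emb (presented S) (pclass S p)"

text \<open>Exhibits \<open>pl\<close> as a linear extension, so that \<open>pl_simps\<close>
  inherits the rules for \<open>lin\<close>.\<close>

lemma pl_eq_lin: "pl S p = lin (\<lambda>xs. pl S (mon xs)) p"
proof -
  interpret calg "presented S" by (rule calg_presented)
  have "p \<in> carrier (monoid_algebra word_monoid)" by (simp add: monoid_algebra_simps)
  then show ?thesis
  proof (rule monoid_algebra_induct, goal_cases)
    case 1 show ?case by (simp add: pl_def pclass_simps(1)[symmetric] emb_simps)
  next
    case (2 x a)
    have "pclass S (Poly_Mapping.single x a) = a \<odot>\<^bsub>presented S\<^esub> pclass S (mon x)"
      by (simp add: pclass_simps)
    then show ?case by (simp add: pl_def emb_simps pclass_simps(6))
  next
    case (3 p r) then show ?case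
      by (simp add: pl_def emb_simps pclass_simps(3)[symmetric] pclass_simps(6))
  qed
qed

lemma pl_simps:
  "pl S 0 = 0" "pl S (p + r) = pl S p + pl S r" "pl S (p - r) = pl S p - pl S r" "pl S (- p) = - pl S p"
  "pl S (Poly_Mapping.map ((*) c) p) = scl c (pl S p)" "pl S (sum f A) = (\<Sum>x\<in>A. pl S (f x))"
proof -
  have "pl S = lin (\<lambda>xs. pl S (mon xs))" by (rule ext) (rule pl_eq_lin)
  then obtain \<psi> where "pl S = lin \<psi>" by blast
  then show "pl S 0 = 0" "pl S (p + r) = pl S p + pl S r" "pl S (p - r) = pl S p - pl S r"
    "pl S (- p) = - pl S p" "pl S (Poly_Mapping.map ((*) c) p) = scl c (pl S p)"
    "pl S (sum f A) = (\<Sum>x\<in>A. pl S (f x))"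
    by simp_all
qed

lemma pl_mult: "pl S (p \<otimes>\<^bsub>free_algebra\<^esub> r) = pl S p * pl S r"
proof -
  interpret calg "presented S" by (rule calg_presented)
  show ?thesis by (simp add: pl_def emb_simps pclass_simps(4)[symmetric] pclass_simps(6))
qed

lemma pl_append: "pl S (mon (xs @ ys)) = pl S (mon xs) * pl S (mon ys)"
  by (simp add: pl_mult[symmetric] free_algebra_simps)

lemma pl_Cons: "ys \<noteq> [] \<Longrightarrow> pl S (mon (g # ys)) = pl S (mon [g]) * pl S (mon ys)"
  using pl_append[of S "[g]" ys] by simp

lemma pl_one_mult: "pl S (mon []) * pl S p = pl S p" "pl S p * pl S (mon []) = pl S p"
proof -
  interpret ring free_algebra by (rule free_algebra_ring)
  show "pl S (mon []) * pl S p = pl S p" "pl S p * pl S (mon []) = pl S p"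
    using l_one[of p] r_one[of p] by (simp_all add: pl_mult[symmetric] free_algebra_simps)
qed

lemma pl_eq_zero: "p \<in> S \<Longrightarrow> pl S p = 0"
proof -
  interpret calg "presented S" by (rule calg_presented)
  assume "p \<in> S"
  then have "p - 0 \<in> Idl\<^bsub>free_algebra\<^esub> S"
    using ring.genideal_self[OF free_algebra_ring, of S] by (auto simp: free_algebra_simps)
  then have "pclass S p = pclass S 0" by (simp only: pclass_eq_iff)
  then show ?thesis by (simp add: pl_def pclass_simps(1)[symmetric] emb_simps)
qed

lemma pl_eq_iff: "pl S p = pl S r \<longleftrightarrow> pclass S p = pclass S r"
  by (simp add: pl_def calg.emb_inj[OF calg_presented] pclass_simps)

lemma pl_rel: "p - r \<in> S \<Longrightarrow> pl S p = pl S r"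
  using pl_eq_zero[of "p - r" S] by (simp add: pl_simps)

section \<open>Graded tensor products\<close>

lemma monoid_algebra_mult_minus:
  "p \<otimes>\<^bsub>monoid_algebra G\<^esub> (r - s) = p \<otimes>\<^bsub>monoid_algebra G\<^esub> r - p \<otimes>\<^bsub>monoid_algebra G\<^esub> s"
  "(r - s) \<otimes>\<^bsub>monoid_algebra G\<^esub> p = r \<otimes>\<^bsub>monoid_algebra G\<^esub> p - s \<otimes>\<^bsub>monoid_algebra G\<^esub> p"
  using monoid_algebra_mult_add_right[where G = G and r = p and p = "r - s" and p' = s]
    monoid_algebra_mult_add_left[where G = G and p = "r - s" and p' = s and r = p]
  by simp_all

lemma keys_free_mult:
  assumes "zs \<in> Poly_Mapping.keys (p \<otimes>\<^bsub>free_algebra\<^esub> r)"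
  obtains xs ys where "xs \<in> Poly_Mapping.keys p" "ys \<in> Poly_Mapping.keys r" "zs = xs @ ys"
proof -
  have "p \<otimes>\<^bsub>free_algebra\<^esub> r = (\<Sum>x\<in>Poly_Mapping.keys p. \<Sum>y\<in>Poly_Mapping.keys r.
      Poly_Mapping.single (x @ y) (Poly_Mapping.lookup p x * Poly_Mapping.lookup r y))"
    by (simp add: free_algebra_def monoid_algebra_def)
  then have "Poly_Mapping.lookup (\<Sum>x\<in>Poly_Mapping.keys p. \<Sum>y\<in>Poly_Mapping.keys r.
      Poly_Mapping.single (x @ y) (Poly_Mapping.lookup p x * Poly_Mapping.lookup r y)) zs \<noteq> 0"
    using assms by (simp add: in_keys_iff)
  then obtain x y where "x \<in> Poly_Mapping.keys p" "y \<in> Poly_Mapping.keys r"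
    "Poly_Mapping.lookup (Poly_Mapping.single (x @ y) (Poly_Mapping.lookup p x * Poly_Mapping.lookup r y)) zs \<noteq> 0"
    unfolding lookup_sum by (meson sum.not_neutral_contains_not_neutral)
  then show ?thesis by (intro that[of x y]) (auto simp: lookup_single when_def split: if_splits)
qed

lemma hom_component_carrier: "X \<in> hom_component S deg d \<Longrightarrow> X \<in> carrier (presented S)"
  by (auto simp: hom_component_def carrier_presented)

lemma hom_component_add:
  assumes "X \<in> hom_component S deg d" "Y \<in> hom_component S deg d"
  shows "X \<oplus>\<^bsub>presented S\<^esub> Y \<in> hom_component S deg d"
proof -
  obtain p r where "X = pclass S p" "Y = pclass S r"
    "\<forall>xs\<in>Poly_Mapping.keys p \<union> Poly_Mapping.keys r. sum_list (map deg xs) = d"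
    using assms by (auto simp: hom_component_def)
  then show ?thesis
    unfolding hom_component_def using Poly_Mapping.keys_add[of p r]
    by (auto simp: pclass_simps intro!: exI[of _ "p + r"])
qed

lemma hom_component_smult:
  assumes "X \<in> hom_component S deg d"
  shows "c \<odot>\<^bsub>presented S\<^esub> X \<in> hom_component S deg d"
proof -
  obtain p where "X = pclass S p" "\<forall>xs\<in>Poly_Mapping.keys p. sum_list (map deg xs) = d"
    using assms by (auto simp: hom_component_def)
  then show ?thesis
    unfolding hom_component_def using keys_scale[of c p]
    by (auto simp: pclass_simps intro!: exI[of _ "Poly_Mapping.map ((*) c) p"])
qed

lemma hom_component_mult:
  assumes "X \<in> hom_component S deg d" "Y \<in> hom_component S deg e"
  shows "X \<otimes>\<^bsub>presented S\<^esub> Y \<in> hom_component S deg (d + e)"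
proof -
  obtain p r where "X = pclass S p" "Y = pclass S r"
    "\<forall>xs\<in>Poly_Mapping.keys p. sum_list (map deg xs) = d"
    "\<forall>xs\<in>Poly_Mapping.keys r. sum_list (map deg xs) = e"
    using assms by (auto simp: hom_component_def)
  then show ?thesis
    unfolding hom_component_def
    by (auto simp: pclass_simps intro!: exI[of _ "p \<otimes>\<^bsub>free_algebra\<^esub> r"] elim!: keys_free_mult)
qed

lemma hom_component_mon:
  "sum_list (map deg xs) = d \<Longrightarrow> pclass S (mon xs) \<in> hom_component S deg d"
  by (auto simp: hom_component_def intro!: exI[of _ "mon xs"])

lemma hom_component_zero: "\<zero>\<^bsub>presented S\<^esub> \<in> hom_component S deg d"
  by (auto simp: hom_component_def pclass_simps intro!: exI[of _ 0])

lemma hom_component_one: "\<one>\<^bsub>presented S\<^esub> \<in> hom_component S deg 0"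
  by (auto simp: pclass_simps intro!: hom_component_mon)

text \<open>The map \<open>\<sigma> i\<close> records how a function changes when it is moved to the
  left of an element of degree \<open>i\<close>. That both factors use the same
  \<open>\<sigma>\<close> is exactly what makes the balancing relation stable under left
  multiplication.\<close>

locale graded_tensor = A: calg A + B: calg B
  for A :: "(complex, 'a) module" and B :: "(complex, 'b) module" +
  fixes AC :: "'i::monoid_add \<Rightarrow> 'a set" and BC :: "'i \<Rightarrow> 'b set"
    and mA :: "'f \<Rightarrow> 'a" and mB :: "'f \<Rightarrow> 'b" and \<sigma> :: "'i \<Rightarrow> 'f \<Rightarrow> 'f"
  assumes car: "x \<in> AC i \<Longrightarrow> x \<in> carrier A" "y \<in> BC i \<Longrightarrow> y \<in> carrier B"
    and mult: "x \<in> AC i \<Longrightarrow> x' \<in> AC j \<Longrightarrow> x \<otimes>\<^bsub>A\<^esub> x' \<in> AC (i + j)"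
      "y \<in> BC i \<Longrightarrow> y' \<in> BC j \<Longrightarrow> y \<otimes>\<^bsub>B\<^esub> y' \<in> BC (i + j)"
    and one: "\<one>\<^bsub>A\<^esub> \<in> AC 0" "\<one>\<^bsub>B\<^esub> \<in> BC 0"
    and add: "x \<in> AC i \<Longrightarrow> x' \<in> AC i \<Longrightarrow> x \<oplus>\<^bsub>A\<^esub> x' \<in> AC i"
      "y \<in> BC i \<Longrightarrow> y' \<in> BC i \<Longrightarrow> y \<oplus>\<^bsub>B\<^esub> y' \<in> BC i"
    and smult: "x \<in> AC i \<Longrightarrow> c \<odot>\<^bsub>A\<^esub> x \<in> AC i" "y \<in> BC i \<Longrightarrow> c \<odot>\<^bsub>B\<^esub> y \<in> BC i"
    and copies: "mA f \<in> AC 0" "mB f \<in> BC 0"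
    and swap: "x \<in> AC i \<Longrightarrow> x \<otimes>\<^bsub>A\<^esub> mA f = mA (\<sigma> i f) \<otimes>\<^bsub>A\<^esub> x"
      "y \<in> BC i \<Longrightarrow> y \<otimes>\<^bsub>B\<^esub> mB f = mB (\<sigma> i f) \<otimes>\<^bsub>B\<^esub> y"
begin

abbreviation "G \<equiv> \<lparr>carrier = (\<Union>i. AC i \<times> BC i),
  mult = (\<lambda>(x, y) (x', y'). (x \<otimes>\<^bsub>A\<^esub> x', y \<otimes>\<^bsub>B\<^esub> y')), one = (\<one>\<^bsub>A\<^esub>, \<one>\<^bsub>B\<^esub>)\<rparr>"
abbreviation "N \<equiv> lin_span (tensor_rels A B AC BC mA mB)"
abbreviation "T \<equiv> tensor A B AC BC mA mB"

lemma monoid_G: "monoid G"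
proof (rule monoidI)
  show "\<one>\<^bsub>G\<^esub> \<in> carrier G" using one by auto
next
  fix u assume "u \<in> carrier G"
  then obtain i x y where u: "u = (x, y)" "x \<in> AC i" "y \<in> BC i" by auto
  note c = car(1)[OF u(2)] car(2)[OF u(3)]
  show "\<one>\<^bsub>G\<^esub> \<otimes>\<^bsub>G\<^esub> u = u" "u \<otimes>\<^bsub>G\<^esub> \<one>\<^bsub>G\<^esub> = u" by (simp_all add: u(1) c)
  fix v assume "v \<in> carrier G"
  then obtain j x' y' where v: "v = (x', y')" "x' \<in> AC j" "y' \<in> BC j" by auto
  note c' = car(1)[OF v(2)] car(2)[OF v(3)]
  show "u \<otimes>\<^bsub>G\<^esub> v \<in> carrier G"
    using mult(1)[OF u(2) v(2)] mult(2)[OF u(3) v(3)] by (auto simp: u(1) v(1))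
  fix w assume "w \<in> carrier G"
  then obtain k x'' y'' where w: "w = (x'', y'')" "x'' \<in> AC k" "y'' \<in> BC k" by auto
  note c'' = car(1)[OF w(2)] car(2)[OF w(3)]
  show "u \<otimes>\<^bsub>G\<^esub> v \<otimes>\<^bsub>G\<^esub> w = u \<otimes>\<^bsub>G\<^esub> (v \<otimes>\<^bsub>G\<^esub> w)"
    by (simp add: u(1) v(1) w(1) c c' c'' A.m_assoc B.m_assoc)
qed

lemma tensor_relsI:
  "x \<in> AC i \<Longrightarrow> x' \<in> AC i \<Longrightarrow> y \<in> BC i \<Longrightarrow>
    mon_pair = Poly_Mapping.single (x \<oplus>\<^bsub>A\<^esub> x', y) 1 - Poly_Mapping.single (x, y) 1 - Poly_Mapping.single (x', y) 1
    \<Longrightarrow> mon_pair \<in> tensor_rels A B AC BC mA mB"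
  "x \<in> AC i \<Longrightarrow> y \<in> BC i \<Longrightarrow> y' \<in> BC i \<Longrightarrow>
    mon_pair = Poly_Mapping.single (x, y \<oplus>\<^bsub>B\<^esub> y') 1 - Poly_Mapping.single (x, y) 1 - Poly_Mapping.single (x, y') 1
    \<Longrightarrow> mon_pair \<in> tensor_rels A B AC BC mA mB"
  "x \<in> AC i \<Longrightarrow> y \<in> BC i \<Longrightarrow>
    mon_pair = Poly_Mapping.single (c \<odot>\<^bsub>A\<^esub> x, y) 1 - Poly_Mapping.single (x, y) c
    \<Longrightarrow> mon_pair \<in> tensor_rels A B AC BC mA mB"
  "x \<in> AC i \<Longrightarrow> y \<in> BC i \<Longrightarrow>
    mon_pair = Poly_Mapping.single (x, c \<odot>\<^bsub>B\<^esub> y) 1 - Poly_Mapping.single (x, y) c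
    \<Longrightarrow> mon_pair \<in> tensor_rels A B AC BC mA mB"
  "x \<in> AC i \<Longrightarrow> y \<in> BC i \<Longrightarrow>
    mon_pair = Poly_Mapping.single (mA f \<otimes>\<^bsub>A\<^esub> x, y) 1 - Poly_Mapping.single (x, mB f \<otimes>\<^bsub>B\<^esub> y) 1
    \<Longrightarrow> mon_pair \<in> tensor_rels A B AC BC mA mB"
  unfolding tensor_rels_def Let_def
  subgoal by (rule UN_I[of i], rule UNIV_I, rule UnI1, rule UnI1, rule UnI1, rule UnI1, blast)
  subgoal by (rule UN_I[of i], rule UNIV_I, rule UnI1, rule UnI1, rule UnI1, rule UnI2, blast)
  subgoal by (rule UN_I[of i], rule UNIV_I, rule UnI1, rule UnI1, rule UnI2, blast)
  subgoal by (rule UN_I[of i], rule UNIV_I, rule UnI1, rule UnI2, blast)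
  subgoal by (rule UN_I[of i], rule UNIV_I, rule UnI2, blast)
  done

lemma tensor_relsE:
  assumes "p \<in> tensor_rels A B AC BC mA mB"
  obtains
    i x x' y where "x \<in> AC i" "x' \<in> AC i" "y \<in> BC i"
    "p = Poly_Mapping.single (x \<oplus>\<^bsub>A\<^esub> x', y) 1 - Poly_Mapping.single (x, y) 1 - Poly_Mapping.single (x', y) 1"
  | i x y y' where "x \<in> AC i" "y \<in> BC i" "y' \<in> BC i"
    "p = Poly_Mapping.single (x, y \<oplus>\<^bsub>B\<^esub> y') 1 - Poly_Mapping.single (x, y) 1 - Poly_Mapping.single (x, y') 1"
  | i x y c where "x \<in> AC i" "y \<in> BC i"
    "p = Poly_Mapping.single (c \<odot>\<^bsub>A\<^esub> x, y) 1 - Poly_Mapping.single (x, y) c"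
  | i x y c where "x \<in> AC i" "y \<in> BC i"
    "p = Poly_Mapping.single (x, c \<odot>\<^bsub>B\<^esub> y) 1 - Poly_Mapping.single (x, y) c"
  | i x y f where "x \<in> AC i" "y \<in> BC i"
    "p = Poly_Mapping.single (mA f \<otimes>\<^bsub>A\<^esub> x, y) 1 - Poly_Mapping.single (x, mB f \<otimes>\<^bsub>B\<^esub> y) 1"
  using assms unfolding tensor_rels_def Let_def
  apply (elim UN_E UnE)
  subgoal by (elim CollectE exE conjE) (rule that(1))
  subgoal by (elim CollectE exE conjE) (rule that(2))
  subgoal by (elim CollectE exE conjE) (rule that(3))
  subgoal by (elim CollectE exE conjE) (rule that(4))
  subgoal by (elim CollectE exE conjE) (rule that(5))
  done

lemma copies_mult: "x \<in> AC i \<Longrightarrow> mA f \<otimes>\<^bsub>A\<^esub> x \<in> AC i" "y \<in> BC i \<Longrightarrow> mB f \<otimes>\<^bsub>B\<^esub> y \<in> BC i"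
  using mult(1)[OF copies(1)] mult(2)[OF copies(2)] by force+

lemma tensor_rels_carrier:
  assumes "p \<in> tensor_rels A B AC BC mA mB"
  shows "p \<in> carrier (monoid_algebra G)"
proof -
  interpret ring "monoid_algebra G" by (rule monoid_algebra_ring[OF monoid_G])
  have s: "Poly_Mapping.single (x, y) c \<in> carrier (monoid_algebra G)" if "x \<in> AC i" "y \<in> BC i" for x y c i
    using that by (auto simp: monoid_algebra_simps)
  have m: "p - r \<in> carrier (monoid_algebra G)"
    if "p \<in> carrier (monoid_algebra G)" "r \<in> carrier (monoid_algebra G)" for p r
    using that minus_closed[OF that] by (simp add: monoid_algebra_minus[OF monoid_G])
  show ?thesis
    using assms
  proof (cases rule: tensor_relsE)
    case (1 i x x' y)
    show ?thesis unfolding 1(4)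
      by (intro m s[of _ i]) (use 1 add in auto)
  next
    case (2 i x y y')
    show ?thesis unfolding 2(4)
      by (intro m s[of _ i]) (use 2 add in auto)
  next
    case (3 i x y c)
    show ?thesis unfolding 3(3)
      by (intro m s[of _ i]) (use 3 smult in auto)
  next
    case (4 i x y c)
    show ?thesis unfolding 4(3)
      by (intro m s[of _ i]) (use 4 smult in auto)
  next
    case (5 i x y f)
    show ?thesis unfolding 5(3)
      by (intro m s[of _ i]) (use 5 copies_mult in auto)
  qed
qed

lemma N_carrier: "N \<subseteq> carrier (monoid_algebra G)"
proof
  interpret calg "monoid_algebra G" by (rule calg_monoid_algebra[OF monoid_G])
  fix p assume "p \<in> N"
  then show "p \<in> carrier (monoid_algebra G)"
  proof induction
    case lin_span_zero
    show ?case by (simp add: monoid_algebra_simps(4))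
  next
    case (lin_span_base p)
    then show ?case by (rule tensor_rels_carrier)
  next
    case (lin_span_add p r)
    then show ?case using a_closed[of p r] by (simp add: monoid_algebra_simps(2))
  next
    case (lin_span_scale p c)
    then show ?case using smult_closed[of p c] by (simp add: monoid_algebra_simps(5))
  qed
qed

text \<open>A relation multiplied by a pure tensor of homogeneous elements is again a relation of
  the same kind, so the linear span is already a two-sided ideal and the componentwise product
  descends.\<close>

lemma ideal_N: "ideal N (monoid_algebra G)"
proof (rule monoid_algebra_idealI[OF monoid_G N_carrier])
  interpret calg "monoid_algebra G" by (rule calg_monoid_algebra[OF monoid_G])
  let ?M = "monoid_algebra G"
  note simps = monoid_algebra_mult_minus monoid_algebra_mult_single
  fix u p assume u: "u \<in> carrier G" and p: "p \<in> N"
  then obtain i0 x0 y0 where u0: "u = (x0, y0)" "x0 \<in> AC i0" "y0 \<in> BC i0" by auto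
  note c0 = car(1)[OF u0(2)] car(2)[OF u0(3)]
  have uM: "Poly_Mapping.single u 1 \<in> carrier ?M" using u by (simp add: monoid_algebra_simps)
  show "Poly_Mapping.single u 1 \<otimes>\<^bsub>?M\<^esub> p \<in> N"
    using p
  proof induction
    case (lin_span_base p)
    then show ?case
    proof (cases rule: tensor_relsE)
      case (1 i x x' y)
      note c = car(1)[OF 1(1)] car(1)[OF 1(2)] car(2)[OF 1(3)] c0
      show ?thesis using 1
        by (intro lin_span.lin_span_base tensor_relsI(1)[of "x0 \<otimes>\<^bsub>A\<^esub> x" "i0 + i" "x0 \<otimes>\<^bsub>A\<^esub> x'" "y0 \<otimes>\<^bsub>B\<^esub> y"])
           (auto simp: simps u0 mult A.r_distr c)
    next
      case (2 i x y y')
      note c = car(1)[OF 2(1)] car(2)[OF 2(2)] car(2)[OF 2(3)] c0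
      show ?thesis using 2
        by (intro lin_span.lin_span_base tensor_relsI(2)[of "x0 \<otimes>\<^bsub>A\<^esub> x" "i0 + i" "y0 \<otimes>\<^bsub>B\<^esub> y" "y0 \<otimes>\<^bsub>B\<^esub> y'"])
           (auto simp: simps u0 mult B.r_distr c)
    next
      case (3 i x y c)
      note c = car(1)[OF 3(1)] car(2)[OF 3(2)] c0
      show ?thesis using 3
        by (intro lin_span.lin_span_base tensor_relsI(3)[of "x0 \<otimes>\<^bsub>A\<^esub> x" "i0 + i" "y0 \<otimes>\<^bsub>B\<^esub> y" _ c])
           (auto simp: simps u0 mult A.smult_mult_right c)
    next
      case (4 i x y c)
      note c = car(1)[OF 4(1)] car(2)[OF 4(2)] c0
      show ?thesis using 4
        by (intro lin_span.lin_span_base tensor_relsI(4)[of "x0 \<otimes>\<^bsub>A\<^esub> x" "i0 + i" "y0 \<otimes>\<^bsub>B\<^esub> y" _ c])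
           (auto simp: simps u0 mult B.smult_mult_right c)
    next
      case (5 i x y f)
      note c = car(1)[OF 5(1)] car(2)[OF 5(2)] car(1)[OF copies(1)] car(2)[OF copies(2)] c0
      \<comment> \<open>The only case that needs the grading: \<open>f\<close> must leave the middle
        of the product, and it turns into \<open>\<sigma> i0 f\<close> on both sides of the tensor
        sign.\<close>
      have "x0 \<otimes>\<^bsub>A\<^esub> (mA f \<otimes>\<^bsub>A\<^esub> x) = mA (\<sigma> i0 f) \<otimes>\<^bsub>A\<^esub> (x0 \<otimes>\<^bsub>A\<^esub> x)"
        using swap(1)[OF u0(2), of f] by (simp add: A.m_assoc[symmetric] c)
      moreover have "y0 \<otimes>\<^bsub>B\<^esub> (mB f \<otimes>\<^bsub>B\<^esub> y) = mB (\<sigma> i0 f) \<otimes>\<^bsub>B\<^esub> (y0 \<otimes>\<^bsub>B\<^esub> y)"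
        using swap(2)[OF u0(3), of f] by (simp add: B.m_assoc[symmetric] c)
      ultimately show ?thesis using 5
        by (intro lin_span.lin_span_base tensor_relsI(5)[of "x0 \<otimes>\<^bsub>A\<^esub> x" "i0 + i" "y0 \<otimes>\<^bsub>B\<^esub> y" _ "\<sigma> i0 f"])
           (auto simp: simps u0 mult)
    qed
  next
    case (lin_span_scale p c)
    have "p \<in> carrier ?M" using lin_span_scale(1) N_carrier by blast
    from smult_mult_right[OF uM this, of c] lin_span.lin_span_scale[OF lin_span_scale(2), of c]
    show ?case by (simp add: monoid_algebra_simps(5))
  qed (auto simp: monoid_algebra_mult_add_right intro: lin_span.intros)
  show "p \<otimes>\<^bsub>?M\<^esub> Poly_Mapping.single u 1 \<in> N"
    using p
  proof induction
    case (lin_span_base p)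
    then show ?case
    proof (cases rule: tensor_relsE)
      case (1 i x x' y)
      note c = car(1)[OF 1(1)] car(1)[OF 1(2)] car(2)[OF 1(3)] c0
      show ?thesis using 1
        by (intro lin_span.lin_span_base tensor_relsI(1)[of "x \<otimes>\<^bsub>A\<^esub> x0" "i + i0" "x' \<otimes>\<^bsub>A\<^esub> x0" "y \<otimes>\<^bsub>B\<^esub> y0"])
           (auto simp: simps u0 mult A.l_distr c)
    next
      case (2 i x y y')
      note c = car(1)[OF 2(1)] car(2)[OF 2(2)] car(2)[OF 2(3)] c0
      show ?thesis using 2
        by (intro lin_span.lin_span_base tensor_relsI(2)[of "x \<otimes>\<^bsub>A\<^esub> x0" "i + i0" "y \<otimes>\<^bsub>B\<^esub> y0" "y' \<otimes>\<^bsub>B\<^esub> y0"])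
           (auto simp: simps u0 mult B.l_distr c)
    next
      case (3 i x y c)
      note c = car(1)[OF 3(1)] car(2)[OF 3(2)] c0
      show ?thesis using 3
        by (intro lin_span.lin_span_base tensor_relsI(3)[of "x \<otimes>\<^bsub>A\<^esub> x0" "i + i0" "y \<otimes>\<^bsub>B\<^esub> y0" _ c])
           (auto simp: simps u0 mult A.smult_mult_left c)
    next
      case (4 i x y c)
      note c = car(1)[OF 4(1)] car(2)[OF 4(2)] c0
      show ?thesis using 4
        by (intro lin_span.lin_span_base tensor_relsI(4)[of "x \<otimes>\<^bsub>A\<^esub> x0" "i + i0" "y \<otimes>\<^bsub>B\<^esub> y0" _ c])
           (auto simp: simps u0 mult B.smult_mult_left c)
    next
      case (5 i x y f)
      note c = car(1)[OF 5(1)] car(2)[OF 5(2)] car(1)[OF copies(1)] car(2)[OF copies(2)] c0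
      show ?thesis using 5
        by (intro lin_span.lin_span_base tensor_relsI(5)[of "x \<otimes>\<^bsub>A\<^esub> x0" "i + i0" "y \<otimes>\<^bsub>B\<^esub> y0" _ f])
           (auto simp: simps u0 mult A.m_assoc B.m_assoc c)
    qed
  next
    case (lin_span_scale p c)
    have "p \<in> carrier ?M" using lin_span_scale(1) N_carrier by blast
    from smult_mult_left[OF this uM, of c] lin_span.lin_span_scale[OF lin_span_scale(2), of c]
    show ?case by (simp add: monoid_algebra_simps(5))
  qed (auto simp: monoid_algebra_mult_add_left intro: lin_span.intros)
qed (auto intro: lin_span.intros)

lemma tensor_quotient:
  shows calg_T: "calg T"
    and class_hom: "(\<lambda>p. N +>\<^bsub>monoid_algebra G\<^esub> p) \<in> alg_hom (monoid_algebra G) T"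
    and class_eq: "\<And>p r. p \<in> carrier (monoid_algebra G) \<Longrightarrow> r \<in> carrier (monoid_algebra G) \<Longrightarrow>
      N +>\<^bsub>monoid_algebra G\<^esub> p = N +>\<^bsub>monoid_algebra G\<^esub> r \<longleftrightarrow> p - r \<in> N"
  using calg_quot_algebra[OF calg_monoid_algebra[OF monoid_G] ideal_N]
  by (auto simp: monoid_algebra_simps(5) lin_span.lin_span_scale tensor_def tensor_free_def
      monoid_algebra_minus[OF monoid_G])

sublocale T: calg T by (rule calg_T)

definition tp :: "'a \<Rightarrow> 'b \<Rightarrow> (('a \<times> 'b) \<Rightarrow>\<^sub>0 complex) set" where
  "tp = tens A B AC BC mA mB"

lemma tp_eq: "tp x y = N +>\<^bsub>monoid_algebra G\<^esub> Poly_Mapping.single (x, y) 1"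
  by (simp add: tp_def tens_def tensor_free_def)

lemma single_carrier:
  "x \<in> AC i \<Longrightarrow> y \<in> BC i \<Longrightarrow> Poly_Mapping.single (x, y) c \<in> carrier (monoid_algebra G)"
  by (auto simp: monoid_algebra_simps)

lemma class_hom_simps:
  assumes "p \<in> carrier (monoid_algebra G)" "r \<in> carrier (monoid_algebra G)"
  shows "N +>\<^bsub>monoid_algebra G\<^esub> p \<in> carrier T"
    "N +>\<^bsub>monoid_algebra G\<^esub> (p + r) = (N +>\<^bsub>monoid_algebra G\<^esub> p) \<oplus>\<^bsub>T\<^esub> (N +>\<^bsub>monoid_algebra G\<^esub> r)"
    "N +>\<^bsub>monoid_algebra G\<^esub> (p \<otimes>\<^bsub>monoid_algebra G\<^esub> r) = (N +>\<^bsub>monoid_algebra G\<^esub> p) \<otimes>\<^bsub>T\<^esub> (N +>\<^bsub>monoid_algebra G\<^esub> r)"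
    "N +>\<^bsub>monoid_algebra G\<^esub> (Poly_Mapping.map ((*) c) p) = c \<odot>\<^bsub>T\<^esub> (N +>\<^bsub>monoid_algebra G\<^esub> p)"
  using class_hom assms
  by (auto simp: alg_hom_def ring_hom_def monoid_algebra_simps(2,5) Pi_iff simp del: monoid_algebra_simps(4))

lemma tp_closed: "x \<in> AC i \<Longrightarrow> y \<in> BC i \<Longrightarrow> tp x y \<in> carrier T"
  using class_hom_simps(1)[OF single_carrier single_carrier] by (simp add: tp_eq)

lemma one_T: "\<one>\<^bsub>T\<^esub> = tp \<one>\<^bsub>A\<^esub> \<one>\<^bsub>B\<^esub>"
  using class_hom by (auto simp: alg_hom_def ring_hom_def tp_eq monoid_algebra_simps(3))

definition tn :: "'a \<Rightarrow> 'b \<Rightarrow> (('a \<times> 'b) \<Rightarrow>\<^sub>0 complex) set palg" where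
  "tn x y = emb T (tp x y)"

lemma tn_mult:
  assumes "x \<in> AC i" "y \<in> BC i" "x' \<in> AC j" "y' \<in> BC j"
  shows "tn x y * tn x' y' = tn (x \<otimes>\<^bsub>A\<^esub> x') (y \<otimes>\<^bsub>B\<^esub> y')"
  using class_hom_simps(3)[OF single_carrier[OF assms(1,2), of 1] single_carrier[OF assms(3,4), of 1]]
    tp_closed[OF assms(1,2)] tp_closed[OF assms(3,4)]
  by (simp add: tn_def T.emb_simps tp_eq monoid_algebra_mult_single)

lemma emb_class_rel:
  assumes "p - r \<in> tensor_rels A B AC BC mA mB"
    "p \<in> carrier (monoid_algebra G)" "r \<in> carrier (monoid_algebra G)"
  shows "emb T (N +>\<^bsub>monoid_algebra G\<^esub> p) = emb T (N +>\<^bsub>monoid_algebra G\<^esub> r)"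
  using class_eq[OF assms(2,3)] lin_span.lin_span_base[OF assms(1)] by (rule arg_cong[OF iffD2])

lemma emb_class_add:
  assumes "p \<in> carrier (monoid_algebra G)" "r \<in> carrier (monoid_algebra G)"
  shows "emb T (N +>\<^bsub>monoid_algebra G\<^esub> (p + r)) =
    emb T (N +>\<^bsub>monoid_algebra G\<^esub> p) + emb T (N +>\<^bsub>monoid_algebra G\<^esub> r)"
  using class_hom_simps(1,2)[OF assms] class_hom_simps(1)[OF assms(2,1)] by (simp add: T.emb_simps)

lemma emb_class_single:
  assumes "x \<in> AC i" "y \<in> BC i"
  shows "emb T (N +>\<^bsub>monoid_algebra G\<^esub> Poly_Mapping.single (x, y) c) = scl c (tn x y)"
  using class_hom_simps(1)[OF single_carrier[OF assms, of 1] single_carrier[OF assms, of 1]]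
    class_hom_simps(4)[OF single_carrier[OF assms, of 1] single_carrier[OF assms, of 1], of c]
  by (simp add: T.emb_simps tn_def tp_eq)

lemma tn_add_left:
  assumes "x \<in> AC i" "x' \<in> AC i" "y \<in> BC i"
  shows "tn (x \<oplus>\<^bsub>A\<^esub> x') y = tn x y + tn x' y"
proof -
  have c: "Poly_Mapping.single (x, y) 1 + Poly_Mapping.single (x', y) 1 \<in> carrier (monoid_algebra G)"
    using ring.ring_simprules(1)[OF monoid_algebra_ring[OF monoid_G]
        single_carrier[OF assms(1,3), of 1] single_carrier[OF assms(2,3), of 1]]
    by (simp only: monoid_algebra_simps(2))
  have "emb T (N +>\<^bsub>monoid_algebra G\<^esub> Poly_Mapping.single (x \<oplus>\<^bsub>A\<^esub> x', y) 1) =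
      emb T (N +>\<^bsub>monoid_algebra G\<^esub> (Poly_Mapping.single (x, y) 1 + Poly_Mapping.single (x', y) 1))"
    by (rule emb_class_rel[OF tensor_relsI(1)[OF assms]])
       (use c single_carrier[OF add(1)[OF assms(1,2)] assms(3)] in \<open>simp_all add: diff_diff_eq\<close>)
  then show ?thesis
    by (simp add: emb_class_add[OF single_carrier[OF assms(1,3)] single_carrier[OF assms(2,3)]]
      emb_class_single[OF add(1)[OF assms(1,2)] assms(3)] emb_class_single[OF assms(1,3)]
      emb_class_single[OF assms(2,3)] scl_simps)
qed

lemma tn_add_right:
  assumes "x \<in> AC i" "y \<in> BC i" "y' \<in> BC i"
  shows "tn x (y \<oplus>\<^bsub>B\<^esub> y') = tn x y + tn x y'"
proof -
  have c: "Poly_Mapping.single (x, y) 1 + Poly_Mapping.single (x, y') 1 \<in> carrier (monoid_algebra G)"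
    using ring.ring_simprules(1)[OF monoid_algebra_ring[OF monoid_G]
        single_carrier[OF assms(1,2), of 1] single_carrier[OF assms(1,3), of 1]]
    by (simp only: monoid_algebra_simps(2))
  have "emb T (N +>\<^bsub>monoid_algebra G\<^esub> Poly_Mapping.single (x, y \<oplus>\<^bsub>B\<^esub> y') 1) =
      emb T (N +>\<^bsub>monoid_algebra G\<^esub> (Poly_Mapping.single (x, y) 1 + Poly_Mapping.single (x, y') 1))"
    by (rule emb_class_rel[OF tensor_relsI(2)[OF assms]])
       (use c single_carrier[OF assms(1) add(2)[OF assms(2,3)]] in \<open>simp_all add: diff_diff_eq\<close>)
  then show ?thesis
    by (simp add: emb_class_add[OF single_carrier[OF assms(1,2)] single_carrier[OF assms(1,3)]]
      emb_class_single[OF assms(1) add(2)[OF assms(2,3)]] emb_class_single[OF assms(1,2)]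
      emb_class_single[OF assms(1,3)] scl_simps)
qed

lemma tn_smult:
  assumes "x \<in> AC i" "y \<in> BC i"
  shows "tn (c \<odot>\<^bsub>A\<^esub> x) y = scl c (tn x y)" "tn x (c \<odot>\<^bsub>B\<^esub> y) = scl c (tn x y)"
  using emb_class_rel[OF tensor_relsI(3)[OF assms refl, of c] single_carrier[OF smult(1)[OF assms(1)] assms(2)]
      single_carrier[OF assms]]
    emb_class_rel[OF tensor_relsI(4)[OF assms refl, of c] single_carrier[OF assms(1) smult(2)[OF assms(2)]]
      single_carrier[OF assms]]
  by (simp_all add: emb_class_single[OF assms] emb_class_single[OF smult(1)[OF assms(1)] assms(2)]
      emb_class_single[OF assms(1) smult(2)[OF assms(2)]] scl_simps)

lemma tn_balanced:
  assumes "x \<in> AC i" "y \<in> BC i"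
  shows "tn (mA f \<otimes>\<^bsub>A\<^esub> x) y = tn x (mB f \<otimes>\<^bsub>B\<^esub> y)"
  using emb_class_rel[OF tensor_relsI(5)[OF assms refl, of f]
      single_carrier[OF copies_mult(1)[OF assms(1)] assms(2)] single_carrier[OF assms(1) copies_mult(2)[OF assms(2)]]]
  by (simp add: emb_class_single[OF copies_mult(1)[OF assms(1)] assms(2)]
      emb_class_single[OF assms(1) copies_mult(2)[OF assms(2)]] scl_simps)

text \<open>The universal property of the balanced tensor product, phrased for equal sums of pure
  tensors: this is the form in which coefficients are compared later.\<close>

lemma tn_functional:
  fixes \<psi> :: "'a \<Rightarrow> 'b \<Rightarrow> 'c palg"
  assumes \<psi>: "\<And>i x x' y. x \<in> AC i \<Longrightarrow> x' \<in> AC i \<Longrightarrow> y \<in> BC i \<Longrightarrow> \<psi> (x \<oplus>\<^bsub>A\<^esub> x') y = \<psi> x y + \<psi> x' y"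
    "\<And>i x y y'. x \<in> AC i \<Longrightarrow> y \<in> BC i \<Longrightarrow> y' \<in> BC i \<Longrightarrow> \<psi> x (y \<oplus>\<^bsub>B\<^esub> y') = \<psi> x y + \<psi> x y'"
    "\<And>i x y c. x \<in> AC i \<Longrightarrow> y \<in> BC i \<Longrightarrow> \<psi> (c \<odot>\<^bsub>A\<^esub> x) y = scl c (\<psi> x y)"
    "\<And>i x y c. x \<in> AC i \<Longrightarrow> y \<in> BC i \<Longrightarrow> \<psi> x (c \<odot>\<^bsub>B\<^esub> y) = scl c (\<psi> x y)"
    "\<And>i x y f. x \<in> AC i \<Longrightarrow> y \<in> BC i \<Longrightarrow> \<psi> (mA f \<otimes>\<^bsub>A\<^esub> x) y = \<psi> x (mB f \<otimes>\<^bsub>B\<^esub> y)"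
    and S: "finite S" "\<And>s. s \<in> S \<Longrightarrow> \<exists>i. x s \<in> AC i \<and> y s \<in> BC i"
      "\<And>s. s \<in> S \<Longrightarrow> \<exists>i. x' s \<in> AC i \<and> y' s \<in> BC i"
    and eq: "(\<Sum>s\<in>S. tn (x s) (y s)) = (\<Sum>s\<in>S. tn (x' s) (y' s))"
  shows "(\<Sum>s\<in>S. \<psi> (x s) (y s)) = (\<Sum>s\<in>S. \<psi> (x' s) (y' s))"
proof -
  interpret M: ring "monoid_algebra G" by (rule monoid_algebra_ring[OF monoid_G])
  have cl: "(\<Sum>s\<in>S. Poly_Mapping.single (x s, y s) 1) \<in> carrier (monoid_algebra G) \<and>
      emb T (N +>\<^bsub>monoid_algebra G\<^esub> (\<Sum>s\<in>S. Poly_Mapping.single (x s, y s) 1)) = (\<Sum>s\<in>S. tn (x s) (y s))"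
    if "\<And>s. s \<in> S \<Longrightarrow> \<exists>i. x s \<in> AC i \<and> y s \<in> BC i" for x y
    using S(1) that
  proof (induction S rule: finite_induct)
    case empty
    have "\<zero>\<^bsub>T\<^esub> = N" by (simp add: tensor_def quot_algebra_simps)
    moreover have "N +>\<^bsub>monoid_algebra G\<^esub> 0 = N"
      using M.a_rcos_zero[OF ideal_N lin_span_zero] .
    ultimately show ?case using T.emb_simps(1) by (simp add: monoid_algebra_simps(4))
  next
    case (insert a F)
    then obtain i where i: "x a \<in> AC i" "y a \<in> BC i" by blast
    note s = single_carrier[OF i, of 1]
    have F: "(\<Sum>s\<in>F. Poly_Mapping.single (x s, y s) 1) \<in> carrier (monoid_algebra G)"
      "emb T (N +>\<^bsub>monoid_algebra G\<^esub> (\<Sum>s\<in>F. Poly_Mapping.single (x s, y s) 1)) = (\<Sum>s\<in>F. tn (x s) (y s))"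
      using insert by auto
    show ?case
      using insert(1,2) M.a_closed[OF s F(1)] emb_class_add[OF s F(1)] emb_class_single[OF i, of 1] F(2)
      by (simp add: monoid_algebra_simps(2) scl_simps)
  qed
  let ?p = "(\<Sum>s\<in>S. Poly_Mapping.single (x s, y s) 1)" and ?r = "(\<Sum>s\<in>S. Poly_Mapping.single (x' s, y' s) 1)"
  note p = cl[OF S(2)] and r = cl[OF S(3)]
  have "N +>\<^bsub>monoid_algebra G\<^esub> ?p = N +>\<^bsub>monoid_algebra G\<^esub> ?r"
    using p r eq T.emb_inj[OF class_hom_simps(1)[of ?p ?p] class_hom_simps(1)[of ?r ?r]] by simp
  then have "?p - ?r \<in> N" using class_eq[of ?p ?r] p r by simp
  \<comment> \<open>The five hypotheses on \<open>\<psi>\<close> say that its linear extension to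
    pairs kills the five kinds of relations.\<close>
  then have "lin (\<lambda>(x, y). \<psi> x y) (?p - ?r) = 0"
    by (rule lin_span_lin_zero, elim tensor_relsE) (auto simp: \<psi> scl_simps)
  then show ?thesis by (simp add: scl_simps)
qed

end

section \<open>Exterior algebras\<close>

lemma mero_rel_self: "mero_rel f f \<longleftrightarrow> mero_fun f"
  by (simp add: mero_rel_def)

lemma mshift_hom:
  "mshift a (f + g) = mshift a f + mshift a g" "mshift a (f * g) = mshift a f * mshift a g"
  "mshift a (mconst c) = mconst c" "mshift a 0 = 0" "mshift a 1 = 1" "mshift a (- f) = - mshift a f"
  "mshift 0 f = f" "mshift a (mshift b f) = mshift (a + b) f"
proof -
  note sh = mero_fun_shift[of _ a]
  show "mshift a (f + g) = mshift a f + mshift a g"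
    by (transfer fixing: a) (simp add: mero_rel_def mero_fun_add sh)
  show "mshift a (f * g) = mshift a f * mshift a g"
    by (transfer fixing: a) (simp add: mero_rel_def mero_fun_mult sh)
  show "mshift a (- f) = - mshift a f"
    by (transfer fixing: a) (simp add: mero_rel_def mero_fun_uminus sh)
  show "mshift 0 f = f"
    by transfer (simp add: mero_rel_def)
  show "mshift a (mshift b f) = mshift (a + b) f"
    by (transfer fixing: a b) (simp add: mero_rel_def add.assoc mero_fun_shift[of _ "a + b"])
qed (transfer; simp add: mero_rel_def)+

lemma mshift_prod: "mshift a (prod F S) = (\<Prod>x\<in>S. mshift a (F x))"
  by (induction S rule: infinite_finite_induct) (auto simp: mshift_hom)

lemma mconst_hom:
  "mconst (c + d) = mconst c + mconst d" "mconst (c * d) = mconst c * mconst d"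
  "mconst 0 = 0" "mconst 1 = 1" "mconst (- c) = - mconst c"
proof -
  show "mconst (c + d) = mconst c + mconst d" by transfer (simp add: mero_rel_def)
  show "mconst (c * d) = mconst c * mconst d" "mconst 0 = 0" "mconst 1 = 1"
    by (transfer; simp add: mero_rel_def)+
  show "mconst (- c) = - mconst c" by transfer (simp add: mero_rel_def)
qed

lemma copy_simps:
  assumes "mero_copy_rels c \<subseteq> S"
  shows "pl S (mon [c (f + g)]) = pl S (mon [c f]) + pl S (mon [c g])"
    "pl S (mon [c (f * g)]) = pl S (mon [c f]) * pl S (mon [c g])"
    "pl S (mon [c (- f)]) = - pl S (mon [c f])"
    "pl S (mon [c 0]) = 0"
    "pl S (mon [c (mconst k)]) = scl k (pl S (mon []))"
    "pl S (mon [c (mconst k)]) * pl S p = scl k (pl S p)"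
    "pl S (mon [c 1]) = pl S (mon [])"
proof -
  have "pl S (mon [c (f + g)] - mon [c f] - mon [c g]) = 0" for f g
    by (rule pl_eq_zero) (use assms in \<open>auto simp: mero_copy_rels_def\<close>)
  then show add: "pl S (mon [c (f + g)]) = pl S (mon [c f]) + pl S (mon [c g])" for f g
    by (simp add: pl_simps diff_eq_eq add.commute)
  have "pl S (mon [c (f * g)]) = pl S (mon [c f, c g])"
    by (rule pl_rel) (use assms in \<open>auto simp: mero_copy_rels_def\<close>)
  then show "pl S (mon [c (f * g)]) = pl S (mon [c f]) * pl S (mon [c g])"
    by (simp add: pl_Cons)
  show z: "pl S (mon [c 0]) = 0" using add[of 0 0] by simp
  show "pl S (mon [c (- f)]) = - pl S (mon [c f])"
    using add[of f "- f"] z by (simp add: eq_neg_iff_add_eq_0 add.commute)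
  have "pl S (mon [c (mconst k)]) = pl S (Poly_Mapping.single [] k)" for k
    by (rule pl_rel) (use assms in \<open>auto simp: mero_copy_rels_def\<close>)
  also have "pl S (Poly_Mapping.single [] k) = scl k (pl S (mon []))" for k
    using pl_simps(5)[of S k "mon []"] by simp
  finally show k: "pl S (mon [c (mconst k)]) = scl k (pl S (mon []))" for k .
  show "pl S (mon [c (mconst k)]) * pl S p = scl k (pl S p)"
    by (simp add: k scl_simps pl_one_mult)
  show "pl S (mon [c 1]) = pl S (mon [])"
    using k[of 1] by (simp add: mconst_hom scl_simps)
qed

definition hm :: "complex \<Rightarrow> 'n::finite \<Rightarrow> 'n \<Rightarrow> 'n mero" where
  "hm \<tau> i j = mdiff (h_fun \<tau>) i j"

text \<open>Only the difference of the two coordinates enters, and the shift does not change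
  it.\<close>

lemma mshift_hm:
  fixes i j :: "'n::finite" and a :: "complex ^ 'n"
  assumes "\<tau> \<noteq> 0" "i \<noteq> j" "a $ i = a $ j"
  shows "mshift a (hm \<tau> i j) = hm \<tau> i j"
  using assms mero_fun_h0_g_h(3)[OF assms(1,2)]
  by (simp add: hm_def mdiff_def mshift.abs_eq mero_rel_self)

lemma omega_nth: "(omega k :: complex ^ 'n::finite) $ i = (if i = k then 1 else 0)"
  by (simp add: omega_def axis_def)

definition ext_rels :: "('n::finite \<Rightarrow> 'n \<Rightarrow> bool) \<Rightarrow> complex \<Rightarrow> ('n egen list \<Rightarrow>\<^sub>0 complex) set" where
  "ext_rels lt \<tau> =
     mero_copy_rels FunE \<union>
     {mon [Egen i, Egen i] | i. True} \<union>
     {mon [Egen j, Egen i] + mon [FunE (hm \<tau> j i), Egen i, Egen j] | i j. lt i j} \<union>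
     {mon [FunE f, Egen i] - mon [Egen i, FunE (mshift (omega i) f)] | f i. True}"

lemma W_rels_eq: "W_rels \<tau> = ext_rels (<) \<tau>"
  by (simp add: W_rels_def ext_rels_def hm_def)

lemma V_rels_eq: "V_rels \<tau> = ext_rels (\<lambda>i j. j < i) \<tau>"
proof -
  have "{mon [Egen i, Egen j] + mon [FunE (mdiff (h_fun \<tau>) i j), Egen j, Egen i] | i j. i < j} =
    {mon [Egen j, Egen i] + mon [FunE (mdiff (h_fun \<tau>) j i), Egen i, Egen j] | i j. j < (i :: 'a)}"
    by blast
  then show ?thesis by (simp add: V_rels_def ext_rels_def hm_def)
qed

text \<open>Covers \<open>W\<close> and \<open>V\<close> together. The ordered listing of a set is a
  parameter because it is the increasing list for one order and its reversal for the other; the two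
  rules for \<open>slist\<close> are all that is asked of it.\<close>

locale ext_alg = linorder le lt for le lt :: "'n::finite \<Rightarrow> 'n \<Rightarrow> bool" +
  fixes \<tau> :: complex and slist :: "'n set \<Rightarrow> 'n list"
  assumes \<tau>: "\<tau> \<noteq> 0" and slist_empty: "slist {} = []"
    and slist_insert: "\<And>j I. (\<And>y. y \<in> I \<Longrightarrow> lt j y) \<Longrightarrow> slist (insert j I) = j # slist I"
begin

abbreviation "S \<equiv> ext_rels lt \<tau>"
abbreviation "E \<equiv> presented S"

text \<open>The factor that arises when \<open>e x\<close> is moved to its place in the ordered
  product over \<open>I\<close>: one factor for each index that it has to pass, see
  \<open>e_es\<close>.\<close>

definition Q :: "'n \<Rightarrow> 'n set \<Rightarrow> 'n mero" where
  "Q x I = (\<Prod>y\<in>{y\<in>I. lt y x}. - hm \<tau> x y)"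

lemma mshift_Q: "j \<noteq> x \<Longrightarrow> j \<notin> I \<Longrightarrow> mshift (omega j) (Q x I) = Q x I"
  "j \<noteq> x \<Longrightarrow> j \<notin> I \<Longrightarrow> mshift (- omega j) (Q x I) = Q x I"
proof -
  have "mshift a (- hm \<tau> x y) = - hm \<tau> x y"
    if "j \<noteq> x" "j \<notin> I" "y \<in> I" "lt y x" "a = omega j \<or> a = - omega j" for y and a :: "complex ^ 'n"
  proof -
    have "x \<noteq> y" "y \<noteq> j" using that by auto
    then show ?thesis using that mshift_hm[OF \<tau>, of x y a] by (auto simp: mshift_hom omega_nth)
  qed
  then show "j \<noteq> x \<Longrightarrow> j \<notin> I \<Longrightarrow> mshift (omega j) (Q x I) = Q x I"
    "j \<noteq> x \<Longrightarrow> j \<notin> I \<Longrightarrow> mshift (- omega j) (Q x I) = Q x I"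
    unfolding Q_def mshift_prod by (intro prod.cong refl; simp)+
qed

lemma Q_insert_less: "lt y x \<Longrightarrow> y \<notin> I \<Longrightarrow> Q x (insert y I) = - hm \<tau> x y * Q x I"
proof -
  assume "lt y x" "y \<notin> I"
  then have "{z \<in> insert y I. lt z x} = insert y {z \<in> I. lt z x}" "y \<notin> {z \<in> I. lt z x}" by auto
  then show ?thesis by (simp add: Q_def)
qed

lemma Q_insert_ge: "\<not> lt y x \<Longrightarrow> Q x (insert y I) = Q x I"
  unfolding Q_def by (intro prod.cong) auto

lemma Q_empty [simp]: "Q x {} = 1"
  by (simp add: Q_def)

lemma Q_min: "(\<And>y. y \<in> I \<Longrightarrow> lt x y) \<Longrightarrow> Q x I = 1"
  unfolding Q_def by (rule prod.neutral) (auto dest: less_asym)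

text \<open>The family \<open>v\<close> stands for the sum of all \<open>v I\<close> times
  \<open>e_I\<close>. Multiplying by \<open>e i\<close> on the left moves \<open>v K\<close> out to
  the left, which shifts its argument by minus \<open>omega i\<close>, and sorting
  \<open>e i\<close> into \<open>e_K\<close> costs \<open>Q i K\<close>; here \<open>K\<close> is
  \<open>I - {i}\<close>.\<close>

fun act :: "'n egen \<Rightarrow> ('n set \<Rightarrow> 'n mero) \<Rightarrow> 'n set \<Rightarrow> 'n mero" where
  "act (FunE f) v I = f * v I"
| "act (Egen i) v I = (if i \<in> I then mshift (- omega i) (v (I - {i})) * Q i (I - {i}) else 0)"

definition rep :: "('n egen list \<Rightarrow>\<^sub>0 complex) \<Rightarrow> ('n set \<Rightarrow> 'n mero) \<Rightarrow> 'n set \<Rightarrow> 'n mero" where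
  "rep p v I = (\<Sum>xs\<in>Poly_Mapping.keys p. mconst (Poly_Mapping.lookup p xs) * foldr act xs v I)"

lemma rep_superset:
  assumes "finite K" "Poly_Mapping.keys p \<subseteq> K"
  shows "rep p v I = (\<Sum>xs\<in>K. mconst (Poly_Mapping.lookup p xs) * foldr act xs v I)"
  unfolding rep_def using assms by (intro sum.mono_neutral_left) (auto simp: in_keys_iff mconst_hom)

lemma rep_zero [simp]: "rep 0 v I = 0"
  by (simp add: rep_def)

lemma rep_single [simp]: "rep (Poly_Mapping.single xs c) v I = mconst c * foldr act xs v I"
  by (subst rep_superset[of "{xs}"]) auto

lemma rep_add [simp]: "rep (p + r) v I = rep p v I + rep r v I"
proof -
  let ?K = "Poly_Mapping.keys p \<union> Poly_Mapping.keys r"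
  have *: "rep s v I = (\<Sum>k\<in>?K. mconst (Poly_Mapping.lookup s k) * foldr act k v I)"
    if "Poly_Mapping.keys s \<subseteq> ?K" for s
    using that by (intro rep_superset) auto
  show ?thesis
    by (subst (1 2 3) *) (use Poly_Mapping.keys_add[of p r] in
      \<open>auto simp: lookup_add mconst_hom distrib_right sum.distrib\<close>)
qed

lemma rep_scale [simp]: "rep (Poly_Mapping.map ((*) c) p) v I = mconst c * rep p v I"
  by (subst rep_superset[OF finite_keys keys_scale])
     (simp add: rep_def lookup_scale mconst_hom sum_distrib_left mult.assoc)

lemma rep_minus [simp]: "rep (p - r) v I = rep p v I - rep r v I"
  using rep_add[of "p - r" r v I] by simp

lemma act_linear:
  "foldr act xs (\<lambda>I. v I + v' I) J = foldr act xs v J + foldr act xs v' J"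
  "foldr act xs (\<lambda>I. mconst c * v I) J = mconst c * foldr act xs v J"
  "foldr act xs (\<lambda>I. 0) J = 0"
proof -
  have 1: "act g (\<lambda>I. v I + v' I) J = act g v J + act g v' J" for g v v' J
    by (cases g) (auto simp: mshift_hom algebra_simps)
  have 2: "act g (\<lambda>I. mconst c * v I) J = mconst c * act g v J" for g c v J
    by (cases g) (auto simp: mshift_hom algebra_simps)
  have 3: "act g (\<lambda>I. 0) J = 0" for g J
    by (cases g) (auto simp: mshift_hom)
  show "foldr act xs (\<lambda>I. v I + v' I) J = foldr act xs v J + foldr act xs v' J"
  proof (induction xs arbitrary: J)
    case (Cons g xs)
    have "foldr act xs (\<lambda>I. v I + v' I) = (\<lambda>J. foldr act xs v J + foldr act xs v' J)"
      by (rule ext) (rule Cons)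
    then show ?case by (simp add: 1)
  qed simp
  show "foldr act xs (\<lambda>I. mconst c * v I) J = mconst c * foldr act xs v J"
  proof (induction xs arbitrary: J)
    case (Cons g xs)
    have "foldr act xs (\<lambda>I. mconst c * v I) = (\<lambda>J. mconst c * foldr act xs v J)"
      by (rule ext) (rule Cons)
    then show ?case by (simp add: 2)
  qed simp
  show "foldr act xs (\<lambda>I. 0) J = 0"
  proof (induction xs arbitrary: J)
    case (Cons g xs)
    have "foldr act xs (\<lambda>I. 0) = (\<lambda>J. 0)" by (rule ext) (rule Cons)
    then show ?case by (simp add: 3)
  qed simp
qed

lemma rep_mult_left:
  "rep (mon xs \<otimes>\<^bsub>free_algebra\<^esub> p) v I = foldr act xs (rep p v) I"
proof -
  have "p \<in> carrier (monoid_algebra word_monoid)" by (simp add: monoid_algebra_simps)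
  then show ?thesis
    unfolding free_algebra_def
  proof (rule monoid_algebra_induct, goal_cases)
    case 1
    have "rep 0 v = (\<lambda>I. 0)" by (rule ext) simp
    then show ?case by (simp add: act_linear)
  next
    case (2 ys a)
    have "rep (Poly_Mapping.single ys a) v = (\<lambda>I. mconst a * foldr act ys v I)" by (rule ext) simp
    then show ?case by (simp add: act_linear monoid_algebra_mult_single)
  next
    case (3 p r)
    have "rep (p + r) v = (\<lambda>I. rep p v I + rep r v I)" by (rule ext) simp
    then show ?case using 3 by (simp add: act_linear monoid_algebra_mult_add_right)
  qed
qed

lemma rep_mult_right:
  "rep (p \<otimes>\<^bsub>free_algebra\<^esub> mon xs) v I = rep p (foldr act xs v) I"
proof -
  have "p \<in> carrier (monoid_algebra word_monoid)" by (simp add: monoid_algebra_simps)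
  then show ?thesis
    unfolding free_algebra_def
    by (rule monoid_algebra_induct)
       (auto simp: monoid_algebra_mult_single monoid_algebra_mult_add_left)
qed

text \<open>For the exchange relation both words produce the same doubly shifted coefficient times
  \<open>Q i K * Q j K\<close>. Only the word in which \<open>e j\<close> is applied after
  \<open>e i\<close> has to sort \<open>j\<close> past \<open>i\<close>, and this yields the extra
  factor \<open>- hm \<tau> j i\<close>.\<close>

lemma rep_rels:
  assumes "p \<in> S" shows "rep p v I = 0"
proof -
  have sw: "foldr act [Egen j, Egen i] v I + foldr act [FunE (hm \<tau> j i), Egen i, Egen j] v I = 0"
    if "lt i j" for i j
  proof (cases "i \<in> I \<and> j \<in> I")
    case True
    define K where "K = I - {i} - {j}"
    have K: "I - {j} - {i} = K" "I - {i} = insert j K" "I - {j} = insert i K" "i \<notin> K" "j \<notin> K" "i \<noteq> j"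
      using True that by (auto simp: K_def)
    have c: "- omega i - omega j = (- omega j - omega i :: complex ^ 'n)" by simp
    have n: "\<not> lt j i" using that by (auto dest: less_asym)
    have "foldr act [Egen j, Egen i] v I = mshift (- omega j) (mshift (- omega i) (v K) * Q i K) * Q j (insert i K)"
      using True K by simp
    also have "\<dots> = - hm \<tau> j i * (mshift (- omega j - omega i) (v K) * Q i K * Q j K)"
      using K that by (simp add: Q_insert_less mshift_hom mshift_Q)
    finally have 1: "foldr act [Egen j, Egen i] v I = \<dots>" .
    have "foldr act [FunE (hm \<tau> j i), Egen i, Egen j] v I =
        hm \<tau> j i * (mshift (- omega i) (mshift (- omega j) (v K) * Q j K) * Q i (insert j K))"
      using True K by simp
    also have "\<dots> = hm \<tau> j i * (mshift (- omega j - omega i) (v K) * Q i K * Q j K)"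
      using K n by (simp add: Q_insert_ge mshift_hom mshift_Q c)
    finally show ?thesis using 1 by simp
  next
    case False
    then show ?thesis by (auto simp: mshift_hom)
  qed
  have sh: "foldr act [FunE f, Egen i] v I = foldr act [Egen i, FunE (mshift (omega i) f)] v I" for f i
    by (auto simp: mshift_hom mult.assoc)
  have sq: "foldr act [Egen i, Egen i] v I = 0" for i
    by (auto simp: mshift_hom)
  show ?thesis
    using assms sw sh sq
    by (auto simp: ext_rels_def mero_copy_rels_def mconst_hom distrib_right mult.assoc
        simp del: foldr.simps) (auto simp: distrib_right mult.assoc)
qed

lemma rep_Idl:
  assumes "p \<in> Idl\<^bsub>free_algebra\<^esub> S" shows "rep p v I = 0"
proof -
  \<comment> \<open>All families \<open>v\<close> are taken at once, since right multiplication by a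
    word replaces \<open>v\<close> by its image under that word.\<close>
  let ?N = "{p. \<forall>v I. rep p v I = 0}"
  have "ideal ?N free_algebra"
    unfolding free_algebra_def
  proof (rule monoid_algebra_idealI[OF monoid_words])
    fix xs and p assume "p \<in> ?N"
    then have "rep p v = (\<lambda>I. 0)" for v by auto
    then show "mon xs \<otimes>\<^bsub>monoid_algebra word_monoid\<^esub> p \<in> ?N"
      by (simp add: rep_mult_left[unfolded free_algebra_def] act_linear)
  qed (auto simp: monoid_algebra_simps rep_mult_right[unfolded free_algebra_def])
  then have "Idl\<^bsub>free_algebra\<^esub> S \<subseteq> ?N"
    by (rule ring.genideal_minimal[OF free_algebra_ring]) (auto simp: rep_rels)
  then show ?thesis using assms by auto
qed

definition vac :: "'n set \<Rightarrow> 'n mero" where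
  "vac I = (if I = {} then 1 else 0)"

text \<open>Acting on \<open>vac\<close>, the coordinates of the unit, returns the coordinates of
  the element itself; \<open>rep_Idl\<close> makes them independent of the representative.\<close>

definition coef :: "'n set \<Rightarrow> 'n ext \<Rightarrow> 'n mero" where
  "coef I X = rep (SOME p. pclass S p = X) vac I"

lemma coef_pclass: "coef I (pclass S p) = rep p vac I"
proof -
  have "pclass S (SOME r. pclass S r = pclass S p) = pclass S p" by (rule someI) (rule refl)
  then have "(SOME r. pclass S r = pclass S p) - p \<in> Idl\<^bsub>free_algebra\<^esub> S" by (simp add: pclass_eq_iff)
  from rep_Idl[OF this, of vac I] show ?thesis by (simp add: coef_def)
qed

definition mu :: "'n mero \<Rightarrow> 'n ext" where "mu f = pclass S (mon [FunE f])"
definition e :: "'n \<Rightarrow> 'n ext" where "e i = pclass S (mon [Egen i])"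
definition es :: "'n set \<Rightarrow> 'n ext" where "es I = pclass S (mon (map Egen (slist I)))"

lemma coef_simps:
  assumes "X \<in> carrier E" "Y \<in> carrier E"
  shows "coef I (X \<oplus>\<^bsub>E\<^esub> Y) = coef I X + coef I Y" "coef I (c \<odot>\<^bsub>E\<^esub> X) = mconst c * coef I X"
    "coef I (mu f \<otimes>\<^bsub>E\<^esub> X) = f * coef I X"
proof -
  obtain p r where "X = pclass S p" "Y = pclass S r" using assms by (auto simp: carrier_presented)
  then show "coef I (X \<oplus>\<^bsub>E\<^esub> Y) = coef I X + coef I Y" "coef I (c \<odot>\<^bsub>E\<^esub> X) = mconst c * coef I X"
    "coef I (mu f \<otimes>\<^bsub>E\<^esub> X) = f * coef I X"
    by (simp_all add: pclass_simps coef_pclass mu_def rep_mult_left)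
qed

lemma set_induct [case_names empty insert]:
  fixes I :: "'n set"
  assumes "P {}" "\<And>j I. (\<And>y. y \<in> I \<Longrightarrow> lt j y) \<Longrightarrow> P I \<Longrightarrow> P (insert j I)"
  shows "P I"
proof (rule finite_linorder_min_induct[of I P])
  show "P (insert j I)" if "finite I" "\<forall>a\<in>I. lt j a" "P I" for j I
    using that by (intro assms(2)) auto
qed (auto intro: assms)

text \<open>Peeling off the smallest index never meets a smaller one, so all sorting factors are 1.
  The \<open>coef I\<close> are thus dual to the \<open>es J\<close>, which gives their linear
  independence over the meromorphic functions.\<close>

lemma coef_es: "coef I (es J) = (if I = J then 1 else 0)"
proof -
  have "foldr act (map Egen (slist J)) vac I = (if I = J then 1 else 0)"
  proof (induction J arbitrary: I rule: set_induct)
    case empty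
    then show ?case by (simp add: slist_empty vac_def)
  next
    case (insert j J)
    have "j \<notin> J" using insert(1) by blast
    then have "j \<in> I \<Longrightarrow> I - {j} = J \<longleftrightarrow> I = insert j J" by blast
    then show ?case
      using insert(2) Q_min[OF insert(1)] by (auto simp: slist_insert[OF insert(1)] mshift_hom)
  qed
  then show ?thesis by (simp add: es_def coef_pclass mconst_hom)
qed

section \<open>Reordering rules in the exterior algebra\<close>

lemma S_copies: "mero_copy_rels FunE \<subseteq> S"
  by (auto simp: ext_rels_def)

lemma mu_simps:
  "emb E (mu (f + g)) = emb E (mu f) + emb E (mu g)"
  "emb E (mu (f * g)) = emb E (mu f) * emb E (mu g)"
  "emb E (mu (- f)) = - emb E (mu f)"
  "mu 1 = \<one>\<^bsub>E\<^esub>"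
  using copy_simps[OF S_copies]
  by (simp_all add: mu_def pl_def[symmetric] pl_eq_iff[symmetric] pclass_simps)

lemma mu_e: "emb E (mu f) * emb E (e i) = emb E (e i) * emb E (mu (mshift (omega i) f))"
proof -
  have "pl S (mon [FunE f, Egen i]) = pl S (mon [Egen i, FunE (mshift (omega i) f)])"
    by (rule pl_rel) (auto simp: ext_rels_def)
  then show ?thesis by (simp add: mu_def e_def pl_def[symmetric] pl_Cons)
qed

lemma e_sq: "emb E (e i) * emb E (e i) = 0"
proof -
  have "pl S (mon [Egen i, Egen i]) = 0"
    by (rule pl_eq_zero) (auto simp: ext_rels_def)
  then show ?thesis by (simp add: e_def pl_def[symmetric] pl_Cons)
qed

lemma e_swap: "lt i j \<Longrightarrow> emb E (e j) * emb E (e i) = emb E (mu (- hm \<tau> j i)) * emb E (e i) * emb E (e j)"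
proof -
  assume "lt i j"
  then have "pl S (mon [Egen j, Egen i] + mon [FunE (hm \<tau> j i), Egen i, Egen j]) = 0"
    by (intro pl_eq_zero) (auto simp: ext_rels_def)
  then show ?thesis
    by (simp add: e_def mu_def pl_def[symmetric] pl_Cons mu_simps(3)[unfolded mu_def pl_def[symmetric]]
        pl_simps mult.assoc eq_neg_iff_add_eq_0)
qed

lemma es_simps: "es {} = \<one>\<^bsub>E\<^esub>" "(\<And>y. y \<in> I \<Longrightarrow> lt j y) \<Longrightarrow> es (insert j I) = e j \<otimes>\<^bsub>E\<^esub> es I"
  by (simp_all add: es_def e_def pclass_simps slist_empty slist_insert free_algebra_simps)

lemma closed: "mu f \<in> carrier E" "e i \<in> carrier E" "es I \<in> carrier E"
  by (simp_all add: mu_def e_def es_def pclass_simps)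

text \<open>Passing the smallest index \<open>j\<close> of the set costs
  \<open>- hm \<tau> x j\<close>. The remaining factor \<open>Q x I\<close> involves only
  coordinates other than \<open>j\<close>, so it commutes with \<open>e j\<close> and can be
  collected on the left.\<close>

lemma e_es_emb:
  "emb E (e x) * emb E (es I) = (if x \<in> I then 0 else emb E (mu (Q x I)) * emb E (es (insert x I)))"
proof (induction I rule: set_induct)
  interpret calg E by (rule calg_presented)
  case empty
  show ?case using es_simps(2)[of "{}" x]
    by (simp add: mu_simps es_simps(1) emb_simps(3)[symmetric] closed)
next
  interpret calg E by (rule calg_presented)
  case (insert j I)
  let ?m = "emb E"
  have j: "j \<notin> I" using insert(1) by blast
  have es: "?m (es (insert j I)) = ?m (e j) * ?m (es I)"
    using es_simps(2)[OF insert(1)] by (simp add: emb_simps closed)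
  consider "x = j" | "lt x j" | "lt j x" using less_linear by blast
  then show ?case
  proof cases
    case 1
    then show ?thesis by (simp add: es mult.assoc[symmetric] e_sq)
  next
    case 2
    then have l: "\<And>y. y \<in> insert j I \<Longrightarrow> lt x y" using insert(1) by (auto intro: less_trans)
    then have x: "x \<notin> insert j I" by blast
    show ?thesis
      using es_simps(2)[of "insert j I" x, OF l] x Q_min[of "insert j I" x, OF l] by (simp add: mu_simps emb_simps(3)[symmetric] closed)
  next
    case 3
    then have xj: "x \<noteq> j" by blast
    have "?m (e x) * ?m (es (insert j I)) = ?m (mu (- hm \<tau> x j)) * ?m (e j) * (?m (e x) * ?m (es I))"
      by (simp only: es mult.assoc[symmetric] e_swap[OF 3])
    also have "\<dots> = (if x \<in> I then 0 else ?m (mu (- hm \<tau> x j)) * ?m (e j) * ?m (mu (Q x I)) * ?m (es (insert x I)))"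
      by (simp add: insert(2) mult.assoc)
    also have "\<dots> = (if x \<in> insert j I then 0 else ?m (mu (Q x (insert j I))) * ?m (es (insert x (insert j I))))"
    proof (cases "x \<in> I")
      case False
      have "\<And>y. y \<in> insert x I \<Longrightarrow> lt j y" using insert(1) 3 by auto
      from es_simps(2)[of "insert x I" j, OF this] have *: "?m (es (insert x (insert j I))) = ?m (e j) * ?m (es (insert x I))"
        by (simp add: emb_simps closed insert_commute)
      have "?m (e j) * ?m (mu (Q x I)) = ?m (mu (Q x I)) * ?m (e j)"
        using mu_e[of "Q x I" j] xj j by (simp add: mshift_Q)
      then have "?m (mu (- hm \<tau> x j)) * (?m (e j) * ?m (mu (Q x I))) * ?m (es (insert x I)) =
          ?m (mu (- hm \<tau> x j)) * (?m (mu (Q x I)) * ?m (e j)) * ?m (es (insert x I))"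
        by (simp only:)
      then have "?m (mu (- hm \<tau> x j)) * ?m (e j) * ?m (mu (Q x I)) * ?m (es (insert x I)) =
          ?m (mu (- hm \<tau> x j)) * ?m (mu (Q x I)) * (?m (e j) * ?m (es (insert x I)))"
        by (simp only: mult.assoc)
      also have "\<dots> = ?m (mu (Q x (insert j I))) * ?m (es (insert x (insert j I)))"
        by (simp only: * Q_insert_less[OF 3 j] mu_simps(2))
      finally show ?thesis using False xj by simp
    qed auto
    finally show ?thesis .
  qed
qed

lemma e_es: "e x \<otimes>\<^bsub>E\<^esub> es I = (if x \<in> I then \<zero>\<^bsub>E\<^esub> else mu (Q x I) \<otimes>\<^bsub>E\<^esub> es (insert x I))"
proof -
  interpret calg E by (rule calg_presented)
  have "emb E (e x \<otimes>\<^bsub>E\<^esub> es I) = emb E (if x \<in> I then \<zero>\<^bsub>E\<^esub> else mu (Q x I) \<otimes>\<^bsub>E\<^esub> es (insert x I))"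
    using e_es_emb[of x I] by (auto simp: emb_simps closed)
  then show ?thesis by (subst (asm) emb_inj) (auto simp: closed)
qed

lemma es_degree: "sum_list (map edeg (map Egen (slist I))) = omega_set I"
proof (induction I rule: set_induct)
  case (insert j I)
  then have "j \<notin> I" by blast
  then show ?case using insert by (simp add: slist_insert omega_set_def)
qed (simp add: slist_empty omega_set_def)

end

text \<open>A function passes one letter at a time, and the additivity of \<open>\<sigma>\<close>
  turns the successive changes into the one for the degree of the word. All words of a homogeneous
  element have the same degree, so the change is common to them.\<close>

lemma hom_component_swap:
  fixes \<sigma> :: "'d::monoid_add \<Rightarrow> 'f \<Rightarrow> 'f"
  assumes letter: "\<And>g f. pl S (mon [g]) * pl S (mon [c f]) = pl S (mon [c (\<sigma> (deg g) f)]) * pl S (mon [g])"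
    and \<sigma>: "\<And>f. \<sigma> 0 f = f" "\<And>a b f. \<sigma> (a + b) f = \<sigma> a (\<sigma> b f)"
    and X: "X \<in> hom_component S deg d"
  shows "X \<otimes>\<^bsub>presented S\<^esub> pclass S (mon [c f]) = pclass S (mon [c (\<sigma> d f)]) \<otimes>\<^bsub>presented S\<^esub> X"
proof -
  have word: "pl S (mon xs) * pl S (mon [c f]) = pl S (mon [c (\<sigma> (sum_list (map deg xs)) f)]) * pl S (mon xs)" for xs f
  proof (induction xs)
    case Nil
    then show ?case by (simp add: \<sigma> pl_one_mult)
  next
    case (Cons g xs)
    have "pl S (mon (g # xs)) = pl S (mon [g]) * pl S (mon xs)"
      using pl_append[of S "[g]" xs] by simp
    then show ?case
      by (simp only: mult.assoc Cons list.map sum_list.Cons \<sigma>)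
         (simp only: mult.assoc[symmetric] letter)
  qed
  obtain p where p: "X = pclass S p" "\<forall>xs\<in>Poly_Mapping.keys p. sum_list (map deg xs) = d"
    using X by (auto simp: hom_component_def)
  have "pl S p * pl S (mon [c f]) = pl S (mon [c (\<sigma> d f)]) * pl S p"
    unfolding pl_eq_lin[of S p] lin_def sum_distrib_left sum_distrib_right
    by (rule sum.cong) (use p(2) word in \<open>auto simp: scl_simps\<close>)
  then show ?thesis
    by (simp add: p(1) pclass_simps pl_mult[symmetric] pl_eq_iff)
qed

section \<open>Scalar identities\<close>

text \<open>As a function of \<open>z\<close> the product has simple poles at the
  \<open>u x\<close>, with the numerators on the right as residues, and the value
  \<open>p ^ card X\<close> at infinity. The induction multiplies by one more factor.\<close>

lemma partial_fractions:
  fixes u :: "'i \<Rightarrow> 'a::field" and p s z :: 'a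
  assumes "finite X" "inj_on u X" "z \<notin> u ` X"
  shows "(\<Prod>y\<in>X. (p * z - s * u y) / (z - u y)) =
    p ^ card X + (\<Sum>x\<in>X. (p - s) * u x * (\<Prod>y\<in>X - {x}. (p * u x - s * u y) / (u x - u y)) / (z - u x))"
  using assms
proof (induction X arbitrary: z rule: finite_induct)
  case empty
  then show ?case by simp
next
  case (insert w X)
  define R where "R x = (p - s) * u x * (\<Prod>y\<in>X - {x}. (p * u x - s * u y) / (u x - u y))" for x
  define R' where "R' x = (p - s) * u x * (\<Prod>y\<in>insert w X - {x}. (p * u x - s * u y) / (u x - u y))" for x
  have w: "u w \<notin> u ` X" "inj_on u X" using insert by auto
  have z: "z \<notin> u ` X" "z \<noteq> u w" using insert by auto
  have R': "R' x = R x * (p * u x - s * u w) / (u x - u w)" if "x \<in> X" for x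
  proof -
    have "insert w X - {x} = insert w (X - {x})" using that insert(2) by auto
    then show ?thesis using insert(1,2) by (simp add: R_def R'_def)
  qed
  \<comment> \<open>The residue at the new pole is \<open>(p - s) * u w\<close> times the old
    product evaluated at \<open>u w\<close>; the induction hypothesis is used at this point too,
    besides at \<open>z\<close>.\<close>
  have "insert w X - {w} = X" using insert(2) by auto
  then have R'w: "R' w = (p - s) * u w * (p ^ card X + (\<Sum>x\<in>X. R x / (u w - u x)))"
    using insert(3)[OF w(2,1)] by (simp add: R_def R'_def)
  have "(\<Prod>y\<in>insert w X. (p * z - s * u y) / (z - u y)) =
      (p * z - s * u w) / (z - u w) * (p ^ card X + (\<Sum>x\<in>X. R x / (z - u x)))"
    using insert(1,2) insert(3)[OF w(2) z(1)] by (simp add: R_def)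
  also have "\<dots> = (p * z - s * u w) / (z - u w) * p ^ card X
      + (\<Sum>x\<in>X. (p * z - s * u w) / (z - u w) * (R x / (z - u x)))"
    by (simp add: distrib_left sum_distrib_left)
  also have "(\<Sum>x\<in>X. (p * z - s * u w) / (z - u w) * (R x / (z - u x))) =
      (\<Sum>x\<in>X. R' x / (z - u x) + (p - s) * u w / (z - u w) * (R x / (u w - u x)))"
  proof (rule sum.cong[OF refl])
    fix x assume x: "x \<in> X"
    have "u x \<noteq> u w" "u x \<noteq> z" using x z w by (metis imageI)+
    then have n: "z - u x \<noteq> 0" "z - u w \<noteq> 0" "u x - u w \<noteq> 0" "u w - u x \<noteq> 0"
      using z by auto
    \<comment> \<open>Separation of the two poles \<open>u w\<close> and \<open>u x\<close> of one
      summand.\<close>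
    have "(p * z - s * u w) / (z - u w) / (z - u x) =
        (p * u x - s * u w) / (u x - u w) / (z - u x) + (p - s) * u w / (z - u w) / (u w - u x)"
    proof -
      have "(p - s) * u w / (z - u w) / (u w - u x) = - ((p - s) * u w / (z - u w) / (u x - u w))"
        by (metis minus_diff_eq minus_divide_right)
      moreover have "(p * z - s * u w) / (z - u w) / (z - u x) =
        (p * u x - s * u w) / (u x - u w) / (z - u x) - (p - s) * u w / (z - u w) / (u x - u w)"
        using n by (simp add: divide_simps) (simp add: algebra_simps)
      ultimately show ?thesis by simp
    qed
    then have "R x * ((p * z - s * u w) / (z - u w) / (z - u x)) =
        R x * ((p * u x - s * u w) / (u x - u w) / (z - u x) + (p - s) * u w / (z - u w) / (u w - u x))"
      by simp
    then show "(p * z - s * u w) / (z - u w) * (R x / (z - u x)) =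
        R' x / (z - u x) + (p - s) * u w / (z - u w) * (R x / (u w - u x))"
      by (simp add: R'[OF x] distrib_left mult.commute)
  qed
  also have "(p * z - s * u w) / (z - u w) * p ^ card X + \<dots> =
      p ^ card (insert w X) + (\<Sum>x\<in>insert w X. R' x / (z - u x))"
  proof -
    have "(p * z - s * u w) / (z - u w) = p + (p - s) * u w / (z - u w)"
      using z(2) by (simp add: field_simps)
    moreover have "R' w / (z - u w) = (p - s) * u w / (z - u w) * (p ^ card X + (\<Sum>x\<in>X. R x / (u w - u x)))"
      by (simp add: R'w)
    moreover have "p ^ card (insert w X) = p * p ^ card X"
      "(\<Sum>x\<in>insert w X. R' x / (z - u x)) = R' w / (z - u w) + (\<Sum>x\<in>X. R' x / (z - u x))"
      using insert(1,2) by simp_all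
    moreover have "(p + c) * P + (A + c * D) = p * P + (c * (P + D) + A)" for c P A D :: 'a
      by (simp add: algebra_simps)
    ultimately show ?thesis
      by (simp only: sum.distrib sum_distrib_left[symmetric])
  qed
  finally show ?case by (simp add: R'_def)
qed

text \<open>The Hall--Littlewood identity: evaluate the partial fractions at zero.\<close>

lemma sum_prod_quotients:
  fixes u :: "'i \<Rightarrow> 'a::field" and p s :: 'a
  assumes "finite X" "inj_on u X" "\<And>x. x \<in> X \<Longrightarrow> u x \<noteq> 0"
  shows "(\<Sum>x\<in>X. \<Prod>y\<in>X - {x}. (p * u x - s * u y) / (u x - u y)) =
    (\<Sum>k<card X. p ^ (card X - Suc k) * s ^ k)"
proof (cases "p = s")
  \<comment> \<open>Here the factor \<open>p - s\<close> that the general argument cancels is zero;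
    each quotient equals \<open>p\<close>. For \<open>p = q\<close> and \<open>s = q^(-1)\<close>
    this is the case of \<open>q\<close> equal to 1 or -1.\<close>
  case True
  have "(\<Prod>y\<in>X - {x}. (p * u x - s * u y) / (u x - u y)) = p ^ (card X - 1)" if "x \<in> X" for x
  proof -
    have "(\<Prod>y\<in>X - {x}. (p * u x - s * u y) / (u x - u y)) = (\<Prod>y\<in>X - {x}. p)"
    proof (rule prod.cong[OF refl])
      fix y assume "y \<in> X - {x}"
      then have "u x - u y \<noteq> 0" using assms(2) that by (auto dest: inj_onD)
      then show "(p * u x - s * u y) / (u x - u y) = p"
        using True by (simp add: right_diff_distrib[symmetric])
    qed
    then show ?thesis using that by simp
  qed
  then show ?thesis using True by (simp add: power_add[symmetric])
next
  case False
  let ?P = "\<lambda>x. \<Prod>y\<in>X - {x}. (p * u x - s * u y) / (u x - u y)"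
  have "(\<Prod>y\<in>X. (p * 0 - s * u y) / (0 - u y)) = p ^ card X + (\<Sum>x\<in>X. (p - s) * u x * ?P x / (0 - u x))"
    using assms by (intro partial_fractions) auto
  moreover have "(\<Prod>y\<in>X. (p * 0 - s * u y) / (0 - u y)) = (\<Prod>y\<in>X. s)"
    by (rule prod.cong) (use assms(3) in auto)
  moreover have "(\<Sum>x\<in>X. (p - s) * u x * ?P x / (0 - u x)) = (\<Sum>x\<in>X. - ((p - s) * ?P x))"
    by (rule sum.cong) (use assms(3) in auto)
  ultimately have "s ^ card X = p ^ card X - (p - s) * (\<Sum>x\<in>X. ?P x)"
    by (simp add: sum_negf sum_distrib_left)
  then have "(p - s) * (\<Sum>x\<in>X. ?P x) = p ^ card X - s ^ card X"
    by (simp add: algebra_simps)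
  also have "\<dots> = (p - s) * (\<Sum>k<card X. p ^ (card X - Suc k) * s ^ k)"
    using power_diff_sumr2[of s "card X" p] by (simp add: algebra_simps)
  finally show ?thesis using False by simp
qed

text \<open>The variables \<open>u\<close> of the Hall--Littlewood identity: \<open>q\<close> to the
  power \<open>-2 \<lambda>_a\<close>, divided by the same power for one fixed reference index. The
  function \<open>h\<close> is homogeneous of degree 0 in them, so this normalization drops
  out.\<close>

definition qm :: "complex \<Rightarrow> 'n::finite \<Rightarrow> 'n mero" where
  "qm \<tau> a = abs_mero (\<lambda>l. qpow \<tau> (- 2 * (l $ a - l $ (SOME c. True))))"

lemma qpow_nonzero [simp]: "qpow \<tau> z \<noteq> 0"
  by (simp add: qpow_def)

lemma mero_fun_qpow_diff: "mero_fun (\<lambda>l :: complex ^ 'n::finite. qpow \<tau> (- 2 * (l $ a - l $ b)))"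
  by (rule mero_fun_quotient[OF holo_on_qpow_diff[of _ \<tau> a b], where h = "\<lambda>_. 1"])
     (auto simp: nowhere_null_on_def)

lemma qpow_diff_split:
  "qpow \<tau> (- 2 * (x - c)) = qpow \<tau> (- 2 * (x - y)) * qpow \<tau> (- 2 * (y - c))"
  by (simp add: qpow_def exp_add[symmetric] algebra_simps)

lemma abs_mero_eq_iff:
  "mero_fun f \<Longrightarrow> mero_fun g \<Longrightarrow> abs_mero f = abs_mero g \<longleftrightarrow> agree_dense f g"
  using Quotient_rel[OF Quotient_mero, of f g] by (auto simp: mero_rel_def)

lemma qm_nonzero: "qm \<tau> a \<noteq> 0"
proof
  assume "qm \<tau> a = (0 :: 'a mero)"
  then have "agree_dense (\<lambda>l :: complex ^ 'a. qpow \<tau> (- 2 * (l $ a - l $ (SOME c. True)))) (\<lambda>_. 0)"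
    unfolding qm_def zero_mero.abs_eq by (subst (asm) abs_mero_eq_iff) (simp_all only: mero_fun_qpow_diff mero_fun_const)
  then show False unfolding agree_dense_def by auto
qed

text \<open>The set where the exponential equals 1 has no interior, so values on it are irrelevant
  to the class of a meromorphic function.\<close>

lemma mero_eqI:
  assumes "\<tau> \<noteq> 0" "a \<noteq> b" "mero_fun f" "mero_fun g"
    and "\<And>l :: complex ^ 'n::finite. qpow \<tau> (- 2 * (l $ a - l $ b)) \<noteq> 1 \<Longrightarrow> f l = g l"
  shows "abs_mero f = abs_mero g"
proof -
  have c: "continuous_on UNIV (\<lambda>l :: complex ^ 'n. qpow \<tau> (- 2 * (l $ a - l $ b)) - 1)"
    using holo_on_imp_continuous_on[OF holo_on_qpow_diff[of UNIV \<tau> a b]] by (intro continuous_intros)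
  show ?thesis
    unfolding abs_mero_eq_iff[OF assms(3,4)]
    by (rule agree_denseI_local[of "\<lambda>_. UNIV" "\<lambda>_ l. qpow \<tau> (- 2 * (l $ a - l $ b)) - 1"])
       (use assms c nowhere_null_on_qpow_diff in auto)
qed

lemma mero_fun_diff: "mero_fun f \<Longrightarrow> mero_fun g \<Longrightarrow> mero_fun (\<lambda>z. f z - g z)"
  using mero_fun_add[of f "\<lambda>z. - g z"] mero_fun_uminus[of g] by simp

lemma abs_mero_hom:
  assumes "mero_fun f" "mero_fun g"
  shows "abs_mero f + abs_mero g = abs_mero (\<lambda>l. f l + g l)"
    "abs_mero f * abs_mero g = abs_mero (\<lambda>l. f l * g l)"
    "- abs_mero f = abs_mero (\<lambda>l. - f l)" "mconst c * abs_mero f = abs_mero (\<lambda>l. c * f l)"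
    "abs_mero f - abs_mero g = abs_mero (\<lambda>l. f l - g l)"
proof -
  have n: "- abs_mero g = abs_mero (\<lambda>l. - g l)" if "mero_fun g" for g :: "complex ^ 'a \<Rightarrow> complex"
    using that by (simp add: uminus_mero.abs_eq mero_rel_self)
  have p: "abs_mero f + abs_mero g = abs_mero (\<lambda>l. f l + g l)"
    if "mero_fun f" "mero_fun g" for f g :: "complex ^ 'a \<Rightarrow> complex"
    using that by (simp add: plus_mero.abs_eq mero_rel_self)
  show "abs_mero f + abs_mero g = abs_mero (\<lambda>l. f l + g l)" by (rule p[OF assms])
  show "- abs_mero f = abs_mero (\<lambda>l. - f l)" by (rule n[OF assms(1)])
  show "abs_mero f * abs_mero g = abs_mero (\<lambda>l. f l * g l)"
    using assms by (simp add: times_mero.abs_eq mero_rel_self)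
  show "mconst c * abs_mero f = abs_mero (\<lambda>l. c * f l)"
    using assms by (simp add: times_mero.abs_eq mero_rel_self mconst_def)
  show "abs_mero f - abs_mero g = abs_mero (\<lambda>l. f l - g l)"
    using p[OF assms(1) mero_fun_uminus[OF assms(2)]] n[OF assms(2)]
    by (simp add: minus_mero_def)
qed

text \<open>Equality would force \<open>q\<close> to the power
  \<open>-2 (\<lambda>_a - \<lambda>_b)\<close> to be constantly 1 on an open set. This is excluded
  by \<tau> being nonzero alone, whether or not \<open>q\<close> is a root of unity.\<close>

lemma qm_inj:
  assumes "\<tau> \<noteq> 0" "a \<noteq> b" shows "qm \<tau> a \<noteq> qm \<tau> (b :: 'n::finite)"
proof
  let ?c = "SOME c :: 'n. True"
  assume "qm \<tau> a = qm \<tau> b"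
  then have "agree_dense (\<lambda>l :: complex ^ 'n. qpow \<tau> (- 2 * (l $ a - l $ ?c))) (\<lambda>l. qpow \<tau> (- 2 * (l $ b - l $ ?c)))"
    unfolding qm_def by (subst (asm) abs_mero_eq_iff) (simp_all only: mero_fun_qpow_diff)
  then obtain D where D: "open D" "closure D = UNIV"
    "\<forall>l\<in>D. qpow \<tau> (- 2 * (l $ a - l $ ?c)) = qpow \<tau> (- 2 * (l $ b - l $ ?c))"
    unfolding agree_dense_def by blast
  then have "qpow \<tau> (- 2 * (l $ a - l $ b)) - 1 = 0" if "l \<in> D" for l
    using that qpow_diff_split[of \<tau> "l $ a" "l $ ?c" "l $ b"] by auto
  moreover have "D \<noteq> {}" using D(2) by auto
  ultimately show False
    using nowhere_null_on_qpow_diff[OF assms, of UNIV] D(1) unfolding nowhere_null_on_def by blast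
qed

text \<open>Brings \<open>h\<close> into the shape of the factors in
  \<open>sum_prod_quotients\<close>. The identity is checked pointwise with cleared denominators,
  away from the poles.\<close>

lemma hm_eq:
  fixes a b :: "'n::finite"
  assumes "\<tau> \<noteq> 0" "a \<noteq> b"
  shows "hm \<tau> a b = (mconst (qpow \<tau> 1) * qm \<tau> a - mconst (qpow \<tau> (- 1)) * qm \<tau> b) / (qm \<tau> a - qm \<tau> b)"
proof -
  let ?c = "SOME c :: 'n. True"
  define A B H where "A l = qpow \<tau> (- 2 * (l $ a - l $ ?c))" "B l = qpow \<tau> (- 2 * (l $ b - l $ ?c))"
    "H l = h_fun \<tau> (l $ a - l $ b)" for l :: "complex ^ 'n"
  have mf: "mero_fun A" "mero_fun B" "mero_fun H"
    unfolding A_B_H_def[abs_def] using mero_fun_qpow_diff mero_fun_h0_g_h[OF assms] by blast+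
  have pt: "H l * (A l - B l) = qpow \<tau> 1 * A l - qpow \<tau> (- 1) * B l"
    if "qpow \<tau> (- 2 * (l $ a - l $ b)) \<noteq> 1" for l
  proof -
    define X where "X = qpow \<tau> (- 2 * (l $ a - l $ b))"
    have "A l = X * B l"
      unfolding A_B_H_def X_def using qpow_diff_split[of \<tau> "l $ a" "l $ ?c" "l $ b"] .
    moreover have "H l * (X - 1) = qpow \<tau> 1 * X - qpow \<tau> (- 1)"
      using that unfolding A_B_H_def h_fun_def h0_fun_def X_def[symmetric] by (simp add: field_simps)
    moreover have "H l * (X * B l - B l) = H l * (X - 1) * B l" by (simp add: algebra_simps)
    ultimately show ?thesis by (simp add: left_diff_distrib mult.assoc)
  qed
  have "hm \<tau> a b * (qm \<tau> a - qm \<tau> b) = abs_mero H * (abs_mero A - abs_mero B)"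
    unfolding hm_def mdiff_def qm_def A_B_H_def[abs_def] ..
  also have "\<dots> = abs_mero (\<lambda>l. H l * (A l - B l))"
    by (simp only: abs_mero_hom mf mero_fun_diff)
  also have "\<dots> = abs_mero (\<lambda>l. qpow \<tau> 1 * A l - qpow \<tau> (- 1) * B l)"
    by (rule mero_eqI[OF assms]) (intro mero_fun_mult mero_fun_diff mf mero_fun_const pt | assumption)+
  also have "\<dots> = mconst (qpow \<tau> 1) * abs_mero A - mconst (qpow \<tau> (- 1)) * abs_mero B"
    by (simp only: abs_mero_hom(4)[OF mf(1) mf(1)] abs_mero_hom(4)[OF mf(2) mf(2)] abs_mero_hom(5) mf
        mero_fun_mult mero_fun_const)
  also have "\<dots> = mconst (qpow \<tau> 1) * qm \<tau> a - mconst (qpow \<tau> (- 1)) * qm \<tau> b"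
    unfolding qm_def A_B_H_def[abs_def] ..
  finally show ?thesis using qm_inj[OF assms] by (simp add: nonzero_eq_divide_eq)
qed

text \<open>Trades \<open>h\<close> at an argument for \<open>h\<close> at its negative, at the
  price of a constant. Both the column version of the quadratic relation and the evaluation of the
  second scalar sum rest on it.\<close>

lemma hm_sym:
  assumes "\<tau> \<noteq> 0" "a \<noteq> b"
  shows "hm \<tau> a b + hm \<tau> b a = mconst (qpow \<tau> 1 + qpow \<tau> (- 1))"
proof -
  have "(p * u - s * v) / (u - v) + (p * v - s * u) / (v - u) = p + s" if "u \<noteq> v" for p s u v :: "'a mero"
  proof -
    have "(p * v - s * u) / (v - u) = (s * u - p * v) / (u - v)"
      by (metis minus_diff_eq minus_divide_divide)
    then have "(p * u - s * v) / (u - v) + (p * v - s * u) / (v - u) = (p + s) * (u - v) / (u - v)"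
      by (simp add: add_divide_distrib[symmetric] algebra_simps)
    then show ?thesis using that by simp
  qed
  then show ?thesis using qm_inj[OF assms] assms by (simp add: hm_eq mconst_hom)
qed

lemma mdiff_h0:
  assumes "\<tau> \<noteq> 0" "a \<noteq> b"
  shows "mdiff (h0_fun \<tau>) a b = mconst (qpow \<tau> 1) - hm \<tau> a b"
proof -
  have "mconst (qpow \<tau> 1) - hm \<tau> a b =
      abs_mero (\<lambda>_. qpow \<tau> 1) - abs_mero (\<lambda>l. h_fun \<tau> (l $ a - l $ b))"
    by (simp add: hm_def mdiff_def mconst_def map_fun_def)
  also have "\<dots> = abs_mero (\<lambda>l. qpow \<tau> 1 - h_fun \<tau> (l $ a - l $ b))"
    by (rule abs_mero_hom(5)[OF mero_fun_const mero_fun_h0_g_h(3)[OF assms]])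
  finally show ?thesis by (simp add: mdiff_def h_fun_def)
qed

text \<open>Together with \<open>mdiff_h0\<close> this writes all entries of the R-matrix in terms
  of \<open>h\<close>, so that only its few identities are needed afterwards.\<close>

lemma mdiff_g:
  assumes "\<tau> \<noteq> 0" "a \<noteq> b" shows "mdiff (g_fun \<tau>) a b = hm \<tau> a b * hm \<tau> b a"
proof -
  have g: "g_fun \<tau> z = h_fun \<tau> z * h_fun \<tau> (- z)" if "qpow \<tau> (- 2 * z) \<noteq> 1" for z
  proof -
    define X p where "X = qpow \<tau> (- 2 * z)" and "p = qpow \<tau> 1"
    have q: "qpow \<tau> (- 2 * - z) = 1 / X" "qpow \<tau> (- 1) = 1 / p" "qpow \<tau> 2 = p * p"
      "qpow \<tau> (- 2) = 1 / (p * p)" "qpow \<tau> (- 2 * z) = X" "qpow \<tau> 1 = p"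
      by (simp_all add: qpow_def X_def p_def exp_minus mult_exp_exp inverse_eq_divide algebra_simps
          flip: exp_add)
    have n: "X \<noteq> 1" "X \<noteq> 0" "p \<noteq> 0" using that by (simp_all add: X_def p_def)
    have "1 / X - 1 = - (X - 1) / X" using n by (simp add: field_simps)
    then have "p - (1 / p - p) / (1 / X - 1) = (1 / p * X - p) / (X - 1)"
      using n by (simp add: divide_simps) (simp add: algebra_simps)
    moreover have "p - (1 / p - p) / (X - 1) = (p * X - 1 / p) / (X - 1)"
      using n by (simp add: divide_simps) (simp add: algebra_simps)
    ultimately show ?thesis
      unfolding g_fun_def h_fun_def h0_fun_def q
      using n by (simp add: power2_eq_square) (simp add: field_simps)
  qed
  have e: "hm \<tau> b a = abs_mero (\<lambda>l. h_fun \<tau> (- (l $ a - l $ b)))" by (simp add: hm_def mdiff_def)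
  have m: "mero_fun (\<lambda>l. h_fun \<tau> (- (l $ a - l $ b)))"
    using mero_fun_h0_g_h(3)[OF assms(1) assms(2)[symmetric]] by simp
  note mh = mero_fun_h0_g_h[OF assms]
  show ?thesis
    unfolding e unfolding hm_def mdiff_def abs_mero_hom(2)[OF mh(3) m]
    by (rule mero_eqI[OF assms mh(2) mero_fun_mult[OF mh(3) m]]) (rule g)
qed

text \<open>The \<open>q\<close>-integer \<open>(q^m - q^(-m)) / (q - q^(-1))\<close>, expanded into
  a sum so that it also makes sense for \<open>q\<close> equal to 1 or -1.\<close>

definition qnum :: "complex \<Rightarrow> nat \<Rightarrow> complex" where
  "qnum \<tau> m = (\<Sum>k<m. qpow \<tau> 1 ^ (m - Suc k) * qpow \<tau> (- 1) ^ k)"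

lemma sum_prod_hm:
  assumes "\<tau> \<noteq> 0"
  shows "(\<Sum>x\<in>X. \<Prod>y\<in>X - {x}. hm \<tau> x y) = mconst (qnum \<tau> (card (X :: 'n::finite set)))"
proof -
  have pw: "mconst (c ^ k) = (mconst c ^ k :: 'n mero)" for c k
    by (induction k) (simp_all add: mconst_hom)
  have sm: "mconst (sum f K) = (\<Sum>k\<in>K. mconst (f k) :: 'n mero)" for f :: "nat \<Rightarrow> complex" and K
    by (induction K rule: infinite_finite_induct) (simp_all add: mconst_hom)
  have "inj_on (qm \<tau>) X" using qm_inj[OF assms] by (meson inj_onI)
  from sum_prod_quotients[OF _ this, of "mconst (qpow \<tau> 1)" "mconst (qpow \<tau> (- 1))"]
  have "(\<Sum>x\<in>X. \<Prod>y\<in>X - {x}. (mconst (qpow \<tau> 1) * qm \<tau> x - mconst (qpow \<tau> (- 1)) * qm \<tau> y) / (qm \<tau> x - qm \<tau> y)) =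
      mconst (qnum \<tau> (card X))"
    by (simp add: qm_nonzero qnum_def pw sm mconst_hom)
  moreover have "(\<Sum>x\<in>X. \<Prod>y\<in>X - {x}. hm \<tau> x y) =
      (\<Sum>x\<in>X. \<Prod>y\<in>X - {x}. (mconst (qpow \<tau> 1) * qm \<tau> x - mconst (qpow \<tau> (- 1)) * qm \<tau> y) / (qm \<tau> x - qm \<tau> y))"
    by (intro sum.cong prod.cong refl hm_eq[OF assms]) auto
  ultimately show ?thesis by simp
qed

text \<open>Add the sum of \<open>hm \<tau> x z\<close> times the inner products to both terms. By
  \<open>hm_sym\<close> the first becomes a constant times \<open>sum_prod_hm\<close> for
  \<open>X\<close>; the second becomes \<open>sum_prod_hm\<close> for \<open>insert z X\<close>. The
  constant is the \<open>q\<close>-integer of \<open>card X - 1\<close>, left unreduced so that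
  empty \<open>X\<close>, where it is -1, fits the same formula.\<close>

lemma sum_prod_hm_diff:
  fixes X :: "'n::finite set"
  assumes "\<tau> \<noteq> 0" "z \<notin> X"
  shows "(\<Sum>x\<in>X. hm \<tau> z x * (\<Prod>y\<in>X - {x}. hm \<tau> x y)) - (\<Prod>y\<in>X. hm \<tau> z y) =
    mconst ((qpow \<tau> 1 + qpow \<tau> (- 1)) * qnum \<tau> (card X) - qnum \<tau> (Suc (card X)))"
proof -
  let ?P = "\<lambda>x. \<Prod>y\<in>X - {x}. hm \<tau> x y"
  have "(\<Sum>x\<in>insert z X. \<Prod>y\<in>insert z X - {x}. hm \<tau> x y) = (\<Prod>y\<in>X. hm \<tau> z y) + (\<Sum>x\<in>X. hm \<tau> x z * ?P x)"
  proof -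
    have "insert z X - {z} = X" using assms by auto
    moreover have "(\<Prod>y\<in>insert z X - {x}. hm \<tau> x y) = hm \<tau> x z * ?P x" if "x \<in> X" for x
    proof -
      have "insert z X - {x} = insert z (X - {x})" "z \<notin> X - {x}" using assms that by auto
      then show ?thesis by simp
    qed
    ultimately show ?thesis using assms by simp
  qed
  then have 1: "(\<Prod>y\<in>X. hm \<tau> z y) + (\<Sum>x\<in>X. hm \<tau> x z * ?P x) = mconst (qnum \<tau> (Suc (card X)))"
    using sum_prod_hm[OF assms(1), of "insert z X"] assms by simp
  have "(\<Sum>x\<in>X. hm \<tau> z x * ?P x) + (\<Sum>x\<in>X. hm \<tau> x z * ?P x) =
      (\<Sum>x\<in>X. mconst (qpow \<tau> 1 + qpow \<tau> (- 1)) * ?P x)"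
    unfolding sum.distrib[symmetric] distrib_right[symmetric]
    using assms by (intro sum.cong refl) (metis hm_sym)
  also have "\<dots> = mconst ((qpow \<tau> 1 + qpow \<tau> (- 1)) * qnum \<tau> (card X))"
    by (simp add: sum_distrib_left[symmetric] sum_prod_hm[OF assms(1)] mconst_hom(2))
  finally have 2: "(\<Sum>x\<in>X. hm \<tau> z x * ?P x) + (\<Sum>x\<in>X. hm \<tau> x z * ?P x) = \<dots>" .
  have md: "mconst (c - d) = (mconst c - mconst d :: 'n mero)" for c d
  proof -
    have "mconst (c + - d) = (mconst c + mconst (- d) :: 'n mero)" by (rule mconst_hom(1))
    also have "mconst (- d) = (- mconst d :: 'n mero)" by (rule mconst_hom(5))
    finally show ?thesis by simp
  qed
  let ?T = "\<Sum>x\<in>X. hm \<tau> x z * ?P x"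
  have "(\<Sum>x\<in>X. hm \<tau> z x * ?P x) - (\<Prod>y\<in>X. hm \<tau> z y) =
      ((\<Sum>x\<in>X. hm \<tau> z x * ?P x) + ?T) - ((\<Prod>y\<in>X. hm \<tau> z y) + ?T)"
    by simp
  also have "\<dots> = mconst ((qpow \<tau> 1 + qpow \<tau> (- 1)) * qnum \<tau> (card X)) - mconst (qnum \<tau> (Suc (card X)))"
    by (simp only: 1 2)
  finally show ?thesis by (simp only: md)
qed

section \<open>The quadratic relations between matrix entries\<close>

definition tt :: "complex \<Rightarrow> 'n::{finite,linorder} \<Rightarrow> 'n \<Rightarrow> 'n frst palg" where
  "tt \<tau> i j = pl (F_rels \<tau>) (mon [Tgen i j])"
definition ml :: "complex \<Rightarrow> 'n::{finite,linorder} mero \<Rightarrow> 'n frst palg" where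
  "ml \<tau> f = pl (F_rels \<tau>) (mon [FunL f])"
definition mr :: "complex \<Rightarrow> 'n::{finite,linorder} mero \<Rightarrow> 'n frst palg" where
  "mr \<tau> f = pl (F_rels \<tau>) (mon [FunR f])"

lemma F_copies: "mero_copy_rels FunL \<subseteq> F_rels \<tau>" "mero_copy_rels FunR \<subseteq> F_rels \<tau>"
  by (auto simp: F_rels_def)

lemmas ml_simps = copy_simps[OF F_copies(1), folded ml_def]
lemmas mr_simps = copy_simps[OF F_copies(2), folded mr_def]

lemma ml_mr: "ml \<tau> f * mr \<tau> g = mr \<tau> g * ml \<tau> f"
proof -
  have "pl (F_rels \<tau>) (mon [FunL f, FunR g]) = pl (F_rels \<tau>) (mon [FunR g, FunL f])"
    by (rule pl_rel) (unfold F_rels_def, blast)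
  then show ?thesis by (simp add: ml_def mr_def pl_Cons)
qed

lemma ml_tt: "ml \<tau> f * tt \<tau> i j = tt \<tau> i j * ml \<tau> (mshift (omega i) f)"
proof -
  have "pl (F_rels \<tau>) (mon [FunL f, Tgen i j]) = pl (F_rels \<tau>) (mon [Tgen i j, FunL (mshift (omega i) f)])"
    by (rule pl_rel) (unfold F_rels_def, blast)
  then show ?thesis by (simp add: ml_def tt_def pl_Cons)
qed

lemma mr_tt: "mr \<tau> f * tt \<tau> i j = tt \<tau> i j * mr \<tau> (mshift (omega j) f)"
proof -
  have "pl (F_rels \<tau>) (mon [FunR f, Tgen i j]) = pl (F_rels \<tau>) (mon [Tgen i j, FunR (mshift (omega j) f)])"
    by (rule pl_rel) (unfold F_rels_def, blast)
  then show ?thesis by (simp add: mr_def tt_def pl_Cons)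
qed

lemma const_tt: "ml \<tau> (mconst k) * (tt \<tau> i j * tt \<tau> a b) = scl k (tt \<tau> i j * tt \<tau> a b)"
  "mr \<tau> (mconst k) * (tt \<tau> i j * tt \<tau> a b) = scl k (tt \<tau> i j * tt \<tau> a b)"
  unfolding tt_def pl_mult[symmetric] by (rule ml_simps mr_simps)+

lemma RLL:
  "(\<Sum>x\<in>UNIV. \<Sum>y\<in>UNIV. ml \<tau> (Rmat \<tau> x y a c) * (tt \<tau> x b * tt \<tau> y d)) =
   (\<Sum>x\<in>UNIV. \<Sum>y\<in>UNIV. mr \<tau> (Rmat \<tau> b d x y) * (tt \<tau> c y * tt \<tau> a x))"
proof -
  have "pl (F_rels \<tau>) (\<Sum>x\<in>UNIV. \<Sum>y\<in>UNIV. mon [FunL (Rmat \<tau> x y a c), Tgen x b, Tgen y d]) =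
      pl (F_rels \<tau>) (\<Sum>x\<in>UNIV. \<Sum>y\<in>UNIV. mon [FunR (Rmat \<tau> b d x y), Tgen c y, Tgen a x])"
    by (rule pl_rel) (unfold F_rels_def, blast)
  then show ?thesis by (simp add: ml_def mr_def tt_def pl_Cons pl_simps)
qed

text \<open>An entry of the R-matrix vanishes unless its lower indices are its upper ones up to
  order, so each side of an RLL relation has at most two terms.\<close>

lemma sum_two_deltas:
  fixes f g :: "'i::finite \<Rightarrow> 'i \<Rightarrow> 'b::ring"
  assumes "\<And>x y. F x y = (if x = a \<and> y = b then f x y else if x = c \<and> y = d then g x y else 0)"
    and "(a, b) \<noteq> (c, d)"
  shows "(\<Sum>x\<in>UNIV. \<Sum>y\<in>UNIV. F x y) = f a b + g c d"
proof -
  have "(\<Sum>x\<in>UNIV. \<Sum>y\<in>UNIV. F x y) = (\<Sum>p\<in>UNIV. F (fst p) (snd p))"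
    by (simp add: sum.cartesian_product split_def flip: UNIV_Times_UNIV)
  also have "\<dots> = (\<Sum>p\<in>{(a, b), (c, d)}. F (fst p) (snd p))"
    by (rule sum.mono_neutral_right) (auto simp: assms(1))
  also have "\<dots> = f a b + g c d" using assms by auto
  finally show ?thesis .
qed

lemma sum_one_delta:
  fixes f :: "'i::finite \<Rightarrow> 'i \<Rightarrow> 'b::ring"
  assumes "\<And>x y. F x y = (if x = a \<and> y = b then f x y else 0)"
  shows "(\<Sum>x\<in>UNIV. \<Sum>y\<in>UNIV. F x y) = f a b"
proof -
  have "(\<Sum>x\<in>UNIV. \<Sum>y\<in>UNIV. F x y) = (\<Sum>p\<in>UNIV. F (fst p) (snd p))"
    by (simp add: sum.cartesian_product split_def flip: UNIV_Times_UNIV)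
  also have "\<dots> = (\<Sum>p\<in>{(a, b)}. F (fst p) (snd p))"
    by (rule sum.mono_neutral_right) (auto simp: assms(1))
  finally show ?thesis using assms by simp
qed

lemma RLL_left:
  "a \<noteq> c \<Longrightarrow> (\<Sum>x\<in>UNIV. \<Sum>y\<in>UNIV. ml \<tau> (Rmat \<tau> x y a c) * (tt \<tau> x b * tt \<tau> y d)) =
     ml \<tau> (Rmat \<tau> a c a c) * (tt \<tau> a b * tt \<tau> c d) + ml \<tau> (mdiff (h0_fun \<tau>) c a) * (tt \<tau> c b * tt \<tau> a d)"
  "(\<Sum>x\<in>UNIV. \<Sum>y\<in>UNIV. ml \<tau> (Rmat \<tau> x y a a) * (tt \<tau> x b * tt \<tau> y d)) =
     scl (qpow \<tau> 1) (tt \<tau> a b * tt \<tau> a d)"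
proof -
  show "(\<Sum>x\<in>UNIV. \<Sum>y\<in>UNIV. ml \<tau> (Rmat \<tau> x y a a) * (tt \<tau> x b * tt \<tau> y d)) =
     scl (qpow \<tau> 1) (tt \<tau> a b * tt \<tau> a d)"
    by (rule trans[OF sum_one_delta[of _ a a "\<lambda>x y. ml \<tau> (mconst (qpow \<tau> 1)) * (tt \<tau> x b * tt \<tau> y d)"]])
       (auto simp: Rmat_def ml_simps(4) const_tt)
  show "(\<Sum>x\<in>UNIV. \<Sum>y\<in>UNIV. ml \<tau> (Rmat \<tau> x y a c) * (tt \<tau> x b * tt \<tau> y d)) =
     ml \<tau> (Rmat \<tau> a c a c) * (tt \<tau> a b * tt \<tau> c d) + ml \<tau> (mdiff (h0_fun \<tau>) c a) * (tt \<tau> c b * tt \<tau> a d)"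
    if "a \<noteq> c"
    by (rule sum_two_deltas[of _ a c "\<lambda>x y. ml \<tau> (Rmat \<tau> x y a c) * (tt \<tau> x b * tt \<tau> y d)" c a
          "\<lambda>x y. ml \<tau> (mdiff (h0_fun \<tau>) x y) * (tt \<tau> x b * tt \<tau> y d)"])
       (use that in \<open>auto simp: Rmat_def ml_simps(4)\<close>)
qed

lemma RLL_right:
  "b \<noteq> d \<Longrightarrow> (\<Sum>x\<in>UNIV. \<Sum>y\<in>UNIV. mr \<tau> (Rmat \<tau> b d x y) * (tt \<tau> c y * tt \<tau> a x)) =
     mr \<tau> (Rmat \<tau> b d b d) * (tt \<tau> c d * tt \<tau> a b) + mr \<tau> (mdiff (h0_fun \<tau>) b d) * (tt \<tau> c b * tt \<tau> a d)"
  "(\<Sum>x\<in>UNIV. \<Sum>y\<in>UNIV. mr \<tau> (Rmat \<tau> b b x y) * (tt \<tau> c y * tt \<tau> a x)) =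
     scl (qpow \<tau> 1) (tt \<tau> c b * tt \<tau> a b)"
proof -
  show "(\<Sum>x\<in>UNIV. \<Sum>y\<in>UNIV. mr \<tau> (Rmat \<tau> b b x y) * (tt \<tau> c y * tt \<tau> a x)) =
     scl (qpow \<tau> 1) (tt \<tau> c b * tt \<tau> a b)"
    by (rule trans[OF sum_one_delta[of _ b b "\<lambda>x y. mr \<tau> (mconst (qpow \<tau> 1)) * (tt \<tau> c y * tt \<tau> a x)"]])
       (auto simp: Rmat_def mr_simps(4) const_tt)
  show "(\<Sum>x\<in>UNIV. \<Sum>y\<in>UNIV. mr \<tau> (Rmat \<tau> b d x y) * (tt \<tau> c y * tt \<tau> a x)) =
     mr \<tau> (Rmat \<tau> b d b d) * (tt \<tau> c d * tt \<tau> a b) + mr \<tau> (mdiff (h0_fun \<tau>) b d) * (tt \<tau> c b * tt \<tau> a d)"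
    if "b \<noteq> d"
    by (rule sum_two_deltas[of _ b d "\<lambda>x y. mr \<tau> (Rmat \<tau> b d x y) * (tt \<tau> c y * tt \<tau> a x)" d b
          "\<lambda>x y. mr \<tau> (mdiff (h0_fun \<tau>) b d) * (tt \<tau> c y * tt \<tau> a x)"])
       (use that in \<open>auto simp: Rmat_def mr_simps(4)\<close>)
qed

lemma Rmat_diag: "\<tau> \<noteq> 0 \<Longrightarrow> a < b \<Longrightarrow> Rmat \<tau> a b a b = 1"
  "\<tau> \<noteq> 0 \<Longrightarrow> a < b \<Longrightarrow> Rmat \<tau> b a b a = hm \<tau> b a * hm \<tau> a b"
  by (auto simp: Rmat_def mdiff_g)

lemma ml_sub: "ml \<tau> (f - g) = ml \<tau> f - ml \<tau> g" "mr \<tau> (f - g) = mr \<tau> f - mr \<tau> g"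
  using ml_simps(1)[of \<tau> f "- g"] mr_simps(1)[of \<tau> f "- g"] by (simp_all add: ml_simps(3) mr_simps(3))

lemma one_tt: "ml \<tau> 1 * (tt \<tau> i j * tt \<tau> a b) = tt \<tau> i j * tt \<tau> a b"
  "mr \<tau> 1 * (tt \<tau> i j * tt \<tau> a b) = tt \<tau> i j * tt \<tau> a b"
  using const_tt[of \<tau> 1] by (simp_all add: mconst_hom scl_simps)

lemma tt_row:
  assumes "\<tau> \<noteq> 0" "a < c"
  shows "tt \<tau> a b * tt \<tau> c b = ml \<tau> (hm \<tau> c a) * (tt \<tau> c b * tt \<tau> a b)"
  using RLL[of \<tau> a c b b] assms
  by (simp add: RLL_left RLL_right Rmat_diag mdiff_h0 ml_sub one_tt const_tt left_diff_distrib)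

lemma tt_col:
  assumes "\<tau> \<noteq> 0" "b < d"
  shows "tt \<tau> a d * tt \<tau> a b = mr \<tau> (hm \<tau> b d) * (tt \<tau> a b * tt \<tau> a d)"
  using RLL[of \<tau> a a b d] assms
  by (simp add: RLL_left RLL_right Rmat_diag mdiff_h0 ml_sub one_tt const_tt left_diff_distrib
      diff_eq_eq eq_diff_eq algebra_simps)

text \<open>Writing \<open>h0\<close> as \<open>q - h\<close> on both sides of the RLL relation, the
  two constants \<open>q\<close> multiply the same product \<open>t_cb t_ad\<close> and
  cancel.\<close>

lemma tt_cross:
  assumes "\<tau> \<noteq> 0" "a < c" "b < d"
  shows "tt \<tau> a b * tt \<tau> c d =
    tt \<tau> c d * tt \<tau> a b + (ml \<tau> (hm \<tau> c a) - mr \<tau> (hm \<tau> b d)) * (tt \<tau> c b * tt \<tau> a d)"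
  using RLL[of \<tau> a c b d] assms
  by (simp add: RLL_left RLL_right Rmat_diag mdiff_h0 ml_sub one_tt const_tt left_diff_distrib)
     (simp add: algebra_simps)

lemma tt_cross':
  assumes "\<tau> \<noteq> 0" "a < c" "b < d"
  shows "tt \<tau> a d * tt \<tau> c b = mr \<tau> (hm \<tau> d b * hm \<tau> b d) * (tt \<tau> c b * tt \<tau> a d) +
    (ml \<tau> (hm \<tau> c a) - mr \<tau> (hm \<tau> d b)) * (tt \<tau> c d * tt \<tau> a b)"
  using RLL[of \<tau> a c d b] assms
  by (simp add: RLL_left RLL_right Rmat_diag mdiff_h0 ml_sub one_tt const_tt left_diff_distrib)
     (simp add: algebra_simps)

text \<open>The relations that make the two coactions respect the relation between \<open>w\<^sub>i\<close> and \<open>w\<^sub>j\<close>,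
  respectively \<open>v\<^sub>i\<close> and \<open>v\<^sub>j\<close>.\<close>

lemma tt_square_rows:
  assumes "\<tau> \<noteq> 0" "x < y" "i < j"
  shows "tt \<tau> x j * tt \<tau> y i + mr \<tau> (hm \<tau> j i) * (tt \<tau> x i * tt \<tau> y j) =
    ml \<tau> (hm \<tau> y x) * (tt \<tau> y j * tt \<tau> x i + mr \<tau> (hm \<tau> j i) * (tt \<tau> y i * tt \<tau> x j))"
proof -
  have c: "mr \<tau> (hm \<tau> j i) * (ml \<tau> (hm \<tau> y x) * z) = ml \<tau> (hm \<tau> y x) * (mr \<tau> (hm \<tau> j i) * z)" for z
    by (simp only: mult.assoc[symmetric] ml_mr)
  show ?thesis
    \<comment> \<open>After all products are rewritten with row \<open>y\<close> first, the terms
      with two factors in \<mu> cancel, and what is left has the common factor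
      \<open>ml \<tau> (hm \<tau> y x)\<close>.\<close>
    unfolding tt_cross'[OF assms] tt_cross[OF assms]
    by (simp add: distrib_left left_diff_distrib right_diff_distrib mr_simps(2) c mult.assoc)
qed

lemma tt_square_cols:
  assumes "\<tau> \<noteq> 0" "y < x" "j < i"
  shows "tt \<tau> j x * tt \<tau> i y + ml \<tau> (hm \<tau> j i) * (tt \<tau> i x * tt \<tau> j y) =
    mr \<tau> (hm \<tau> y x) * (tt \<tau> j y * tt \<tau> i x + ml \<tau> (hm \<tau> j i) * (tt \<tau> i y * tt \<tau> j x))"
proof -
  let ?q = "qpow \<tau> 1 + qpow \<tau> (- 1)"
  let ?X = "tt \<tau> i y * tt \<tau> j x" and ?Y = "tt \<tau> i x * tt \<tau> j y"
  \<comment> \<open>The cross relations produce \<open>h\<close> at arguments opposite to the wanted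
    ones; \<open>hm_sym\<close> turns them around, and the constants cancel.\<close>
  have s1: "ml \<tau> (hm \<tau> i j) = ml \<tau> (mconst ?q) - ml \<tau> (hm \<tau> j i)"
    using hm_sym[of \<tau> i j] assms by (metis add_diff_cancel_right' less_irrefl ml_sub(1))
  have s2: "mr \<tau> (hm \<tau> x y) = mr \<tau> (mconst ?q) - mr \<tau> (hm \<tau> y x)"
    using hm_sym[of \<tau> x y] assms by (metis add_diff_cancel_right' less_irrefl ml_sub(2))
  have m: "mr \<tau> (hm \<tau> x y * hm \<tau> y x) = mr \<tau> (hm \<tau> y x) * mr \<tau> (hm \<tau> x y)"
    by (simp add: mr_simps(2)[symmetric] mult.commute)
  show ?thesis
    unfolding tt_cross'[OF assms(1,3,2)] tt_cross[OF assms(1,3,2)] m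
    by (simp add: distrib_left left_diff_distrib right_diff_distrib s1 s2 const_tt mult.assoc scl_simps)
qed

section \<open>Coactions and Laplace expansions\<close>

text \<open>Complex scalars allow division by 2, so a sum equal to its own negative
  vanishes.\<close>

lemma scl_double_zero: "x + x = 0 \<Longrightarrow> x = (0 :: 'a palg)"
proof -
  assume "x + x = 0"
  then have "scl (1 / 2) (scl (1 + 1) x) = 0" by (simp only: scl_simps scl_zero)
  then show ?thesis by (simp only: scl_simps(3)) (simp add: scl_simps)
qed

text \<open>A pair of a set and an element outside it is the same as a larger set with a marked
  element. This turns a product of expansions into an expansion with Laplace sums as
  coefficients.\<close>

lemma sum_insert_reindex:
  fixes g :: "'i::finite \<Rightarrow> 'i set \<Rightarrow> 'b::comm_monoid_add"
  shows "(\<Sum>x\<in>UNIV. \<Sum>I\<in>UNIV. if x \<in> I then 0 else g x I) = (\<Sum>K\<in>UNIV. \<Sum>x\<in>K. g x (K - {x}))"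
proof -
  have "(\<Sum>x\<in>UNIV. \<Sum>I\<in>UNIV. if x \<in> I then 0 else g x I) = (\<Sum>x\<in>UNIV. \<Sum>I\<in>{I. x \<notin> I}. g x I)"
    by (intro sum.cong refl sum.mono_neutral_cong_right) auto
  also have "\<dots> = (\<Sum>(x, I)\<in>Sigma UNIV (\<lambda>x. {I. x \<notin> I}). g x I)"
    by (rule sum.Sigma) auto
  also have "\<dots> = (\<Sum>(K, x)\<in>Sigma UNIV (\<lambda>K. K). g x (K - {x}))"
    by (rule sum.reindex_bij_witness[of _ "\<lambda>(K, x). (x, K - {x})" "\<lambda>(x, I). (insert x I, x)"]) auto
  also have "\<dots> = (\<Sum>K\<in>UNIV. \<Sum>x\<in>K. g x (K - {x}))"
    by (rule sum.Sigma[symmetric]) auto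
  finally show ?thesis .
qed

text \<open>What \<open>R\<close> and \<open>L\<close> have in common, with the exterior factor
  always written first. The copy \<open>m1\<close> of the functions is the one balanced against
  those of the exterior algebra; \<open>m2\<close> is the image of these functions under the
  coaction. The entry \<open>s x i\<close> is the coefficient of \<open>e x\<close> in the image of
  \<open>e i\<close>, hence \<open>t_xi\<close> for \<open>R\<close> and \<open>t_ix\<close> for
  \<open>L\<close>. In \<open>Gc \<alpha> \<beta>\<close> the weight \<alpha> is the one matched
  with the exterior factor.\<close>

locale side = ext_alg le lt \<tau> slist + T: calg T
  for le lt :: "'n::finite \<Rightarrow> 'n \<Rightarrow> bool" and \<tau> slist and T :: "(complex, 't) module" +
  fixes m1 m2 :: "'n mero \<Rightarrow> 'f palg" and s :: "'n \<Rightarrow> 'n \<Rightarrow> 'f palg"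
    and Gc :: "'n weight \<Rightarrow> 'n weight \<Rightarrow> 'f palg set" and ten :: "'n ext \<Rightarrow> 'f palg \<Rightarrow> 't palg"
  assumes m1_neg: "m1 (- f) = - m1 f"
    and m2_add: "m2 (f + g) = m2 f + m2 g" and m2_mult: "m2 (f * g) = m2 f * m2 g"
    and m2_const: "m2 (mconst k) = scl k (m2 1)"
    and unit_left: "m1 1 * s x i = s x i" "a \<in> Gc \<alpha> \<beta> \<Longrightarrow> m1 1 * a = a" "a \<in> Gc \<alpha> \<beta> \<Longrightarrow> m2 1 * a = a"
      "a \<in> Gc \<alpha> \<beta> \<Longrightarrow> a * m2 1 = a"
    and m2_s: "m2 f * s x i = s x i * m2 (mshift (omega i) f)"
    and square_same: "lt x y \<Longrightarrow> s x i * s y i = m1 (hm \<tau> y x) * (s y i * s x i)"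
    and square: "lt x y \<Longrightarrow> lt i j \<Longrightarrow> s x j * s y i + m2 (hm \<tau> j i) * (s x i * s y j) =
      m1 (hm \<tau> y x) * (s y j * s x i + m2 (hm \<tau> j i) * (s y i * s x j))"
    and Gc: "0 \<in> Gc \<alpha> \<beta>" "a \<in> Gc \<alpha> \<beta> \<Longrightarrow> a' \<in> Gc \<alpha> \<beta> \<Longrightarrow> a + a' \<in> Gc \<alpha> \<beta>"
      "a \<in> Gc \<alpha> \<beta> \<Longrightarrow> a' \<in> Gc \<alpha>' \<beta>' \<Longrightarrow> a * a' \<in> Gc (\<alpha> + \<alpha>') (\<beta> + \<beta>')"
      "a \<in> Gc \<alpha> \<beta> \<Longrightarrow> scl c a \<in> Gc \<alpha> \<beta>"
      "s x i \<in> Gc (omega x) (omega i)" "m1 f \<in> Gc 0 0" "m2 f \<in> Gc 0 0"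
    and ten_range: "w \<in> hom_component S edeg \<alpha> \<Longrightarrow> a \<in> Gc \<alpha> \<beta> \<Longrightarrow> ten w a \<in> emb T ` carrier T"
    and ten_add: "w \<in> hom_component S edeg \<alpha> \<Longrightarrow> a \<in> Gc \<alpha> \<beta> \<Longrightarrow> a' \<in> Gc \<alpha> \<beta> \<Longrightarrow>
      ten w (a + a') = ten w a + ten w a'"
    and ten_scl: "w \<in> hom_component S edeg \<alpha> \<Longrightarrow> a \<in> Gc \<alpha> \<beta> \<Longrightarrow> ten w (scl c a) = scl c (ten w a)"
    and ten_mult: "w \<in> hom_component S edeg \<alpha> \<Longrightarrow> a \<in> Gc \<alpha> \<beta> \<Longrightarrow> w' \<in> hom_component S edeg \<alpha>' \<Longrightarrow>
      a' \<in> Gc \<alpha>' \<beta>' \<Longrightarrow> ten w a * ten w' a' = ten (w \<otimes>\<^bsub>E\<^esub> w') (a * a')"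
    and ten_bal: "w \<in> hom_component S edeg \<alpha> \<Longrightarrow> a \<in> Gc \<alpha> \<beta> \<Longrightarrow> ten (mu f \<otimes>\<^bsub>E\<^esub> w) a = ten w (m1 f * a)"
    and ten_zero: "a \<in> Gc \<alpha> \<beta> \<Longrightarrow> ten \<zero>\<^bsub>E\<^esub> a = 0"
    and ten_one: "emb T \<one>\<^bsub>T\<^esub> = ten \<one>\<^bsub>E\<^esub> (m2 1)"
    and ten_inj: "(\<And>I. \<exists>\<beta>. u I \<in> Gc (omega_set I) \<beta>) \<Longrightarrow> (\<And>I. \<exists>\<beta>. u' I \<in> Gc (omega_set I) \<beta>) \<Longrightarrow>
      (\<Sum>I\<in>UNIV. ten (es I) (u I)) = (\<Sum>I\<in>UNIV. ten (es I) (u' I)) \<Longrightarrow> u J = u' J"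
begin

sublocale E: calg E by (rule calg_presented)

lemma comps: "es I \<in> hom_component S edeg (omega_set I)" "e i \<in> hom_component S edeg (omega i)"
  "\<one>\<^bsub>E\<^esub> \<in> hom_component S edeg 0" "mu f \<in> hom_component S edeg 0"
  unfolding es_def e_def mu_def
  by (rule hom_component_mon[OF es_degree] hom_component_one hom_component_mon; simp)+

lemma ten_zero_right: "w \<in> hom_component S edeg \<alpha> \<Longrightarrow> ten w 0 = 0"
  using ten_scl[of w \<alpha> 0 _ 0] Gc(1) by simp

lemma ten_uminus:
  assumes "w \<in> hom_component S edeg \<alpha>" "a \<in> Gc \<alpha> \<beta>" shows "ten w (- a) = - ten w a"
  using ten_scl[OF assms, of "- 1"] by (simp add: scl_minus scl_simps)

lemma Gc_sum: "(\<And>x. x \<in> A \<Longrightarrow> f x \<in> Gc \<alpha> \<beta>) \<Longrightarrow> sum f A \<in> Gc \<alpha> \<beta>"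
  by (induction A rule: infinite_finite_induct) (auto intro: Gc)

lemma ten_sum:
  assumes "w \<in> hom_component S edeg \<alpha>" "\<And>x. x \<in> A \<Longrightarrow> f x \<in> Gc \<alpha> \<beta>"
  shows "ten w (sum f A) = (\<Sum>x\<in>A. ten w (f x))"
  using assms(2)
proof (induction A rule: infinite_finite_induct)
  case (insert x A)
  then show ?case using ten_add[OF assms(1), of "f x" \<beta> "sum f A"] Gc_sum[of A f] by simp
qed (simp_all add: ten_zero_right[OF assms(1)])

lemma m_Gc: "a \<in> Gc \<alpha> \<beta> \<Longrightarrow> m1 f * a \<in> Gc \<alpha> \<beta>" "a \<in> Gc \<alpha> \<beta> \<Longrightarrow> m2 f * a \<in> Gc \<alpha> \<beta>"
  using Gc(3)[OF Gc(6)] Gc(3)[OF Gc(7)] by fastforce+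

section \<open>Images of the generators and existence of the coaction\<close>

definition M :: "'n mero \<Rightarrow> 't palg" where "M f = ten \<one>\<^bsub>E\<^esub> (m2 f)"
definition \<Phi> :: "'n \<Rightarrow> 't palg" where "\<Phi> i = (\<Sum>x\<in>UNIV. ten (e x) (s x i))"

lemma range_gen: "M f \<in> emb T ` carrier T" "\<Phi> i \<in> emb T ` carrier T"
proof -
  show "M f \<in> emb T ` carrier T" unfolding M_def by (rule ten_range[OF comps(3) Gc(7)])
  have "finite A \<Longrightarrow> (\<Sum>x\<in>A. ten (e x) (s x i)) \<in> emb T ` carrier T" for A
    by (induction A rule: finite_induct) (auto intro!: T.emb_range ten_range[OF comps(2) Gc(5)])
  then show "\<Phi> i \<in> emb T ` carrier T" by (simp add: \<Phi>_def)
qed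

lemma M_ten: "w \<in> hom_component S edeg \<alpha> \<Longrightarrow> a \<in> Gc \<alpha> \<beta> \<Longrightarrow> M f * ten w a = ten w (m2 f * a)"
  unfolding M_def using ten_mult[OF comps(3) Gc(7), of w \<alpha> a \<beta> f] by (simp add: hom_component_carrier)

lemma ten_M: "w \<in> hom_component S edeg \<alpha> \<Longrightarrow> a \<in> Gc \<alpha> \<beta> \<Longrightarrow> ten w a * M f = ten w (a * m2 f)"
  unfolding M_def using ten_mult[OF _ _ comps(3) Gc(7), of w \<alpha> a \<beta> f] by (simp add: hom_component_carrier)

lemma \<Phi>\<Phi>: "\<Phi> j * \<Phi> i = (\<Sum>x\<in>UNIV. \<Sum>y\<in>UNIV. ten (e x \<otimes>\<^bsub>E\<^esub> e y) (s x j * s y i))"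
  unfolding \<Phi>_def sum_product by (intro sum.cong refl ten_mult[OF comps(2) Gc(5) comps(2) Gc(5)])

lemma ee_comp: "e x \<otimes>\<^bsub>E\<^esub> e y \<in> hom_component S edeg (omega x + omega y)"
  by (rule hom_component_mult[OF comps(2) comps(2)])

text \<open>The summands are antisymmetric in \<open>x\<close> and \<open>y\<close>.\<close>

lemma quadratic_zero:
  assumes Z: "\<And>x y. Z x y \<in> Gc (omega x + omega y) \<beta>"
    and anti: "\<And>x y. lt x y \<Longrightarrow> Z x y = m1 (hm \<tau> y x) * Z y x"
  shows "(\<Sum>x\<in>UNIV. \<Sum>y\<in>UNIV. ten (e x \<otimes>\<^bsub>E\<^esub> e y) (Z x y)) = 0"
proof -
  let ?g = "\<lambda>x y. ten (e x \<otimes>\<^bsub>E\<^esub> e y) (Z x y)"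
  have eq: "e y \<otimes>\<^bsub>E\<^esub> e x = mu (- hm \<tau> y x) \<otimes>\<^bsub>E\<^esub> (e x \<otimes>\<^bsub>E\<^esub> e y)" if "lt x y" for x y
    using e_swap[OF that] by (subst E.emb_inj[symmetric]) (auto simp: E.emb_simps closed mult.assoc)
  have sq: "e x \<otimes>\<^bsub>E\<^esub> e x = \<zero>\<^bsub>E\<^esub>" for x
    using e_sq by (subst E.emb_inj[symmetric]) (auto simp: E.emb_simps closed)
  have lt: "?g y x = - ?g x y" if l: "lt x y" for x y
  proof -
    have z: "Z y x \<in> Gc (omega x + omega y) \<beta>" using Z[of y x] by (simp add: add.commute)
    \<comment> \<open>The factor from exchanging \<open>e y\<close> and \<open>e x\<close> crosses
      the tensor sign as \<open>m1\<close>, where \<open>anti\<close> absorbs it up to sign.\<close>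
    have "?g y x = ten (e x \<otimes>\<^bsub>E\<^esub> e y) (m1 (- hm \<tau> y x) * Z y x)"
      unfolding eq[OF l] by (rule ten_bal[OF ee_comp z])
    also have "m1 (- hm \<tau> y x) * Z y x = - Z x y" using anti[OF l] by (simp add: m1_neg)
    finally show ?thesis using ten_uminus[OF ee_comp Z] by simp
  qed
  have as: "?g x y = - ?g y x" for x y
  proof -
    consider "x = y" | "lt x y" | "lt y x" using less_linear by blast
    then show ?thesis
    proof cases
      case 1
      have "?g y y = 0" unfolding sq using ten_zero[OF Z] .
      then show ?thesis using 1 by simp
    next
      case 2 then show ?thesis using lt[of x y] by simp
    next
      case 3 then show ?thesis using lt[of y x] by simp
    qed
  qed
  have "(\<Sum>x\<in>UNIV. \<Sum>y\<in>UNIV. ?g x y) = (\<Sum>x\<in>UNIV. \<Sum>y\<in>UNIV. - ?g y x)"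
    by (rule sum.cong[OF refl], rule sum.cong[OF refl], rule as)
  then have 1: "(\<Sum>x\<in>UNIV. \<Sum>y\<in>UNIV. ?g x y) = - (\<Sum>x\<in>UNIV. \<Sum>y\<in>UNIV. ?g y x)"
    by (simp only: sum_negf)
  have 2: "(\<Sum>x\<in>UNIV. \<Sum>y\<in>UNIV. ?g y x) = (\<Sum>x\<in>UNIV. \<Sum>y\<in>UNIV. ?g x y)"
    by (rule sum.swap)
  show ?thesis
    by (rule scl_double_zero, rule iffD1[OF eq_neg_iff_add_eq_0], rule trans[OF 1], rule arg_cong[OF 2])
qed

definition is_coaction :: "('n ext \<Rightarrow> 't) \<Rightarrow> bool" where
  "is_coaction C \<longleftrightarrow> C \<in> alg_hom E T \<and> (\<forall>i. emb T (C (e i)) = \<Phi> i) \<and>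
    (\<forall>f. \<forall>w\<in>carrier E. emb T (C (mu f \<otimes>\<^bsub>E\<^esub> w)) = M f * emb T (C w))"

text \<open>The coactions are introduced by a choice operator, so nothing can be said about them
  before a homomorphism with the required properties is constructed from the presentation.\<close>

lemma coaction_exists: "\<exists>C. is_coaction C"
proof -
  define gen where "gen g = (case g of Egen i \<Rightarrow> \<Phi> i | FunE f \<Rightarrow> M f)" for g
  \<comment> \<open>The universal property asks for images in the carrier of \<open>T\<close>; the
    known images live in \<open>palg\<close> and are pulled back along \<open>emb\<close>.\<close>
  define \<phi> where "\<phi> g = inv_into (carrier T) (emb T) (gen g)" for g
  have \<phi>: "\<phi> g \<in> carrier T" "emb T (\<phi> g) = gen g" for g
    using range_gen by (cases g; simp add: \<phi>_def gen_def inv_into_into f_inv_into_f)+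
  define w where "w = (\<lambda>xs. emb T (foldr (\<lambda>g x. \<phi> g \<otimes>\<^bsub>T\<^esub> x) xs \<one>\<^bsub>T\<^esub>))"
  have cl: "foldr (\<lambda>g x. \<phi> g \<otimes>\<^bsub>T\<^esub> x) xs \<one>\<^bsub>T\<^esub> \<in> carrier T" for xs
    by (induction xs) (auto simp: \<phi>)
  have w_Cons: "w (g # xs) = gen g * w xs" for g xs
    by (simp add: w_def T.emb_simps \<phi> cl)
  have w_one: "w [g] = gen g" for g
    by (simp add: w_def T.r_one \<phi>)
  have w_nil: "w [] = M 1" by (simp add: w_def ten_one M_def)
  have M_add: "M (f + g) = M f + M g" for f g
    unfolding M_def m2_add by (rule ten_add[OF comps(3) Gc(7) Gc(7)])
  have M_mult: "M (f * g) = M f * M g" for f g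
    using M_ten[OF comps(3) Gc(7), of f g] by (simp add: M_def m2_mult)
  have M_const: "M (mconst k) = scl k (M 1)" for k
    unfolding M_def m2_const by (rule ten_scl[OF comps(3) Gc(7)])
  have M\<Phi>: "M f * \<Phi> i = \<Phi> i * M (mshift (omega i) f)" for f i
    unfolding \<Phi>_def sum_distrib_left sum_distrib_right
    by (intro sum.cong refl) (simp add: M_ten[OF comps(2) Gc(5)] ten_M[OF comps(2) Gc(5)] m2_s)
  have sq: "\<Phi> i * \<Phi> i = 0" for i
    unfolding \<Phi>\<Phi> by (rule quadratic_zero) (rule Gc(3)[OF Gc(5) Gc(5)], rule square_same)
  have sw: "\<Phi> j * \<Phi> i + M (hm \<tau> j i) * (\<Phi> i * \<Phi> j) = 0" if "lt i j" for i j
  proof -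
    let ?Z = "\<lambda>x y. s x j * s y i + m2 (hm \<tau> j i) * (s x i * s y j)"
    have G: "s x j * s y i \<in> Gc (omega x + omega y) (omega j + omega i)" for x y i j
      by (rule Gc(3)[OF Gc(5) Gc(5)])
    have G': "s x j * s y i \<in> Gc (omega x + omega y) (omega i + omega j)" for x y i j
      using G[of x j y i] by (simp add: add.commute)
    have "\<Phi> j * \<Phi> i + M (hm \<tau> j i) * (\<Phi> i * \<Phi> j) = (\<Sum>x\<in>UNIV. \<Sum>y\<in>UNIV. ten (e x \<otimes>\<^bsub>E\<^esub> e y) (?Z x y))"
      unfolding \<Phi>\<Phi> sum_distrib_left sum.distrib[symmetric]
      by (intro sum.cong refl) (simp add: M_ten[OF ee_comp G] ten_add[OF ee_comp G' m_Gc(2)[OF G]])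
    also have "\<dots> = 0"
    proof (rule quadratic_zero[where \<beta> = "omega i + omega j"])
      show "?Z x y \<in> Gc (omega x + omega y) (omega i + omega j)" for x y
        by (rule Gc(2)[OF G' m_Gc(2)[OF G]])
      show "?Z x y = m1 (hm \<tau> y x) * ?Z y x" if "lt x y" for x y
        by (rule square[OF that \<open>lt i j\<close>])
    qed
    finally show ?thesis .
  qed
  have "lin w p = 0" if "p \<in> S" for p
  proof -
    note simps = w_Cons w_one w_nil scl_simps(4) gen_def
    have gM: "gen (FunE f) = M f" and g\<Phi>: "gen (Egen i) = \<Phi> i" for f i by (simp_all add: gen_def)
    have two: "w [g, h] = gen g * gen h" for g h by (simp only: w_Cons[of g] w_one)
    have three: "w [g, h, k] = gen g * (gen h * gen k)" for g h k by (simp only: w_Cons[of g] two)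
    note simps = w_nil w_one two three scl_simps(4) gM g\<Phi>
    from that show ?thesis
      unfolding ext_rels_def mero_copy_rels_def
    proof (elim UnE CollectE exE conjE, goal_cases)
      case 1 then show ?case by (simp add: simps M_add)
    next
      case 2 then show ?case by (simp add: simps M_mult)
    next
      case 3 then show ?case by (simp add: simps M_const)
    next
      case 4 then show ?case by (simp add: simps sq)
    next
      case 5 then show ?case by (simp add: simps sw)
    next
      case 6 then show ?case by (simp add: simps M\<Phi>)
    qed
  qed
  then obtain C where C: "C \<in> alg_hom E T" "\<And>g. C (pclass S (mon [g])) = \<phi> g"
    unfolding w_def by (rule presented_hom_exists[of T \<phi> S, OF T.calg_axioms \<phi>(1)]) blast+
  have "emb T (C (e i)) = \<Phi> i" "emb T (C (mu f)) = M f" for i f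
    by (simp_all add: e_def mu_def C(2) \<phi>(2) gen_def)
  moreover have "C w \<in> carrier T" "C (mu f \<otimes>\<^bsub>E\<^esub> w) = C (mu f) \<otimes>\<^bsub>T\<^esub> C w" "C (mu f) \<in> carrier T"
    if "w \<in> carrier E" for f w
    using C(1) that closed(1)[of f] by (auto simp: alg_hom_def ring_hom_def)
  ultimately have "is_coaction C"
    unfolding is_coaction_def using C(1) by (simp add: T.emb_simps)
  then show ?thesis by blast
qed

section \<open>Coefficients of a coaction and their Laplace expansion\<close>

context
  fixes C assumes C: "is_coaction C"
begin

lemma C_hom: "X \<in> carrier E \<Longrightarrow> Y \<in> carrier E \<Longrightarrow> emb T (C (X \<otimes>\<^bsub>E\<^esub> Y)) = emb T (C X) * emb T (C Y)"
  "emb T (C \<one>\<^bsub>E\<^esub>) = M 1"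
proof -
  have h: "C \<in> ring_hom E T" using C by (simp add: is_coaction_def alg_hom_def)
  show "emb T (C (X \<otimes>\<^bsub>E\<^esub> Y)) = emb T (C X) * emb T (C Y)" if "X \<in> carrier E" "Y \<in> carrier E"
    using that by (simp add: ring_hom_mult[OF h] T.emb_simps(3) ring_hom_closed[OF h])
  show "emb T (C \<one>\<^bsub>E\<^esub>) = M 1"
    by (simp add: ring_hom_one[OF h] ten_one M_def)
qed

lemma omega_set_insert: "j \<notin> J \<Longrightarrow> omega_set (insert j J) = omega j + (omega_set J :: 'n weight)"
  by (simp add: omega_set_def)

lemma laplace_terms:
  assumes a: "\<And>I. a I \<in> Gc (omega_set I) \<beta>" and x: "x \<in> K"
  shows "m1 (Q x (K - {x})) * (s x j * a (K - {x})) \<in> Gc (omega_set K) (omega j + \<beta>)"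
proof -
  have "omega_set K = omega x + omega_set (K - {x})"
    using omega_set_insert[of x "K - {x}"] x by (simp add: insert_absorb)
  then show ?thesis using m_Gc(1)[OF Gc(3)[OF Gc(5) a[of "K - {x}"]], of _ x j] by simp
qed

text \<open>Multiplicativity gives a double sum over \<open>e x\<close> times \<open>e_I\<close>.
  Sorting leaves zero or the factor \<open>Q x I\<close>, which balancing moves into the second
  factor as \<open>m1\<close>; collecting equal sets \<open>insert x I\<close> gives the Laplace
  sum.\<close>

lemma C_product:
  assumes a: "\<And>I. a I \<in> Gc (omega_set I) \<beta>" and eq: "emb T (C (es J)) = (\<Sum>I\<in>UNIV. ten (es I) (a I))"
  shows "emb T (C (e j \<otimes>\<^bsub>E\<^esub> es J)) =
    (\<Sum>K\<in>UNIV. ten (es K) (\<Sum>x\<in>K. m1 (Q x (K - {x})) * (s x j * a (K - {x}))))"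
proof -
  have "emb T (C (e j \<otimes>\<^bsub>E\<^esub> es J)) = \<Phi> j * (\<Sum>I\<in>UNIV. ten (es I) (a I))"
    using C by (simp add: C_hom closed eq is_coaction_def)
  also have "\<dots> = (\<Sum>x\<in>UNIV. \<Sum>I\<in>UNIV. ten (e x \<otimes>\<^bsub>E\<^esub> es I) (s x j * a I))"
    unfolding \<Phi>_def sum_product by (intro sum.cong refl ten_mult[OF comps(2) Gc(5) comps(1) a])
  \<comment> \<open>The set \<open>I\<close> is rewritten as \<open>insert x I - {x}\<close>, so
    that the summand depends only on the enlarged set and the marked element.\<close>
  also have "\<dots> = (\<Sum>x\<in>UNIV. \<Sum>I\<in>UNIV. if x \<in> I then 0 else
      ten (es (insert x I)) (m1 (Q x (insert x I - {x})) * (s x j * a (insert x I - {x}))))"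
  proof (intro sum.cong refl)
    fix x I
    have G: "s x j * a I \<in> Gc (omega x + omega_set I) (omega j + \<beta>)" by (rule Gc(3)[OF Gc(5) a])
    have "ten (mu (Q x I) \<otimes>\<^bsub>E\<^esub> es (insert x I)) (s x j * a I) = ten (es (insert x I)) (m1 (Q x I) * (s x j * a I))"
      if "x \<notin> I"
      by (rule ten_bal[OF comps(1)]) (use G in \<open>simp add: omega_set_insert[OF that]\<close>)
    then show "ten (e x \<otimes>\<^bsub>E\<^esub> es I) (s x j * a I) = (if x \<in> I then 0 else
      ten (es (insert x I)) (m1 (Q x (insert x I - {x})) * (s x j * a (insert x I - {x}))))"
      using ten_zero[OF G] by (simp add: e_es)
  qed
  also have "\<dots> = (\<Sum>K\<in>UNIV. \<Sum>x\<in>K. ten (es K) (m1 (Q x (K - {x})) * (s x j * a (K - {x}))))"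
    by (subst sum_insert_reindex[where g = "\<lambda>x I. ten (es (insert x I))
        (m1 (Q x (insert x I - {x})) * (s x j * a (insert x I - {x})))"])
       (intro sum.cong refl; simp add: insert_absorb)
  also have "\<dots> = (\<Sum>K\<in>UNIV. ten (es K) (\<Sum>x\<in>K. m1 (Q x (K - {x})) * (s x j * a (K - {x}))))"
    by (intro sum.cong refl ten_sum[OF comps(1) laplace_terms[OF a], symmetric])
  finally show ?thesis .
qed

lemma unit_expansion: "emb T (C (es {})) = (\<Sum>I\<in>UNIV. ten (es I) (if I = {} then m2 1 else 0))"
proof -
  have "(\<Sum>I\<in>UNIV. ten (es I) (if I = {} then m2 1 else 0)) = (\<Sum>I\<in>(UNIV :: 'n set set). if I = {} then M 1 else 0)"
    by (intro sum.cong refl) (auto simp: es_simps(1) M_def ten_zero_right[OF comps(1)])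
  then show ?thesis by (simp add: es_simps(1) C_hom)
qed

text \<open>Each new index in front of \<open>J\<close> enlarges the row sets by one element, which
  explains the vanishing for unequal cardinalities. The bidegree is carried along because only
  homogeneous coefficients can be compared.\<close>

lemma expansion_exists:
  "\<exists>a. (\<forall>I. a I \<in> Gc (omega_set I) (omega_set J)) \<and> (\<forall>I. card I \<noteq> card J \<longrightarrow> a I = 0) \<and>
     emb T (C (es J)) = (\<Sum>I\<in>UNIV. ten (es I) (a I))"
proof (induction J rule: set_induct)
  case empty
  show ?case
    using Gc(1) Gc(7)[of 1] unit_expansion
    by (intro exI[of _ "\<lambda>I. if I = {} then m2 1 else 0"]) (auto simp: omega_set_def)
next
  case (insert j J)
  then obtain a where a: "\<And>I. a I \<in> Gc (omega_set I) (omega_set J)" "\<And>I. card I \<noteq> card J \<Longrightarrow> a I = 0"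
    "emb T (C (es J)) = (\<Sum>I\<in>UNIV. ten (es I) (a I))" by blast
  have j: "j \<notin> J" using insert(1) by blast
  let ?a = "\<lambda>K. \<Sum>x\<in>K. m1 (Q x (K - {x})) * (s x j * a (K - {x}))"
  have "?a K \<in> Gc (omega_set K) (omega_set (insert j J))" for K
    unfolding omega_set_insert[OF j] by (rule Gc_sum) (rule laplace_terms[OF a(1)])
  moreover have "?a K = 0" if "card K \<noteq> card (insert j J)" for K
  proof (rule sum.neutral, rule ballI)
    fix x assume "x \<in> K"
    then have "card K = Suc (card (K - {x}))" by (metis card.remove finite)
    then have "card (K - {x}) \<noteq> card J" using that j by simp
    then show "m1 (Q x (K - {x})) * (s x j * a (K - {x})) = 0" using a(2) by simp
  qed
  moreover have "emb T (C (es (insert j J))) = (\<Sum>K\<in>UNIV. ten (es K) (?a K))"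
    using C_product[OF a(1,3)] es_simps(2)[OF insert(1)] by simp
  ultimately show ?case by (intro exI[of _ ?a]) simp
qed

definition X :: "'n set \<Rightarrow> 'n set \<Rightarrow> 'f palg" where
  "X I J = (SOME a. (\<forall>I. a I \<in> Gc (omega_set I) (omega_set J)) \<and> (\<forall>I. card I \<noteq> card J \<longrightarrow> a I = 0) \<and>
     emb T (C (es J)) = (\<Sum>I\<in>UNIV. ten (es I) (a I))) I"

lemma X: "X I J \<in> Gc (omega_set I) (omega_set J)" "card I \<noteq> card J \<Longrightarrow> X I J = 0"
  "emb T (C (es J)) = (\<Sum>I\<in>UNIV. ten (es I) (X I J))"
  using someI_ex[OF expansion_exists[of J]] unfolding X_def by blast+

lemma X_unique:
  assumes "\<And>I. \<exists>\<beta>. a I \<in> Gc (omega_set I) \<beta>" "emb T (C (es J)) = (\<Sum>I\<in>UNIV. ten (es I) (a I))"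
  shows "a I = X I J"
  by (rule ten_inj) (use assms X in auto)

lemma X_empty: "X {} {} = m2 1"
proof -
  have "\<exists>\<beta>. (if I = {} then m2 1 else 0) \<in> Gc (omega_set I) \<beta>" for I :: "'n set"
    using Gc(1) Gc(7)[of 1] by (auto simp: omega_set_def)
  from X_unique[OF this unit_expansion, of "{}"] show ?thesis by simp
qed

text \<open>The image of \<open>e j\<close> times \<open>e_J\<close> is computed twice: through
  multiplicativity, and after sorting \<open>j\<close> into \<open>J\<close>, where the sorting
  factor becomes \<open>m2 (Q j J)\<close>. Comparing coefficients gives the expansion along
  \<open>j\<close>.\<close>

lemma laplace:
  assumes j: "j \<notin> J"
  shows "(\<Sum>x\<in>K. m1 (Q x (K - {x})) * (s x j * X (K - {x}) J)) = m2 (Q j J) * X K (insert j J)"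
proof -
  let ?a = "\<lambda>K. \<Sum>x\<in>K. m1 (Q x (K - {x})) * (s x j * X (K - {x}) J)"
  let ?b = "\<lambda>K. m2 (Q j J) * X K (insert j J)"
  have "?a K \<in> Gc (omega_set K) (omega j + omega_set J)" for K
    by (rule Gc_sum) (rule laplace_terms[OF X(1)])
  moreover have "?b K \<in> Gc (omega_set K) (omega_set (insert j J))" for K
    by (rule m_Gc(2)[OF X(1)])
  moreover have "(\<Sum>K\<in>UNIV. ten (es K) (?a K)) = (\<Sum>K\<in>UNIV. ten (es K) (?b K))"
  proof -
    have "(\<Sum>K\<in>UNIV. ten (es K) (?a K)) = emb T (C (e j \<otimes>\<^bsub>E\<^esub> es J))"
      by (rule C_product[OF X(1,3), symmetric])
    also have "\<dots> = M (Q j J) * emb T (C (es (insert j J)))"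
      using C j by (simp add: e_es is_coaction_def closed)
    also have "\<dots> = (\<Sum>K\<in>UNIV. ten (es K) (?b K))"
      unfolding X(3)[of "insert j J"] sum_distrib_left
      by (intro sum.cong refl M_ten[OF comps(1) X(1)])
    finally show ?thesis .
  qed
  ultimately show ?thesis by (intro ten_inj) blast+
qed

end

end

section \<open>The two kinds of minors agree\<close>

text \<open>The signs are those of the sorting factors in the Laplace expansions. What matters is
  that neither \<open>z\<close> nor the elements of \<open>X\<close> enter the right-hand side, only
  their number.\<close>

lemma sum_prod_hm_signed:
  fixes X :: "'n::finite set"
  assumes "\<tau> \<noteq> 0" "z \<notin> X"
  shows "(\<Prod>y\<in>X. - hm \<tau> z y) + (\<Sum>x\<in>X. hm \<tau> z x * (\<Prod>y\<in>X - {x}. - hm \<tau> x y)) =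
    mconst (- ((- 1) ^ card X) * ((qpow \<tau> 1 + qpow \<tau> (- 1)) * qnum \<tau> (card X) - qnum \<tau> (Suc (card X))))"
proof -
  let ?s = "(- 1) ^ card X :: 'n mero"
  let ?S = "\<Sum>x\<in>X. hm \<tau> z x * (\<Prod>y\<in>X - {x}. hm \<tau> x y)"
  have pw: "mconst ((- 1) ^ k) = ((- 1) ^ k :: 'n mero)" for k
    by (induction k) (simp_all add: mconst_hom)
  have "(\<Sum>x\<in>X. hm \<tau> z x * (\<Prod>y\<in>X - {x}. - hm \<tau> x y)) = (\<Sum>x\<in>X. - ?s * (hm \<tau> z x * (\<Prod>y\<in>X - {x}. hm \<tau> x y)))"
  proof (rule sum.cong[OF refl])
    fix x assume "x \<in> X"
    then have "card X = Suc (card (X - {x}))" by (metis card.remove finite)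
    then show "hm \<tau> z x * (\<Prod>y\<in>X - {x}. - hm \<tau> x y) = - ?s * (hm \<tau> z x * (\<Prod>y\<in>X - {x}. hm \<tau> x y))"
      by (simp add: prod_uminus)
  qed
  then have "(\<Prod>y\<in>X. - hm \<tau> z y) + (\<Sum>x\<in>X. hm \<tau> z x * (\<Prod>y\<in>X - {x}. - hm \<tau> x y)) =
      - ?s * (?S - (\<Prod>y\<in>X. hm \<tau> z y))"
    by (simp add: prod_uminus sum_distrib_left sum_negf right_diff_distrib)
  also have "\<dots> = mconst (- ((- 1) ^ card X)) * mconst ((qpow \<tau> 1 + qpow \<tau> (- 1)) * qnum \<tau> (card X) - qnum \<tau> (Suc (card X)))"
    unfolding sum_prod_hm_diff[OF assms] by (simp only: mconst_hom(5) pw)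
  finally show ?thesis by (simp only: mconst_hom(2))
qed

lemma tt_invariant:
  "(\<And>k. mshift (omega i) f = f) \<Longrightarrow> ml \<tau> f * (tt \<tau> i j * z) = tt \<tau> i j * (ml \<tau> f * z)"
  "(\<And>k. mshift (omega j) f = f) \<Longrightarrow> mr \<tau> f * (tt \<tau> i j * z) = tt \<tau> i j * (mr \<tau> f * z)"
  by (simp_all only: mult.assoc[symmetric] ml_tt mr_tt)

lemma mshift_prod_hm:
  fixes K :: "'n::finite set"
  assumes "\<tau> \<noteq> 0" "j \<noteq> x" "j \<notin> K" "x \<notin> K"
  shows "mshift (omega j) (\<Prod>y\<in>K. - hm \<tau> x y) = (\<Prod>y\<in>K. - hm \<tau> x y)"
  unfolding mshift_prod
proof (rule prod.cong[OF refl])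
  fix y assume "y \<in> K"
  then have "x \<noteq> y" "y \<noteq> j" using assms by auto
  then show "mshift (omega j) (- hm \<tau> x y) = - hm \<tau> x y"
    using assms by (simp add: mshift_hom mshift_hm omega_nth)
qed

text \<open>A constant function of \<lambda> and the same constant as a function of \<mu> both act
  as a complex scalar. Through this lemma the sums over rows and over columns become
  comparable.\<close>

lemma const_tt_mult: "ml \<tau> (mconst k) * (tt \<tau> i j * z) = mr \<tau> (mconst k) * (tt \<tau> i j * z)"
proof -
  have "ml \<tau> (mconst k) * tt \<tau> i j = mr \<tau> (mconst k) * tt \<tau> i j"
    unfolding tt_def ml_simps(6) mr_simps(6) ..
  then show ?thesis by (simp only: mult.assoc[symmetric])
qed

text \<open>\<open>Qless\<close> and \<open>Qgr\<close> are the sorting factors \<open>Q\<close> of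
  \<open>W\<close> and of \<open>V\<close>, made explicit for the given and for the reversed
  order.\<close>

definition Qless :: "complex \<Rightarrow> 'n::{finite,linorder} \<Rightarrow> 'n set \<Rightarrow> 'n mero" where
  "Qless \<tau> x I = (\<Prod>y\<in>{y\<in>I. y < x}. - hm \<tau> x y)"
definition Qgr :: "complex \<Rightarrow> 'n::{finite,linorder} \<Rightarrow> 'n set \<Rightarrow> 'n mero" where
  "Qgr \<tau> x I = (\<Prod>y\<in>{y\<in>I. x < y}. - hm \<tau> x y)"

text \<open>One expansion contributes the indices below \<open>x\<close>, the other those above.
  Their product no longer refers to the order, which is what makes the symmetric scalar identities
  applicable.\<close>

lemma Qless_Qgr: "x \<notin> I \<Longrightarrow> Qless \<tau> x I * Qgr \<tau> x I = (\<Prod>y\<in>I. - hm \<tau> x y)"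
proof -
  assume "x \<notin> I"
  then have "y < x \<or> x < y" if "y \<in> I" for y using that by (metis neqE)
  then have "I = {y\<in>I. y < x} \<union> {y\<in>I. x < y}" by blast
  then have "(\<Prod>y\<in>I. - hm \<tau> x y) = (\<Prod>y\<in>{y\<in>I. y < x} \<union> {y\<in>I. x < y}. - hm \<tau> x y)" by simp
  also have "\<dots> = Qless \<tau> x I * Qgr \<tau> x I"
    unfolding Qless_def Qgr_def by (rule prod.union_disjoint) auto
  finally show ?thesis by simp
qed

lemma mshift_Qless: "\<tau> \<noteq> 0 \<Longrightarrow> j \<noteq> x \<Longrightarrow> j \<notin> I \<Longrightarrow> mshift (omega j) (Qless \<tau> x I) = Qless \<tau> x I"
  unfolding Qless_def by (rule mshift_prod_hm) auto

lemma mshift_Qgr: "\<tau> \<noteq> 0 \<Longrightarrow> j \<noteq> x \<Longrightarrow> j \<notin> I \<Longrightarrow> mshift (omega j) (Qgr \<tau> x I) = Qgr \<tau> x I"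
  unfolding Qgr_def by (rule mshift_prod_hm) auto

lemma Qless_eq:
  "(\<And>y. y \<in> I \<Longrightarrow> x < y) \<Longrightarrow> Qless \<tau> x I = 1"
  "(\<And>y. y \<in> I \<Longrightarrow> y < x) \<Longrightarrow> Qless \<tau> x I = (\<Prod>y\<in>I. - hm \<tau> x y)"
  "x < c \<Longrightarrow> Qless \<tau> x (insert c I) = Qless \<tau> x I"
  unfolding Qless_def by (rule prod.neutral prod.cong; force)+

lemma Qgr_eq:
  "(\<And>y. y \<in> I \<Longrightarrow> y < x) \<Longrightarrow> Qgr \<tau> x I = 1"
  "(\<And>y. y \<in> I \<Longrightarrow> x < y) \<Longrightarrow> Qgr \<tau> x I = (\<Prod>y\<in>I. - hm \<tau> x y)"
  "c < x \<Longrightarrow> Qgr \<tau> x (insert c I) = Qgr \<tau> x I"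
  unfolding Qgr_def by (rule prod.neutral prod.cong; force)+

text \<open>Induction on the size. With \<open>c\<close> the maximum of \<open>I\<close> and \<open>d\<close> the minimum of \<open>J\<close>, expand
  \<open>\<xi>\<close> along column \<open>d\<close> and \<open>\<eta>\<close> along row \<open>c\<close>, and expand the resulting minors once more
  along the other line. The double sums differ by the cross relation between
  \<open>t\<^sub>x\<^sub>d\<close> and \<open>t\<^sub>c\<^sub>j\<close>; the difference collapses to a multiple of \<open>t\<^sub>c\<^sub>d\<close> times a smaller minor, with a
  coefficient that vanishes since the expression in \<open>sum_prod_hm_signed\<close> depends only on
  the number of variables.\<close>

lemma minors_agree:
  fixes \<xi> \<eta> :: "'n::{finite,linorder} set \<Rightarrow> 'n set \<Rightarrow> 'n frst palg"
  assumes \<tau>: "\<tau> \<noteq> 0" and empty: "\<xi> {} {} = \<eta> {} {}"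
    and unit: "\<And>I J. mr \<tau> 1 * \<xi> I J = \<xi> I J" "\<And>I J. ml \<tau> 1 * \<eta> I J = \<eta> I J"
    and R: "\<And>j J K. j \<notin> J \<Longrightarrow> (\<Sum>x\<in>K. ml \<tau> (Qless \<tau> x (K - {x})) * (tt \<tau> x j * \<xi> (K - {x}) J)) =
      mr \<tau> (Qless \<tau> j J) * \<xi> K (insert j J)"
    and L: "\<And>x I K. x \<notin> I \<Longrightarrow> (\<Sum>j\<in>K. mr \<tau> (Qgr \<tau> j (K - {j})) * (tt \<tau> x j * \<eta> I (K - {j}))) =
      ml \<tau> (Qgr \<tau> x I) * \<eta> (insert x I) K"
    and "card I = card J"
  shows "\<xi> I J = \<eta> I J"
  using \<open>card I = card J\<close>
proof (induction "card I" arbitrary: I J rule: less_induct)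
  case (less I J)
  note IH = less(1)
  show ?case
  proof (cases "I = {}")
    case True
    then have "J = {}" using less(2) by simp
    then show ?thesis using True empty by simp
  next
    case False
    then have "J \<noteq> {}" using less(2) by auto
    \<comment> \<open>With \<open>c\<close> largest the factor \<open>Qgr \<tau> c I'\<close> is 1,
      and with \<open>d\<close> smallest \<open>Qless \<tau> d J'\<close> is 1, so the expansions
      give the minors themselves.\<close>
    define c d where "c = Max I" and "d = Min J"
    define I' J' where "I' = I - {c}" and "J' = J - {d}"
    have c: "c \<in> I" "\<And>x. x \<in> I' \<Longrightarrow> x < c" and d: "d \<in> J" "\<And>j. j \<in> J' \<Longrightarrow> d < j"
      using False \<open>J \<noteq> {}\<close> unfolding c_def d_def I'_def J'_def
      by (auto intro: Max_in Min_in simp: order_less_le Max_ge Min_le)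
    have IJ: "I = insert c I'" "c \<notin> I'" "J = insert d J'" "d \<notin> J'"
      using c(1) d(1) by (auto simp: I'_def J'_def)
    have card: "card I' = card J'" "card I' < card I"
      using less(2) IJ by simp_all
    have del: "card (I' - {x}) = card (J' - {j})" "card (I' - {x}) < card I"
      "insert c (I' - {x}) = I - {x}" "insert d (J' - {j}) = J - {j}"
      "card (I - {x}) = card J'" "card (I - {x}) < card I" "card I' = card (J - {j})"
      "c \<notin> I' - {x}" "d \<notin> J' - {j}" "insert x (I' - {x}) = I'" "insert j (J' - {j}) = J'" "x < c" "d < j"
      if "x \<in> I'" "j \<in> J'" for x j
      using that IJ card c(2) d(2) by (auto simp: card_Diff_singleton_if card_gt_0_iff less(2)[symmetric])
    let ?l = "\<lambda>x. ml \<tau> (Qless \<tau> x (I' - {x}))" and ?r = "\<lambda>j. mr \<tau> (Qgr \<tau> j (J' - {j}))"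
    let ?z = "\<lambda>x j. \<xi> (I' - {x}) (J' - {j})"
    let ?Z = "tt \<tau> c d * \<xi> I' J'"
    \<comment> \<open>The factors \<open>?l\<close> involve only rows of \<open>I'\<close> and the
      factors \<open>?r\<close> only columns of \<open>J'\<close>, so they commute with entries of
      row \<open>c\<close> and of column \<open>d\<close> respectively.\<close>
    have cl: "?l x * (tt \<tau> c j * z) = tt \<tau> c j * (?l x * z)" if "x \<in> I'" for x j z
      by (rule tt_invariant) (rule mshift_Qless[OF \<tau>]; use that IJ in blast)
    have cr: "?r j * (tt \<tau> x d * z) = tt \<tau> x d * (?r j * z)" if "j \<in> J'" for x j z
      by (rule tt_invariant) (rule mshift_Qgr[OF \<tau>]; use that IJ in blast)
    have lr: "ml \<tau> f * (mr \<tau> g * z) = mr \<tau> g * (ml \<tau> f * z)" for f g z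
      by (simp only: mult.assoc[symmetric] ml_mr)

    have \<xi>1: "\<xi> I J = (\<Sum>x\<in>I. ml \<tau> (Qless \<tau> x (I - {x})) * (tt \<tau> x d * \<xi> (I - {x}) J'))"
      using R[OF IJ(4), of I] d(2) by (simp add: Qless_eq(1) unit IJ(3)[symmetric])
    have \<xi>2: "ml \<tau> (Qless \<tau> x (I - {x})) * (tt \<tau> x d * \<xi> (I - {x}) J') =
        (\<Sum>j\<in>J'. ?l x * (?r j * (tt \<tau> x d * (tt \<tau> c j * ?z x j))))" if x: "x \<in> I'" for x
    proof -
      obtain j0 where j0: "j0 \<in> J'" using x card(1) by (metis card_eq_0_iff empty_iff equals0I finite)
      have q: "Qless \<tau> x (I - {x}) = Qless \<tau> x (I' - {x})"
        using Qless_eq(3)[of x c \<tau> "I' - {x}"] del(3,12)[OF x j0] by simp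
      have "\<xi> (I - {x}) J' = \<eta> (insert c (I' - {x})) J'"
        using IH[of "I - {x}" J'] del(3,5,6)[OF x j0] by simp
      also have "\<dots> = (\<Sum>j\<in>J'. ?r j * (tt \<tau> c j * \<eta> (I' - {x}) (J' - {j})))"
        using L[OF del(8)[OF x j0], of J'] Qgr_eq(1)[of "I' - {x}" c] c(2) by (simp add: unit)
      also have "\<dots> = (\<Sum>j\<in>J'. ?r j * (tt \<tau> c j * ?z x j))"
        by (rule sum.cong[OF refl]) (use IH del(1,2)[OF x] in simp)
      finally show ?thesis
        by (simp add: q sum_distrib_left cr cong: sum.cong)
    qed
    have \<xi>: "\<xi> I J = ml \<tau> (\<Prod>y\<in>I'. - hm \<tau> c y) * ?Z +
        (\<Sum>x\<in>I'. \<Sum>j\<in>J'. ?l x * (?r j * (tt \<tau> x d * (tt \<tau> c j * ?z x j))))"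
    proof -
      have "(\<Sum>x\<in>I. ml \<tau> (Qless \<tau> x (I - {x})) * (tt \<tau> x d * \<xi> (I - {x}) J')) =
          ml \<tau> (Qless \<tau> c I') * ?Z + (\<Sum>x\<in>I'. ml \<tau> (Qless \<tau> x (I - {x})) * (tt \<tau> x d * \<xi> (I - {x}) J'))"
        unfolding I'_def by (rule sum.remove) (use c in auto)
      then show ?thesis
        by (simp add: \<xi>1 \<xi>2 Qless_eq(2)[OF c(2)] cong: sum.cong)
    qed

    have \<eta>1: "\<eta> I J = (\<Sum>j\<in>J. mr \<tau> (Qgr \<tau> j (J - {j})) * (tt \<tau> c j * \<eta> I' (J - {j})))"
      using L[OF IJ(2), of J] c(2) by (simp add: Qgr_eq(1) unit IJ(1)[symmetric])
    have \<eta>2: "mr \<tau> (Qgr \<tau> j (J - {j})) * (tt \<tau> c j * \<eta> I' (J - {j})) =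
        (\<Sum>x\<in>I'. ?l x * (?r j * (tt \<tau> c j * (tt \<tau> x d * ?z x j))))" if j: "j \<in> J'" for j
    proof -
      obtain x0 where x0: "x0 \<in> I'" using j card(1) by (metis card_eq_0_iff empty_iff equals0I finite)
      have q: "Qgr \<tau> j (J - {j}) = Qgr \<tau> j (J' - {j})"
        using Qgr_eq(3)[of d j \<tau> "J' - {j}"] del(4,13)[OF x0 j] by simp
      have "\<eta> I' (J - {j}) = \<xi> I' (insert d (J' - {j}))"
        using IH[of I' "J - {j}"] del(4,7)[OF x0 j] card by simp
      also have "\<dots> = (\<Sum>x\<in>I'. ?l x * (tt \<tau> x d * ?z x j))"
        using R[OF del(9)[OF x0 j], of I'] Qless_eq(1)[of "J' - {j}" d] d(2) by (simp add: unit)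
      finally show ?thesis
        by (simp add: q sum_distrib_left cl[symmetric] lr cong: sum.cong)
    qed
    have \<eta>: "\<eta> I J = mr \<tau> (\<Prod>y\<in>J'. - hm \<tau> d y) * ?Z +
        (\<Sum>x\<in>I'. \<Sum>j\<in>J'. ?l x * (?r j * (tt \<tau> c j * (tt \<tau> x d * ?z x j))))"
    proof -
      have "(\<Sum>j\<in>J. mr \<tau> (Qgr \<tau> j (J - {j})) * (tt \<tau> c j * \<eta> I' (J - {j}))) =
          mr \<tau> (Qgr \<tau> d J') * (tt \<tau> c d * \<eta> I' J') +
          (\<Sum>j\<in>J'. mr \<tau> (Qgr \<tau> j (J - {j})) * (tt \<tau> c j * \<eta> I' (J - {j})))"
        unfolding J'_def by (rule sum.remove) (use d in auto)
      moreover have "\<eta> I' J' = \<xi> I' J'" using IH[OF card(2,1)] by simp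
      ultimately show ?thesis
        by (simp add: \<eta>1 \<eta>2 Qgr_eq(2)[OF d(2)] cong: sum.cong)
           (rule sum.swap)
    qed

    have cross: "tt \<tau> x d * (tt \<tau> c j * z) = tt \<tau> c j * (tt \<tau> x d * z) +
        ml \<tau> (hm \<tau> c x) * (tt \<tau> c d * (tt \<tau> x j * z)) - mr \<tau> (hm \<tau> d j) * (tt \<tau> c d * (tt \<tau> x j * z))"
      if "x \<in> I'" "j \<in> J'" for x j z
      using tt_cross[OF \<tau> c(2)[OF that(1)] d(2)[OF that(2)]]
      by (simp only: mult.assoc[symmetric]) (simp add: distrib_right left_diff_distrib mult.assoc)
    let ?D1 = "\<Sum>x\<in>I'. \<Sum>j\<in>J'. ?l x * (?r j * (ml \<tau> (hm \<tau> c x) * (tt \<tau> c d * (tt \<tau> x j * ?z x j))))"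
    let ?D2 = "\<Sum>x\<in>I'. \<Sum>j\<in>J'. ?l x * (?r j * (mr \<tau> (hm \<tau> d j) * (tt \<tau> c d * (tt \<tau> x j * ?z x j))))"
    have diff: "(\<Sum>x\<in>I'. \<Sum>j\<in>J'. ?l x * (?r j * (tt \<tau> x d * (tt \<tau> c j * ?z x j)))) =
        (\<Sum>x\<in>I'. \<Sum>j\<in>J'. ?l x * (?r j * (tt \<tau> c j * (tt \<tau> x d * ?z x j)))) + ?D1 - ?D2"
      unfolding sum.distrib[symmetric] sum_subtractf[symmetric]
      by (intro sum.cong refl) (simp only: cross distrib_left right_diff_distrib)

    have D1: "?D1 = (\<Sum>x\<in>I'. ml \<tau> (hm \<tau> c x * (\<Prod>y\<in>I' - {x}. - hm \<tau> x y)) * ?Z)"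
    proof (rule sum.cong[OF refl])
      fix x assume x: "x \<in> I'"
      have "(\<Sum>j\<in>J'. ?l x * (?r j * (ml \<tau> (hm \<tau> c x) * (tt \<tau> c d * (tt \<tau> x j * ?z x j))))) =
          ?l x * (ml \<tau> (hm \<tau> c x) * (tt \<tau> c d * (\<Sum>j\<in>J'. ?r j * (tt \<tau> x j * ?z x j))))"
        by (simp add: sum_distrib_left lr[symmetric] cr cong: sum.cong)
      also have "(\<Sum>j\<in>J'. ?r j * (tt \<tau> x j * ?z x j)) = (\<Sum>j\<in>J'. ?r j * (tt \<tau> x j * \<eta> (I' - {x}) (J' - {j})))"
        by (rule sum.cong[OF refl]) (use IH del(1,2)[OF x] in simp)
      also have "\<dots> = ml \<tau> (Qgr \<tau> x (I' - {x})) * \<eta> I' J'"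
        using L[of x "I' - {x}" J'] x by (simp add: insert_absorb)
      also have "\<eta> I' J' = \<xi> I' J'" using IH[OF card(2,1)] by simp
      also have "tt \<tau> c d * (ml \<tau> (Qgr \<tau> x (I' - {x})) * \<xi> I' J') = ml \<tau> (Qgr \<tau> x (I' - {x})) * ?Z"
        by (rule tt_invariant(1)[symmetric], rule mshift_Qgr[OF \<tau>]) (use x IJ in blast)+
      also have "?l x * (ml \<tau> (hm \<tau> c x) * (ml \<tau> (Qgr \<tau> x (I' - {x})) * ?Z)) =
          ml \<tau> (hm \<tau> c x * (Qless \<tau> x (I' - {x}) * Qgr \<tau> x (I' - {x}))) * ?Z"
        by (simp only: mult.assoc[symmetric] ml_simps(2)[symmetric]) (simp only: mult_ac)
      finally show "(\<Sum>j\<in>J'. ?l x * (?r j * (ml \<tau> (hm \<tau> c x) * (tt \<tau> c d * (tt \<tau> x j * ?z x j))))) =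
          ml \<tau> (hm \<tau> c x * (\<Prod>y\<in>I' - {x}. - hm \<tau> x y)) * ?Z"
        by (simp add: Qless_Qgr)
    qed

    have D2: "?D2 = (\<Sum>j\<in>J'. mr \<tau> (hm \<tau> d j * (\<Prod>y\<in>J' - {j}. - hm \<tau> j y)) * ?Z)"
    proof (subst sum.swap, rule sum.cong[OF refl])
      fix j assume j: "j \<in> J'"
      have "(\<Sum>x\<in>I'. ?l x * (?r j * (mr \<tau> (hm \<tau> d j) * (tt \<tau> c d * (tt \<tau> x j * ?z x j))))) =
          ?r j * (mr \<tau> (hm \<tau> d j) * (tt \<tau> c d * (\<Sum>x\<in>I'. ?l x * (tt \<tau> x j * ?z x j))))"
        by (simp add: sum_distrib_left lr cl cong: sum.cong)
      also have "(\<Sum>x\<in>I'. ?l x * (tt \<tau> x j * ?z x j)) = mr \<tau> (Qless \<tau> j (J' - {j})) * \<xi> I' J'"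
        using R[of j "J' - {j}" I'] j by (simp add: insert_absorb)
      also have "tt \<tau> c d * (mr \<tau> (Qless \<tau> j (J' - {j})) * \<xi> I' J') = mr \<tau> (Qless \<tau> j (J' - {j})) * ?Z"
        by (rule tt_invariant(2)[symmetric], rule mshift_Qless[OF \<tau>]) (use j IJ in blast)+
      also have "?r j * (mr \<tau> (hm \<tau> d j) * (mr \<tau> (Qless \<tau> j (J' - {j})) * ?Z)) =
          mr \<tau> (hm \<tau> d j * (Qless \<tau> j (J' - {j}) * Qgr \<tau> j (J' - {j}))) * ?Z"
        by (simp only: mult.assoc[symmetric] mr_simps(2)[symmetric]) (simp only: mult_ac)
      finally show "(\<Sum>x\<in>I'. ?l x * (?r j * (mr \<tau> (hm \<tau> d j) * (tt \<tau> c d * (tt \<tau> x j * ?z x j))))) =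
          mr \<tau> (hm \<tau> d j * (\<Prod>y\<in>J' - {j}. - hm \<tau> j y)) * ?Z"
        by (simp add: Qless_Qgr)
    qed

    have mls: "ml \<tau> (sum f A) = (\<Sum>x\<in>A. ml \<tau> (f x))" "mr \<tau> (sum f A) = (\<Sum>x\<in>A. mr \<tau> (f x))" for f and A :: "'n set"
      by (induction A rule: infinite_finite_induct) (simp_all add: ml_simps(1,4) mr_simps(1,4))
    have "ml \<tau> (\<Prod>y\<in>I'. - hm \<tau> c y) * ?Z + ?D1 = mr \<tau> (\<Prod>y\<in>J'. - hm \<tau> d y) * ?Z + ?D2"
    proof -
      have "ml \<tau> (\<Prod>y\<in>I'. - hm \<tau> c y) * ?Z + ?D1 = ml \<tau> ((\<Prod>y\<in>I'. - hm \<tau> c y) +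
          (\<Sum>x\<in>I'. hm \<tau> c x * (\<Prod>y\<in>I' - {x}. - hm \<tau> x y))) * ?Z"
        by (simp only: D1 ml_simps(1) mls distrib_right sum_distrib_right)
      also have "\<dots> = mr \<tau> ((\<Prod>y\<in>J'. - hm \<tau> d y) +
          (\<Sum>j\<in>J'. hm \<tau> d j * (\<Prod>y\<in>J' - {j}. - hm \<tau> j y))) * ?Z"
        unfolding sum_prod_hm_signed[OF \<tau> IJ(2)] sum_prod_hm_signed[OF \<tau> IJ(4)] card(1)
        by (rule const_tt_mult)
      also have "\<dots> = mr \<tau> (\<Prod>y\<in>J'. - hm \<tau> d y) * ?Z + ?D2"
        by (simp only: D2 mr_simps(1) mls distrib_right sum_distrib_right)
      finally show ?thesis .
    qed
    then show ?thesis unfolding \<xi> \<eta> diff by (simp add: algebra_simps)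
  qed
qed

section \<open>Instances\<close>

lemma F_letters:
  "pl (F_rels \<tau>) (mon [g]) * pl (F_rels \<tau>) (mon [FunL f]) =
    pl (F_rels \<tau>) (mon [FunL (mshift (- fst (fdeg g)) f)]) * pl (F_rels \<tau>) (mon [g])"
  "pl (F_rels \<tau>) (mon [g]) * pl (F_rels \<tau>) (mon [FunR f]) =
    pl (F_rels \<tau>) (mon [FunR (mshift (- snd (fdeg g)) f)]) * pl (F_rels \<tau>) (mon [g])"
proof -
  note fold = ml_def[symmetric] mr_def[symmetric] tt_def[symmetric]
  have c: "ml \<tau> f * ml \<tau> g = ml \<tau> g * ml \<tau> f" "mr \<tau> f * mr \<tau> g = mr \<tau> g * mr \<tau> f" for f g :: "'a mero"
    by (simp_all add: ml_simps(2)[symmetric] mr_simps(2)[symmetric] mult.commute)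
  show "pl (F_rels \<tau>) (mon [g]) * pl (F_rels \<tau>) (mon [FunL f]) =
    pl (F_rels \<tau>) (mon [FunL (mshift (- fst (fdeg g)) f)]) * pl (F_rels \<tau>) (mon [g])"
    by (cases g) (simp_all add: fold ml_tt mshift_hom ml_mr c)
  show "pl (F_rels \<tau>) (mon [g]) * pl (F_rels \<tau>) (mon [FunR f]) =
    pl (F_rels \<tau>) (mon [FunR (mshift (- snd (fdeg g)) f)]) * pl (F_rels \<tau>) (mon [g])"
    by (cases g) (simp_all add: fold mr_tt mshift_hom ml_mr c)
qed

lemma (in ext_alg) E_letters:
  "pl S (mon [g]) * pl S (mon [FunE f]) = pl S (mon [FunE (mshift (- edeg g) f)]) * pl S (mon [g])"
proof (cases g)
  case (Egen i)
  then show ?thesis using mu_e[of "mshift (- omega i) f" i]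
    by (simp add: mu_def e_def pl_def[symmetric] mshift_hom)
next
  case (FunE h)
  have "pl S (mon [FunE h]) * pl S (mon [FunE f]) = pl S (mon [FunE f]) * pl S (mon [FunE h])"
    using mu_simps(2)[of h f] mu_simps(2)[of f h] by (simp add: mu_def pl_def[symmetric] mult.commute)
  then show ?thesis using FunE by (simp add: mshift_hom)
qed

lemma (in ext_alg) E_swap:
  assumes "X \<in> hom_component S edeg \<alpha>"
  shows "X \<otimes>\<^bsub>E\<^esub> mu f = mu (mshift (- \<alpha>) f) \<otimes>\<^bsub>E\<^esub> X"
  unfolding mu_def
  by (rule hom_component_swap[where c = FunE and \<sigma> = "\<lambda>\<alpha>. mshift (- \<alpha>)", OF E_letters _ _ assms])
     (simp_all add: mshift_hom)

lemma F_swap: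
  assumes "X \<in> F_comp \<tau> d"
  shows "X \<otimes>\<^bsub>FR \<tau>\<^esub> mu_l \<tau> f = mu_l \<tau> (mshift (- fst d) f) \<otimes>\<^bsub>FR \<tau>\<^esub> X"
    "X \<otimes>\<^bsub>FR \<tau>\<^esub> mu_r \<tau> f = mu_r \<tau> (mshift (- snd d) f) \<otimes>\<^bsub>FR \<tau>\<^esub> X"
  unfolding mu_l_def mu_r_def FR_def
  by (rule hom_component_swap[where c = FunL and \<sigma> = "\<lambda>d. mshift (- fst d)", OF F_letters(1) _ _
        assms[unfolded F_comp_def]]; simp add: mshift_hom)
     (rule hom_component_swap[where c = FunR and \<sigma> = "\<lambda>d. mshift (- snd d)", OF F_letters(2) _ _
        assms[unfolded F_comp_def]]; simp add: mshift_hom)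

lemma calg_FR: "calg (FR \<tau>)"
  unfolding FR_def by (rule calg_presented)

lemma FR_copies: "mu_l \<tau> f \<in> F_comp \<tau> 0" "mu_r \<tau> f \<in> F_comp \<tau> 0" "t_el \<tau> i j \<in> F_comp \<tau> (omega i, omega j)"
  unfolding mu_l_def mu_r_def t_el_def F_comp_def by (auto intro!: hom_component_mon)

lemmas F_comp_simps =
  hom_component_carrier[of _ "F_rels \<tau>" fdeg, folded F_comp_def FR_def]
  hom_component_add[of _ "F_rels \<tau>" fdeg, folded F_comp_def FR_def]
  hom_component_smult[of _ "F_rels \<tau>" fdeg, folded F_comp_def FR_def]
  hom_component_mult[of _ "F_rels \<tau>" fdeg, folded F_comp_def FR_def]
  hom_component_zero[of "F_rels \<tau>" fdeg, folded F_comp_def FR_def]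
  hom_component_one[of "F_rels \<tau>" fdeg, folded F_comp_def FR_def] for \<tau>

definition FG :: "complex \<Rightarrow> 'n weight \<times> 'n weight \<Rightarrow> 'n::{finite,linorder} frst palg set" where
  "FG \<tau> d = emb (FR \<tau>) ` F_comp \<tau> d"

definition prj :: "complex \<Rightarrow> 'n::{finite,linorder} frst palg \<Rightarrow> 'n frst" where
  "prj \<tau> a = Rep_palg a (FR \<tau>)"

lemma prj_emb: "x \<in> carrier (FR \<tau>) \<Longrightarrow> prj \<tau> (emb (FR \<tau>) x) = x"
  by (simp add: prj_def calg.Rep_palg_emb calg_FR)

lemma F_embs: "emb (FR \<tau>) (mu_l \<tau> f) = ml \<tau> f" "emb (FR \<tau>) (mu_r \<tau> f) = mr \<tau> f"
  "emb (FR \<tau>) (t_el \<tau> i j) = tt \<tau> i j"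
  by (simp_all add: mu_l_def mu_r_def t_el_def ml_def mr_def tt_def FR_def pl_def)

lemma FG:
  "0 \<in> FG \<tau> d" "a \<in> FG \<tau> d \<Longrightarrow> b \<in> FG \<tau> d \<Longrightarrow> a + b \<in> FG \<tau> d"
  "a \<in> FG \<tau> d \<Longrightarrow> b \<in> FG \<tau> d' \<Longrightarrow> a * b \<in> FG \<tau> (d + d')" "a \<in> FG \<tau> d \<Longrightarrow> scl c a \<in> FG \<tau> d"
  "tt \<tau> i j \<in> FG \<tau> (omega i, omega j)" "ml \<tau> f \<in> FG \<tau> 0" "mr \<tau> f \<in> FG \<tau> 0"
proof -
  interpret calg "FR \<tau>" by (rule calg_FR)
  note s = F_comp_simps
  show "0 \<in> FG \<tau> d" unfolding FG_def using emb_simps(1) s(5) by (metis imageI)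
  show "a + b \<in> FG \<tau> d" if "a \<in> FG \<tau> d" "b \<in> FG \<tau> d"
    using that unfolding FG_def by (auto simp: emb_simps(2)[symmetric] s)
  show "a * b \<in> FG \<tau> (d + d')" if "a \<in> FG \<tau> d" "b \<in> FG \<tau> d'"
    using that unfolding FG_def by (auto simp: emb_simps(3)[symmetric] s)
  show "scl c a \<in> FG \<tau> d" if "a \<in> FG \<tau> d"
    using that unfolding FG_def by (auto simp: emb_simps(4)[symmetric] s)
  show "tt \<tau> i j \<in> FG \<tau> (omega i, omega j)" "ml \<tau> f \<in> FG \<tau> 0" "mr \<tau> f \<in> FG \<tau> 0"
    unfolding FG_def F_embs[symmetric] by (auto intro: FR_copies)
qed

lemma FG_pl: "a \<in> FG \<tau> d \<Longrightarrow> \<exists>p. a = pl (F_rels \<tau>) p"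
  by (auto simp: FG_def F_comp_def hom_component_def FR_def pl_def)

lemma FG_unit:
  assumes "a \<in> FG \<tau> d"
  shows "ml \<tau> 1 * a = a" "mr \<tau> 1 * a = a" "a * ml \<tau> 1 = a" "a * mr \<tau> 1 = a"
    "ml \<tau> (mconst k) * a = scl k a" "mr \<tau> (mconst k) * a = scl k a"
  using FG_pl[OF assms] by (auto simp: ml_simps mr_simps pl_one_mult scl_simps(5))

lemma ext_alg_W: "\<tau> \<noteq> 0 \<Longrightarrow> ext_alg (\<le>) (<) \<tau> (sorted_list_of_set :: 'n::{finite,linorder} set \<Rightarrow> 'n list)"
proof unfold_locales
  fix j :: 'n and I :: "'n set" assume "\<And>y. y \<in> I \<Longrightarrow> j < y"
  then have m: "\<And>y. y \<in> I \<Longrightarrow> j < y" and j: "j \<notin> I" by auto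
  have "insort j (sorted_list_of_set I) = j # sorted_list_of_set I"
    by (rule insort_is_Cons) (use m in \<open>auto simp: less_imp_le\<close>)
  then show "sorted_list_of_set (insert j I) = j # sorted_list_of_set I"
    using j by (simp add: sorted_list_of_set.sorted_key_list_of_set_insert)
qed auto

lemma ext_alg_V: "\<tau> \<noteq> 0 \<Longrightarrow> ext_alg (\<lambda>i j. j \<le> i) (\<lambda>i j. j < i) \<tau>
    (\<lambda>I. rev (sorted_list_of_set (I :: 'n::{finite,linorder} set)))"
proof unfold_locales
  fix j :: 'n and I :: "'n set" assume *: "\<And>y. y \<in> I \<Longrightarrow> y < j"
  then have "y < j" if "y \<in> I" for y using that by blast
  then have "sorted_list_of_set (insert j I) = sorted_list_of_set I @ [j]"
    by (intro sorted_distinct_set_unique) (auto simp: sorted_append less_imp_le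
        simp del: sorted_list_of_set.sorted_key_list_of_set_insert_remove)
  then show "rev (sorted_list_of_set (insert j I)) = j # rev (sorted_list_of_set I)" by simp
qed auto

lemma ext_names:
  "W_alg \<tau> = presented (ext_rels (<) \<tau>)" "W_comp \<tau> = hom_component (ext_rels (<) \<tau>) edeg"
  "V_alg \<tau> = presented (ext_rels (\<lambda>i j. j < i) \<tau>)" "V_comp \<tau> = hom_component (ext_rels (\<lambda>i j. j < i) \<tau>) edeg"
  by (simp_all add: W_alg_def W_comp_def W_rels_eq V_alg_def V_comp_def V_rels_eq)

lemma ext_elements_W:
  assumes "\<tau> \<noteq> 0"
  shows "mu_W \<tau> f = ext_alg.mu (<) \<tau> (f :: 'n::{finite,linorder} mero)" "w_el \<tau> i = ext_alg.e (<) \<tau> (i :: 'n)"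
    "w_set \<tau> I = ext_alg.es (<) \<tau> sorted_list_of_set (I :: 'n set)"
proof -
  interpret W: ext_alg "(\<le>)" "(<)" \<tau> "sorted_list_of_set :: 'n set \<Rightarrow> 'n list" by (rule ext_alg_W) fact
  show "mu_W \<tau> f = ext_alg.mu (<) \<tau> f" "w_el \<tau> i = ext_alg.e (<) \<tau> i"
    "w_set \<tau> I = ext_alg.es (<) \<tau> sorted_list_of_set I"
    by (simp_all add: mu_W_def w_el_def w_set_def W.mu_def W.e_def W.es_def W_rels_eq)
qed

lemma ext_elements_V:
  assumes "\<tau> \<noteq> 0"
  shows "mu_V \<tau> f = ext_alg.mu (\<lambda>i j. j < i) \<tau> (f :: 'n::{finite,linorder} mero)"
    "v_el \<tau> i = ext_alg.e (\<lambda>i j. j < i) \<tau> (i :: 'n)"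
    "v_set \<tau> I = ext_alg.es (\<lambda>i j. j < i) \<tau> (\<lambda>I. rev (sorted_list_of_set I)) (I :: 'n set)"
proof -
  interpret V: ext_alg "\<lambda>i j. j \<le> i" "\<lambda>i j. j < i" \<tau> "\<lambda>I. rev (sorted_list_of_set (I :: 'n set))" by (rule ext_alg_V) fact
  show "mu_V \<tau> f = ext_alg.mu (\<lambda>i j. j < i) \<tau> f" "v_el \<tau> i = ext_alg.e (\<lambda>i j. j < i) \<tau> i"
    "v_set \<tau> I = ext_alg.es (\<lambda>i j. j < i) \<tau> (\<lambda>I. rev (sorted_list_of_set I)) I"
    by (simp_all add: mu_V_def v_el_def v_set_def V.mu_def V.e_def V.es_def V_rels_eq)
qed

lemma graded_tensor_W:
  assumes "\<tau> \<noteq> 0"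
  shows "graded_tensor (W_alg \<tau> :: (complex, 'n::{finite,linorder} ext) module) (FR \<tau>)
    (\<lambda>(\<alpha>, \<beta>). W_comp \<tau> \<alpha>) (F_comp \<tau>) (mu_W \<tau>) (mu_l \<tau>) (\<lambda>d. mshift (- fst d))"
proof -
  interpret W: ext_alg "(\<le>)" "(<)" \<tau> "sorted_list_of_set :: 'n set \<Rightarrow> 'n list" by (rule ext_alg_W) fact
  interpret A: calg "W_alg \<tau> :: (complex, 'n ext) module" unfolding ext_names by (rule calg_presented)
  interpret B: calg "FR \<tau> :: (complex, 'n frst) module" by (rule calg_FR)
  have "mu_W \<tau> f \<in> W_comp \<tau> 0" for f :: "'n mero"
    unfolding mu_W_def W_comp_def by (rule hom_component_mon) simp
  then show ?thesis
    by unfold_locales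
       (auto simp: F_comp_simps FR_copies F_swap W_comp_def W_alg_def split_def
         ext_elements_W(1)[OF assms] W.E_swap[folded W_rels_eq]
         intro: hom_component_carrier hom_component_add hom_component_smult hom_component_mult hom_component_one)
qed

lemma graded_tensor_V:
  assumes "\<tau> \<noteq> 0"
  shows "graded_tensor (FR \<tau>) (V_alg \<tau> :: (complex, 'n::{finite,linorder} ext) module)
    (F_comp \<tau>) (\<lambda>(\<alpha>, \<beta>). V_comp \<tau> \<beta>) (mu_r \<tau>) (mu_V \<tau>) (\<lambda>d. mshift (- snd d))"
proof -
  interpret V: ext_alg "\<lambda>i j. j \<le> i" "\<lambda>i j. j < i" \<tau> "\<lambda>I. rev (sorted_list_of_set (I :: 'n set))"
    by (rule ext_alg_V) fact
  interpret A: calg "V_alg \<tau> :: (complex, 'n ext) module" unfolding ext_names by (rule calg_presented)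
  interpret B: calg "FR \<tau> :: (complex, 'n frst) module" by (rule calg_FR)
  have "mu_V \<tau> f \<in> V_comp \<tau> 0" for f :: "'n mero"
    unfolding mu_V_def V_comp_def by (rule hom_component_mon) simp
  then show ?thesis
    by unfold_locales
       (auto simp: F_comp_simps FR_copies F_swap V_comp_def V_alg_def split_def
         ext_elements_V(1)[OF assms] V.E_swap[folded V_rels_eq]
         intro: hom_component_carrier hom_component_add hom_component_smult hom_component_mult hom_component_one)
qed

lemma const_mult:
  "ml \<tau> (mconst c * f) * x = scl c (ml \<tau> f * x)" "mr \<tau> (mconst c * f) * x = scl c (mr \<tau> f * x)"
proof -
  have "ml \<tau> (mconst c) * ml \<tau> f = scl c (ml \<tau> f)" "mr \<tau> (mconst c) * mr \<tau> f = scl c (mr \<tau> f)"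
    using ml_simps(6)[of \<tau> c "mon [FunL f]"] mr_simps(6)[of \<tau> c "mon [FunR f]"]
    by (simp_all add: ml_def mr_def)
  then show "ml \<tau> (mconst c * f) * x = scl c (ml \<tau> f * x)" "mr \<tau> (mconst c * f) * x = scl c (mr \<tau> f * x)"
    by (simp_all add: ml_simps(2) mr_simps(2) scl_simps(5))
qed

text \<open>The assumption \<open>variant\<close> lists the data of \<open>R\<close> and, with the order of the indices reversed, of \<open>L\<close>.\<close>

locale coaction_data = ext_alg le lt \<tau> slist + T: calg T
  for le lt :: "'n::{finite,linorder} \<Rightarrow> 'n \<Rightarrow> bool" and \<tau> slist and T :: "(complex, 't) module" +
  fixes m1 m2 :: "'n mero \<Rightarrow> 'n frst palg" and f1 f2 :: "'n mero \<Rightarrow> 'n frst"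
    and s :: "'n \<Rightarrow> 'n \<Rightarrow> 'n frst palg" and t :: "'n \<Rightarrow> 'n \<Rightarrow> 'n frst"
    and FC :: "'n weight \<Rightarrow> 'n weight \<Rightarrow> 'n frst set" and tp :: "'n ext \<Rightarrow> 'n frst \<Rightarrow> 't"
  assumes variant:
    "lt = (<) \<and> m1 = ml \<tau> \<and> m2 = mr \<tau> \<and> f1 = mu_l \<tau> \<and> f2 = mu_r \<tau> \<and> s = tt \<tau> \<and> t = t_el \<tau> \<and>
       FC = (\<lambda>\<alpha> \<beta>. F_comp \<tau> (\<alpha>, \<beta>)) \<or>
     lt = (\<lambda>i j. j < i) \<and> m1 = mr \<tau> \<and> m2 = ml \<tau> \<and> f1 = mu_r \<tau> \<and> f2 = mu_l \<tau> \<and>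
       s = (\<lambda>x i. tt \<tau> i x) \<and> t = (\<lambda>x i. t_el \<tau> i x) \<and> FC = (\<lambda>\<alpha> \<beta>. F_comp \<tau> (\<beta>, \<alpha>))"
    and tp_closed: "w \<in> hom_component S edeg \<alpha> \<Longrightarrow> x \<in> FC \<alpha> \<beta> \<Longrightarrow> tp w x \<in> carrier T"
    and tp_add: "w \<in> hom_component S edeg \<alpha> \<Longrightarrow> x \<in> FC \<alpha> \<beta> \<Longrightarrow> y \<in> FC \<alpha> \<beta> \<Longrightarrow>
      emb T (tp w (x \<oplus>\<^bsub>FR \<tau>\<^esub> y)) = emb T (tp w x) + emb T (tp w y)"
    and tp_smult: "w \<in> hom_component S edeg \<alpha> \<Longrightarrow> x \<in> FC \<alpha> \<beta> \<Longrightarrow>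
      emb T (tp w (c \<odot>\<^bsub>FR \<tau>\<^esub> x)) = scl c (emb T (tp w x))"
    and tp_mult: "w \<in> hom_component S edeg \<alpha> \<Longrightarrow> x \<in> FC \<alpha> \<beta> \<Longrightarrow> w' \<in> hom_component S edeg \<alpha>' \<Longrightarrow>
      y \<in> FC \<alpha>' \<beta>' \<Longrightarrow> emb T (tp w x) * emb T (tp w' y) = emb T (tp (w \<otimes>\<^bsub>E\<^esub> w') (x \<otimes>\<^bsub>FR \<tau>\<^esub> y))"
    and tp_balanced: "w \<in> hom_component S edeg \<alpha> \<Longrightarrow> x \<in> FC \<alpha> \<beta> \<Longrightarrow>
      emb T (tp (mu f \<otimes>\<^bsub>E\<^esub> w) x) = emb T (tp w (f1 f \<otimes>\<^bsub>FR \<tau>\<^esub> x))"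
    and tp_zero: "x \<in> FC \<alpha> \<beta> \<Longrightarrow> emb T (tp \<zero>\<^bsub>E\<^esub> x) = 0"
    and tp_one: "\<one>\<^bsub>T\<^esub> = tp \<one>\<^bsub>E\<^esub> \<one>\<^bsub>FR \<tau>\<^esub>"
    and tp_functional: "\<And>(\<psi> :: 'n ext \<Rightarrow> 'n frst \<Rightarrow> 'n frst palg) x y.
      (\<And>\<alpha> w w' x. w \<in> hom_component S edeg \<alpha> \<Longrightarrow> w' \<in> hom_component S edeg \<alpha> \<Longrightarrow>
        \<psi> (w \<oplus>\<^bsub>E\<^esub> w') x = \<psi> w x + \<psi> w' x) \<Longrightarrow>
      (\<And>\<alpha> \<beta> w x y. x \<in> FC \<alpha> \<beta> \<Longrightarrow> y \<in> FC \<alpha> \<beta> \<Longrightarrow> \<psi> w (x \<oplus>\<^bsub>FR \<tau>\<^esub> y) = \<psi> w x + \<psi> w y) \<Longrightarrow>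
      (\<And>\<alpha> w x c. w \<in> hom_component S edeg \<alpha> \<Longrightarrow> \<psi> (c \<odot>\<^bsub>E\<^esub> w) x = scl c (\<psi> w x)) \<Longrightarrow>
      (\<And>\<alpha> \<beta> w x c. x \<in> FC \<alpha> \<beta> \<Longrightarrow> \<psi> w (c \<odot>\<^bsub>FR \<tau>\<^esub> x) = scl c (\<psi> w x)) \<Longrightarrow>
      (\<And>\<alpha> \<beta> w x f. w \<in> hom_component S edeg \<alpha> \<Longrightarrow> x \<in> FC \<alpha> \<beta> \<Longrightarrow>
        \<psi> (mu f \<otimes>\<^bsub>E\<^esub> w) x = \<psi> w (f1 f \<otimes>\<^bsub>FR \<tau>\<^esub> x)) \<Longrightarrow>
      (\<And>I. \<exists>\<beta>. x I \<in> FC (omega_set I) \<beta>) \<Longrightarrow> (\<And>I. \<exists>\<beta>. y I \<in> FC (omega_set I) \<beta>) \<Longrightarrow>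
      (\<Sum>I\<in>UNIV. emb T (tp (es I) (x I))) = (\<Sum>I\<in>UNIV. emb T (tp (es I) (y I))) \<Longrightarrow>
      (\<Sum>I\<in>UNIV. \<psi> (es I) (x I)) = (\<Sum>I\<in>UNIV. \<psi> (es I) (y I))"
begin

sublocale F: calg "FR \<tau>" by (rule calg_FR)

definition Gc :: "'n weight \<Rightarrow> 'n weight \<Rightarrow> 'n frst palg set" where
  "Gc \<alpha> \<beta> = emb (FR \<tau>) ` FC \<alpha> \<beta>"

definition ten :: "'n ext \<Rightarrow> 'n frst palg \<Rightarrow> 't palg" where
  "ten w a = emb T (tp w (prj \<tau> a))"

lemma Gc_cases:
  "(\<forall>\<alpha> \<beta>. Gc \<alpha> \<beta> = FG \<tau> (\<alpha>, \<beta>)) \<or> (\<forall>\<alpha> \<beta>. Gc \<alpha> \<beta> = FG \<tau> (\<beta>, \<alpha>))"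
  using variant by (auto simp: Gc_def FG_def)

lemma Gc_unit:
  assumes "a \<in> Gc \<alpha> \<beta>"
  shows "m1 1 * a = a" "m2 1 * a = a" "a * m2 1 = a"
proof -
  obtain d where "a \<in> FG \<tau> d" using assms Gc_cases by blast
  from FG_unit[OF this] show "m1 1 * a = a" "m2 1 * a = a" "a * m2 1 = a" using variant by auto
qed

lemma FC_car: "x \<in> FC \<alpha> \<beta> \<Longrightarrow> x \<in> carrier (FR \<tau>)"
  using variant F_comp_simps(1) by auto

lemma Gc_prj: "a \<in> Gc \<alpha> \<beta> \<Longrightarrow> prj \<tau> a \<in> FC \<alpha> \<beta>" "a \<in> Gc \<alpha> \<beta> \<Longrightarrow> emb (FR \<tau>) (prj \<tau> a) = a"
  by (auto simp: Gc_def prj_emb FC_car)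

lemma FC_gens: "f1 f \<in> FC 0 0" "f2 f \<in> FC 0 0" "t x i \<in> FC (omega x) (omega i)" "\<zero>\<^bsub>FR \<tau>\<^esub> \<in> FC \<alpha> \<beta>"
  using variant FR_copies F_comp_simps(5) by (auto simp: zero_prod_def)

lemma emb_gens: "emb (FR \<tau>) (f1 f) = m1 f" "emb (FR \<tau>) (f2 f) = m2 f" "emb (FR \<tau>) (t x i) = s x i"
  "f2 1 = \<one>\<^bsub>FR \<tau>\<^esub>"
proof -
  have "mu_r \<tau> 1 = \<one>\<^bsub>FR \<tau>\<^esub>" "mu_l \<tau> 1 = \<one>\<^bsub>FR \<tau>\<^esub>"
    using ml_simps(7)[of \<tau>] mr_simps(7)[of \<tau>]
    by (simp_all add: mu_r_def mu_l_def ml_def mr_def pl_eq_iff FR_def pclass_simps)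
  then show "f2 1 = \<one>\<^bsub>FR \<tau>\<^esub>" using variant by auto
  show "emb (FR \<tau>) (f1 f) = m1 f" "emb (FR \<tau>) (f2 f) = m2 f" "emb (FR \<tau>) (t x i) = s x i"
    using variant F_embs by auto
qed

lemma prj_gens: "prj \<tau> (m1 f) = f1 f" "prj \<tau> (m2 f) = f2 f"
  unfolding emb_gens[symmetric] by (rule prj_emb[OF FC_car[OF FC_gens(1)]] prj_emb[OF FC_car[OF FC_gens(2)]])+

lemma prj_hom:
  "prj \<tau> (a + b) = prj \<tau> a \<oplus>\<^bsub>FR \<tau>\<^esub> prj \<tau> b" "prj \<tau> (a * b) = prj \<tau> a \<otimes>\<^bsub>FR \<tau>\<^esub> prj \<tau> b"
  "prj \<tau> (scl c a) = c \<odot>\<^bsub>FR \<tau>\<^esub> prj \<tau> a" "prj \<tau> 0 = \<zero>\<^bsub>FR \<tau>\<^esub>"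
  by (simp_all add: prj_def Rep_palg_simps Rep_palg_scl calg_FR)

lemma m1_simps: "m1 (f + g) = m1 f + m1 g" "m1 (f * g) = m1 f * m1 g" "m1 0 = 0"
  using variant by (auto simp: ml_simps mr_simps)

lemma m1_const: "m1 (mconst c * f) * x = scl c (m1 f * x)"
  using variant by (auto simp: const_mult)

lemma ten_inj:
  assumes u: "\<And>I. \<exists>\<beta>. u I \<in> Gc (omega_set I) \<beta>" and u': "\<And>I. \<exists>\<beta>. u' I \<in> Gc (omega_set I) \<beta>"
    and eq: "(\<Sum>I\<in>UNIV. ten (es I) (u I)) = (\<Sum>I\<in>UNIV. ten (es I) (u' I))"
  shows "u J = u' J"
proof -
  define \<psi> where "\<psi> w x = m1 (coef J w) * emb (FR \<tau>) x" for w x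
  note hc = hom_component_carrier[of _ S edeg]
  have "(\<Sum>I\<in>UNIV. \<psi> (es I) (prj \<tau> (u I))) = (\<Sum>I\<in>UNIV. \<psi> (es I) (prj \<tau> (u' I)))"
  proof (rule tp_functional)
    show "\<psi> (w \<oplus>\<^bsub>E\<^esub> w') x = \<psi> w x + \<psi> w' x"
      if "w \<in> hom_component S edeg \<alpha>" "w' \<in> hom_component S edeg \<alpha>" for \<alpha> w w' x
      using coef_simps(1)[OF that[THEN hc]] by (simp add: \<psi>_def m1_simps distrib_right)
    show "\<psi> w (x \<oplus>\<^bsub>FR \<tau>\<^esub> y) = \<psi> w x + \<psi> w y" if "x \<in> FC \<alpha> \<beta>" "y \<in> FC \<alpha> \<beta>" for \<alpha> \<beta> w x y
      using that[THEN FC_car] by (simp add: \<psi>_def F.emb_simps distrib_left)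
    show "\<psi> (c \<odot>\<^bsub>E\<^esub> w) x = scl c (\<psi> w x)" if "w \<in> hom_component S edeg \<alpha>" for \<alpha> w x c
      using coef_simps(2)[OF hc[OF that] hc[OF that]] by (simp add: \<psi>_def m1_const)
    show "\<psi> w (c \<odot>\<^bsub>FR \<tau>\<^esub> x) = scl c (\<psi> w x)" if "x \<in> FC \<alpha> \<beta>" for \<alpha> \<beta> w x c
      using FC_car[OF that] by (simp add: \<psi>_def F.emb_simps scl_simps(6))
    show "\<psi> (mu f \<otimes>\<^bsub>E\<^esub> w) x = \<psi> w (f1 f \<otimes>\<^bsub>FR \<tau>\<^esub> x)"
      if "w \<in> hom_component S edeg \<alpha>" "x \<in> FC \<alpha> \<beta>" for \<alpha> \<beta> w x f
      using coef_simps(3)[OF hc[OF that(1)] hc[OF that(1)]] FC_car[OF that(2)] FC_car[OF FC_gens(1)]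
      by (simp add: \<psi>_def F.emb_simps emb_gens mult.assoc[symmetric] m1_simps(2)[symmetric] mult.commute)
    show "\<exists>\<beta>. prj \<tau> (u I) \<in> FC (omega_set I) \<beta>" "\<exists>\<beta>. prj \<tau> (u' I) \<in> FC (omega_set I) \<beta>" for I
      using u[of I] u'[of I] Gc_prj by blast+
  qed (use eq in \<open>simp add: ten_def\<close>)
  moreover have "\<psi> (es I) (prj \<tau> (v I)) = (if I = J then v I else 0)"
    if "\<exists>\<beta>. v I \<in> Gc (omega_set I) \<beta>" for I v
    using that by (auto simp: \<psi>_def coef_es Gc_prj m1_simps(3) Gc_unit)
  ultimately show ?thesis using u u' by simp
qed

sublocale side le lt \<tau> slist T m1 m2 s Gc ten
proof unfold_locales
  show "m1 (- f) = - m1 f" "m2 (f + g) = m2 f + m2 g" "m2 (f * g) = m2 f * m2 g"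
    "m2 (mconst k) = scl k (m2 1)" for f g k
    using variant by (auto simp: ml_simps mr_simps)
  show "m1 1 * a = a" "m2 1 * a = a" "a * m2 1 = a" if "a \<in> Gc \<alpha> \<beta>" for a \<alpha> \<beta>
    using Gc_unit[OF that] by simp_all
  show "m1 1 * s x i = s x i" for x i
    using variant FG_unit[OF FG(5)] by auto
  show "m2 f * s x i = s x i * m2 (mshift (omega i) f)" for f x i
    using variant ml_tt mr_tt by auto
  show "s x i * s y i = m1 (hm \<tau> y x) * (s y i * s x i)" if "lt x y" for x y i
    using variant that tt_row[OF \<tau>] tt_col[OF \<tau>] by auto
  show "s x j * s y i + m2 (hm \<tau> j i) * (s x i * s y j) =
      m1 (hm \<tau> y x) * (s y j * s x i + m2 (hm \<tau> j i) * (s y i * s x j))"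
    if "lt x y" "lt i j" for x y i j
    using variant that tt_square_rows[OF \<tau>] tt_square_cols[OF \<tau>] by auto
  show "0 \<in> Gc \<alpha> \<beta>" for \<alpha> \<beta> using Gc_cases by (auto intro: FG(1))
  show "a + b \<in> Gc \<alpha> \<beta>" if "a \<in> Gc \<alpha> \<beta>" "b \<in> Gc \<alpha> \<beta>" for a b \<alpha> \<beta>
    using Gc_cases that by (auto intro: FG(2))
  show "a * b \<in> Gc (\<alpha> + \<alpha>') (\<beta> + \<beta>')" if "a \<in> Gc \<alpha> \<beta>" "b \<in> Gc \<alpha>' \<beta>'" for a b \<alpha> \<alpha>' \<beta> \<beta>'
    using Gc_cases that FG(3)[of a \<tau> "(\<alpha>, \<beta>)" b "(\<alpha>', \<beta>')"]
      FG(3)[of a \<tau> "(\<beta>, \<alpha>)" b "(\<beta>', \<alpha>')"] by auto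
  show "scl c a \<in> Gc \<alpha> \<beta>" if "a \<in> Gc \<alpha> \<beta>" for a c \<alpha> \<beta>
    using Gc_cases that by (auto intro: FG(4))
  show "s x i \<in> Gc (omega x) (omega i)" "m1 f \<in> Gc 0 0" "m2 f \<in> Gc 0 0" for x i f
    unfolding Gc_def emb_gens[symmetric] by (intro imageI FC_gens)+
  fix w w' \<alpha> \<alpha>' \<beta> \<beta>' a a' c f
  assume w: "w \<in> hom_component S edeg \<alpha>" and a: "a \<in> Gc \<alpha> \<beta>"
  note wa = w Gc_prj(1)[OF a]
  show "ten w a \<in> emb T ` carrier T" unfolding ten_def by (intro imageI tp_closed[OF wa])
  show "ten w (scl c a) = scl c (ten w a)" unfolding ten_def prj_hom by (rule tp_smult[OF wa])
  show "ten (mu f \<otimes>\<^bsub>E\<^esub> w) a = ten w (m1 f * a)"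
    unfolding ten_def prj_hom prj_gens by (rule tp_balanced[OF wa])
  show "ten w (a + a') = ten w a + ten w a'" if "a' \<in> Gc \<alpha> \<beta>"
    unfolding ten_def prj_hom by (rule tp_add[OF wa Gc_prj(1)[OF that]])
  show "ten w a * ten w' a' = ten (w \<otimes>\<^bsub>E\<^esub> w') (a * a')"
    if "w' \<in> hom_component S edeg \<alpha>'" "a' \<in> Gc \<alpha>' \<beta>'"
    unfolding ten_def prj_hom by (rule tp_mult[OF wa that(1) Gc_prj(1)[OF that(2)]])
next
  show "ten \<zero>\<^bsub>E\<^esub> a = 0" if "a \<in> Gc \<alpha> \<beta>" for a \<alpha> \<beta>
    unfolding ten_def by (rule tp_zero[OF Gc_prj(1)[OF that]])
  show "emb T \<one>\<^bsub>T\<^esub> = ten \<one>\<^bsub>E\<^esub> (m2 1)" by (simp add: ten_def prj_gens emb_gens tp_one)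
qed (rule ten_inj)

lemma ten_emb: "x \<in> FC \<alpha> \<beta> \<Longrightarrow> ten w (emb (FR \<tau>) x) = emb T (tp w x)"
  by (simp add: ten_def prj_emb FC_car)

lemma is_coaction_iff:
  "is_coaction C \<longleftrightarrow> C \<in> alg_hom E T \<and> (\<forall>i. C (e i) = (\<Oplus>\<^bsub>T\<^esub>j\<in>UNIV. tp (e j) (t j i))) \<and>
     (\<forall>f. \<forall>w\<in>carrier E. C (mu f \<otimes>\<^bsub>E\<^esub> w) = tp \<one>\<^bsub>E\<^esub> (f2 f) \<otimes>\<^bsub>T\<^esub> C w)"
proof (cases "C \<in> alg_hom E T")
  case True
  then have Cc: "C w \<in> carrier T" if "w \<in> carrier E" for w
    using that by (auto simp: alg_hom_def ring_hom_def)
  have "C (e i) = (\<Oplus>\<^bsub>T\<^esub>j\<in>UNIV. tp (e j) (t j i)) \<longleftrightarrow> emb T (C (e i)) = \<Phi> i" for i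
  proof -
    have c: "(\<lambda>j. tp (e j) (t j i)) \<in> UNIV \<rightarrow> carrier T"
      using tp_closed[OF comps(2) FC_gens(3)] by simp
    have "\<Phi> i = emb T (\<Oplus>\<^bsub>T\<^esub>j\<in>UNIV. tp (e j) (t j i))"
      by (subst T.emb_finsum[OF c]) (simp add: \<Phi>_def ten_emb[OF FC_gens(3), symmetric] emb_gens)
    then show ?thesis using T.emb_inj[OF Cc[OF closed(2)] T.finsum_closed[OF c]] by simp
  qed
  moreover have "C (mu f \<otimes>\<^bsub>E\<^esub> w) = tp \<one>\<^bsub>E\<^esub> (f2 f) \<otimes>\<^bsub>T\<^esub> C w \<longleftrightarrow>
      emb T (C (mu f \<otimes>\<^bsub>E\<^esub> w)) = M f * emb T (C w)" if w: "w \<in> carrier E" for f w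
  proof -
    have c: "tp \<one>\<^bsub>E\<^esub> (f2 f) \<in> carrier T" by (rule tp_closed[OF comps(3) FC_gens(2)])
    have "M f = emb T (tp \<one>\<^bsub>E\<^esub> (f2 f))"
      by (simp add: M_def ten_emb[OF FC_gens(2), symmetric] emb_gens)
    then have "M f * emb T (C w) = emb T (tp \<one>\<^bsub>E\<^esub> (f2 f) \<otimes>\<^bsub>T\<^esub> C w)"
      using c Cc[OF w] by (simp add: T.emb_simps)
    then show ?thesis
      using T.emb_inj[OF Cc[OF E.m_closed[OF closed(1) w]] T.m_closed[OF c Cc[OF w]]] by simp
  qed
  ultimately show ?thesis using True unfolding is_coaction_def by simp
next
  case False
  then show ?thesis unfolding is_coaction_def by simp
qed

context
  fixes C assumes C: "is_coaction C"
begin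

definition minor :: "'n set \<Rightarrow> 'n set \<Rightarrow> 'n frst" where
  "minor I J = prj \<tau> (X C I J)"

lemma minor: "minor I J \<in> FC (omega_set I) (omega_set J)" "emb (FR \<tau>) (minor I J) = X C I J"
  "card I \<noteq> card J \<Longrightarrow> minor I J = \<zero>\<^bsub>FR \<tau>\<^esub>"
  using Gc_prj[OF X(1)[OF C, of I J]] X(2)[OF C] by (simp_all add: minor_def prj_hom)

lemma minor_characterization:
  "(\<forall>I J. card I = card J \<longrightarrow> (\<exists>\<beta>. \<xi> I J \<in> FC (omega_set I) \<beta>)) \<and>
   (\<forall>J. C (es J) = (\<Oplus>\<^bsub>T\<^esub>I\<in>{I. card I = card J}. tp (es I) (\<xi> I J))) \<and>
   (\<forall>I J. card I \<noteq> card J \<longrightarrow> \<xi> I J = \<zero>\<^bsub>FR \<tau>\<^esub>) \<longleftrightarrow> \<xi> = minor"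
proof -
  have Cc: "C (es J) \<in> carrier T" for J
    using C closed(3) by (auto simp: is_coaction_def alg_hom_def ring_hom_def)
  have expand: "C (es J) = (\<Oplus>\<^bsub>T\<^esub>I\<in>{I. card I = card J}. tp (es I) (\<xi> I J)) \<longleftrightarrow>
      emb T (C (es J)) = (\<Sum>I\<in>UNIV. ten (es I) (emb (FR \<tau>) (\<xi> I J)))"
    if \<xi>: "\<And>I. \<exists>\<beta>. \<xi> I J \<in> FC (omega_set I) \<beta>" and z: "\<And>I. card I \<noteq> card J \<Longrightarrow> \<xi> I J = \<zero>\<^bsub>FR \<tau>\<^esub>" for \<xi> J
  proof -
    let ?K = "{I :: 'n set. card I = card J}"
    have c: "(\<lambda>I. tp (es I) (\<xi> I J)) \<in> ?K \<rightarrow> carrier T"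
      using \<xi> tp_closed[OF comps(1)] by blast
    have "(\<Sum>I\<in>UNIV. ten (es I) (emb (FR \<tau>) (\<xi> I J))) = (\<Sum>I\<in>?K. ten (es I) (emb (FR \<tau>) (\<xi> I J)))"
      by (rule sum.mono_neutral_right) (auto simp: z F.emb_simps ten_zero_right[OF comps(1)])
    also have "\<dots> = (\<Sum>I\<in>?K. emb T (tp (es I) (\<xi> I J)))"
      using \<xi> ten_emb by (metis (no_types, lifting))
    also have "\<dots> = emb T (\<Oplus>\<^bsub>T\<^esub>I\<in>?K. tp (es I) (\<xi> I J))"
      by (rule T.emb_finsum[OF c, symmetric])
    finally show ?thesis using T.emb_inj[OF Cc T.finsum_closed[OF c]] by simp
  qed
  show ?thesis
  proof
    assume "\<xi> = minor"
    moreover have "C (es J) = (\<Oplus>\<^bsub>T\<^esub>I\<in>{I. card I = card J}. tp (es I) (minor I J))" for J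
      by (subst expand) (use minor X(3)[OF C] in auto)
    ultimately show "(\<forall>I J. card I = card J \<longrightarrow> (\<exists>\<beta>. \<xi> I J \<in> FC (omega_set I) \<beta>)) \<and>
        (\<forall>J. C (es J) = (\<Oplus>\<^bsub>T\<^esub>I\<in>{I. card I = card J}. tp (es I) (\<xi> I J))) \<and>
        (\<forall>I J. card I \<noteq> card J \<longrightarrow> \<xi> I J = \<zero>\<^bsub>FR \<tau>\<^esub>)"
      using minor(1,3) by blast
  next
    assume *: "(\<forall>I J. card I = card J \<longrightarrow> (\<exists>\<beta>. \<xi> I J \<in> FC (omega_set I) \<beta>)) \<and>
        (\<forall>J. C (es J) = (\<Oplus>\<^bsub>T\<^esub>I\<in>{I. card I = card J}. tp (es I) (\<xi> I J))) \<and>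
        (\<forall>I J. card I \<noteq> card J \<longrightarrow> \<xi> I J = \<zero>\<^bsub>FR \<tau>\<^esub>)"
    then have \<xi>: "\<exists>\<beta>. \<xi> I J \<in> FC (omega_set I) \<beta>" for I J
      using FC_gens(4) by metis
    have "\<xi> I J = minor I J" for I J
    proof -
      have "\<exists>\<beta>. emb (FR \<tau>) (\<xi> I J) \<in> Gc (omega_set I) \<beta>" for I
        using \<xi>[of I J] unfolding Gc_def by blast
      moreover have "emb T (C (es J)) = (\<Sum>I\<in>UNIV. ten (es I) (emb (FR \<tau>) (\<xi> I J)))"
        by (rule iffD1[OF expand]) (use * \<xi> in blast)+
      ultimately have "emb (FR \<tau>) (\<xi> I J) = X C I J" by (rule X_unique[OF C])
      then show ?thesis
        using \<xi>[of I J] F.emb_inj FC_car minor(1,2)[of I J] by metis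
    qed
    then show "\<xi> = minor" by blast
  qed
qed

end

end

lemma coaction_data_W:
  assumes \<tau>: "\<tau> \<noteq> 0"
  shows "coaction_data (\<le>) (<) \<tau> (sorted_list_of_set :: 'n::{finite,linorder} set \<Rightarrow> 'n list) (WF \<tau>)
    (ml \<tau>) (mr \<tau>) (mu_l \<tau>) (mu_r \<tau>) (tt \<tau>) (t_el \<tau>) (\<lambda>\<alpha> \<beta>. F_comp \<tau> (\<alpha>, \<beta>)) (wf_tens \<tau>)"
proof -
  interpret W: ext_alg "(\<le>)" "(<)" \<tau> "sorted_list_of_set :: 'n set \<Rightarrow> 'n list" by (rule ext_alg_W) fact
  interpret G: graded_tensor "W_alg \<tau> :: (complex, 'n ext) module" "FR \<tau>"
    "\<lambda>(\<alpha>, \<beta>). W_comp \<tau> \<alpha>" "F_comp \<tau>" "mu_W \<tau>" "mu_l \<tau>" "\<lambda>d. mshift (- fst d)"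
    by (rule graded_tensor_W) fact
  have T: "G.T = WF \<tau>" by (simp add: WF_def)
  interpret T: calg "WF \<tau> :: (complex, (('n ext \<times> 'n frst) \<Rightarrow>\<^sub>0 complex) set) module" using G.calg_T by (simp only: T)
  have tp: "wf_tens \<tau> = G.tp" by (simp add: G.tp_def[abs_def] wf_tens_def)
  have tn: "emb (WF \<tau>) (G.tp w x) = G.tn w x" for w x by (simp add: G.tn_def T)
  have E: "W.E = W_alg \<tau>" by (simp add: ext_names)
  have hc: "hom_component W.S edeg = W_comp \<tau>" by (simp add: ext_names)
  have z: "\<zero>\<^bsub>W_alg \<tau>\<^esub> \<in> W_comp \<tau> \<alpha>" for \<alpha>
    unfolding ext_names by (rule hom_component_zero)
  have mu: "W.mu = mu_W \<tau>" by (rule ext) (simp add: ext_elements_W[OF \<tau>])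
  show ?thesis
  proof (unfold_locales, unfold tp tn E mu hc, goal_cases)
    case 1 show ?case by simp
  next
    case (2 w \<alpha> x \<beta>) then show ?case using G.tp_closed[of w "(\<alpha>, \<beta>)" x] by (simp add: T)
  next
    case (3 w \<alpha> x \<beta> y) then show ?case using G.tn_add_right[of w "(\<alpha>, \<beta>)" x y] by simp
  next
    case (4 w \<alpha> x \<beta> c) then show ?case using G.tn_smult(2)[of w "(\<alpha>, \<beta>)" x c] by simp
  next
    case (5 w \<alpha> x \<beta> w' \<alpha>' y \<beta>')
    then show ?case using G.tn_mult[of w "(\<alpha>, \<beta>)" x w' "(\<alpha>', \<beta>')" y] by simp
  next
    case (6 w \<alpha> x \<beta> f) then show ?case using G.tn_balanced[of w "(\<alpha>, \<beta>)" x f] by simp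
  next
    case (7 x \<alpha> \<beta>)
    then show ?case
      using G.tn_smult(1)[of "\<zero>\<^bsub>W_alg \<tau>\<^esub>" "(\<alpha>, \<beta>)" x 0] by (simp add: z)
  next
    case 8 show ?case using G.one_T by (simp add: T)
  next
    case (9 \<psi> x y)
    have es: "W.es I \<in> W_comp \<tau> (omega_set I)" for I
      unfolding W.es_def ext_names by (rule hom_component_mon[OF W.es_degree])
    show ?case
    proof (rule G.tn_functional[of \<psi>])
      show "\<exists>i. W.es I \<in> (case i of (\<alpha>, \<beta>) \<Rightarrow> W_comp \<tau> \<alpha>) \<and> x I \<in> F_comp \<tau> i" for I
        using 9(6)[of I] es by auto
      show "\<exists>i. W.es I \<in> (case i of (\<alpha>, \<beta>) \<Rightarrow> W_comp \<tau> \<alpha>) \<and> y I \<in> F_comp \<tau> i" for I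
        using 9(7)[of I] es by auto
    qed (use 9(1-5,8) in auto)
  qed
qed

lemma coaction_data_V:
  assumes \<tau>: "\<tau> \<noteq> 0"
  shows "coaction_data (\<lambda>i j. j \<le> i) (\<lambda>i j. j < i) \<tau> (\<lambda>I. rev (sorted_list_of_set (I :: 'n::{finite,linorder} set)))
    (FV \<tau>) (mr \<tau>) (ml \<tau>) (mu_r \<tau>) (mu_l \<tau>) (\<lambda>x i. tt \<tau> i x) (\<lambda>x i. t_el \<tau> i x)
    (\<lambda>\<alpha> \<beta>. F_comp \<tau> (\<beta>, \<alpha>)) (\<lambda>v x. fv_tens \<tau> x v)"
proof -
  interpret V: ext_alg "\<lambda>i j. j \<le> i" "\<lambda>i j. j < i" \<tau> "\<lambda>I. rev (sorted_list_of_set (I :: 'n set))"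
    by (rule ext_alg_V) fact
  interpret G: graded_tensor "FR \<tau>" "V_alg \<tau> :: (complex, 'n ext) module"
    "F_comp \<tau>" "\<lambda>(\<alpha>, \<beta>). V_comp \<tau> \<beta>" "mu_r \<tau>" "mu_V \<tau>" "\<lambda>d. mshift (- snd d)"
    by (rule graded_tensor_V) fact
  have T: "G.T = FV \<tau>" by (simp add: FV_def)
  interpret T: calg "FV \<tau> :: (complex, (('n frst \<times> 'n ext) \<Rightarrow>\<^sub>0 complex) set) module" using G.calg_T by (simp only: T)
  have tp: "fv_tens \<tau> = G.tp" by (simp add: G.tp_def[abs_def] fv_tens_def)
  have tn: "emb (FV \<tau>) (G.tp x v) = G.tn x v" for v x by (simp add: G.tn_def T)
  have E: "V.E = V_alg \<tau>" by (simp add: ext_names)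
  have hc: "hom_component V.S edeg = V_comp \<tau>" by (simp add: ext_names)
  have z: "\<zero>\<^bsub>V_alg \<tau>\<^esub> \<in> V_comp \<tau> \<alpha>" for \<alpha>
    unfolding ext_names by (rule hom_component_zero)
  have mu: "V.mu = mu_V \<tau>" by (rule ext) (simp add: ext_elements_V[OF \<tau>])
  show ?thesis
  proof (unfold_locales, unfold tp tn E mu hc, goal_cases)
    case 1 show ?case by simp
  next
    case (2 v \<alpha> x \<beta>) then show ?case using G.tp_closed[of x "(\<beta>, \<alpha>)" v] by (simp add: T)
  next
    case (3 v \<alpha> x \<beta> y) then show ?case using G.tn_add_left[of x "(\<beta>, \<alpha>)" y v] by simp
  next
    case (4 v \<alpha> x \<beta> c) then show ?case using G.tn_smult(1)[of x "(\<beta>, \<alpha>)" v c] by simp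
  next
    case (5 v \<alpha> x \<beta> v' \<alpha>' y \<beta>')
    then show ?case using G.tn_mult[of x "(\<beta>, \<alpha>)" v y "(\<beta>', \<alpha>')" v'] by simp
  next
    case (6 v \<alpha> x \<beta> f) then show ?case using G.tn_balanced[of x "(\<beta>, \<alpha>)" v f] by simp
  next
    case (7 x \<alpha> \<beta>)
    then show ?case
      using G.tn_smult(2)[of x "(\<beta>, \<alpha>)" "\<zero>\<^bsub>V_alg \<tau>\<^esub>" 0] by (simp add: z)
  next
    case 8 show ?case using G.one_T by (simp add: T)
  next
    case (9 \<psi> x y)
    have es: "V.es I \<in> V_comp \<tau> (omega_set I)" for I
      unfolding V.es_def ext_names by (rule hom_component_mon[OF V.es_degree])
    show ?case
    proof (rule G.tn_functional[of "\<lambda>x v. \<psi> v x"])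
      show "\<exists>i. x I \<in> F_comp \<tau> i \<and> V.es I \<in> (case i of (\<alpha>, \<beta>) \<Rightarrow> V_comp \<tau> \<beta>)" for I
        using 9(6)[of I] es by auto
      show "\<exists>i. y I \<in> F_comp \<tau> i \<and> V.es I \<in> (case i of (\<alpha>, \<beta>) \<Rightarrow> V_comp \<tau> \<beta>)" for I
        using 9(7)[of I] es by auto
    qed (use 9(1-5,8) in auto)
  qed
qed

lemma xi_properties:
  fixes \<tau> :: complex
  assumes \<tau>: "\<tau> \<noteq> 0"
  defines "X \<equiv> \<lambda>I J :: 'n::{finite,linorder} set. emb (FR \<tau>) (xi \<tau> I J)"
  shows "xi \<tau> I J \<in> F_comp \<tau> (omega_set I, omega_set J)"
    "card I \<noteq> card J \<Longrightarrow> xi \<tau> I J = \<zero>\<^bsub>FR \<tau>\<^esub>"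
    "X {} {} = mr \<tau> 1"
    "j \<notin> J \<Longrightarrow> (\<Sum>x\<in>K. ml \<tau> (Qless \<tau> x (K - {x})) * (tt \<tau> x j * X (K - {x}) J)) =
      mr \<tau> (Qless \<tau> j J) * X K (insert j J)"
proof -
  interpret W: coaction_data "(\<le>)" "(<)" \<tau> "sorted_list_of_set :: 'n set \<Rightarrow> 'n list" "WF \<tau>" "ml \<tau>" "mr \<tau>"
    "mu_l \<tau>" "mu_r \<tau>" "tt \<tau>" "t_el \<tau>" "\<lambda>\<alpha> \<beta>. F_comp \<tau> (\<alpha>, \<beta>)" "wf_tens \<tau>" by (rule coaction_data_W) fact
  note el = ext_elements_W[OF \<tau>, where 'n = 'n]
  have "is_coaction_R \<tau> R \<longleftrightarrow> W.is_coaction R" for R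
    unfolding is_coaction_R_def W.is_coaction_iff el ext_names ..
  then have C: "W.is_coaction (coaction_R \<tau>)"
    using W.coaction_exists unfolding coaction_R_def by (metis someI_ex)
  note minor = W.minor[OF C]
  have xi: "xi \<tau> = W.minor (coaction_R \<tau>)"
    unfolding xi_def el W.minor_characterization[OF C] by simp
  have X: "X I J = W.X (coaction_R \<tau>) I J" for I J by (simp add: X_def xi minor)
  show "xi \<tau> I J \<in> F_comp \<tau> (omega_set I, omega_set J)"
    "card I \<noteq> card J \<Longrightarrow> xi \<tau> I J = \<zero>\<^bsub>FR \<tau>\<^esub>" using minor by (simp_all add: xi)
  show "X {} {} = mr \<tau> 1" unfolding X by (rule W.X_empty[OF C])
  have "Qless \<tau> = W.Q" by (intro ext) (simp add: Qless_def W.Q_def)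
  then show "j \<notin> J \<Longrightarrow> (\<Sum>x\<in>K. ml \<tau> (Qless \<tau> x (K - {x})) * (tt \<tau> x j * X (K - {x}) J)) =
      mr \<tau> (Qless \<tau> j J) * X K (insert j J)"
    unfolding X using W.laplace[OF C, of j J K] by simp
qed

lemma eta_properties:
  fixes \<tau> :: complex
  assumes \<tau>: "\<tau> \<noteq> 0"
  defines "Y \<equiv> \<lambda>I J :: 'n::{finite,linorder} set. emb (FR \<tau>) (eta \<tau> I J)"
  shows "eta \<tau> I J \<in> F_comp \<tau> (omega_set I, omega_set J)"
    "card I \<noteq> card J \<Longrightarrow> eta \<tau> I J = \<zero>\<^bsub>FR \<tau>\<^esub>"
    "Y {} {} = ml \<tau> 1"
    "x \<notin> I \<Longrightarrow> (\<Sum>j\<in>K. mr \<tau> (Qgr \<tau> j (K - {j})) * (tt \<tau> x j * Y I (K - {j}))) =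
      ml \<tau> (Qgr \<tau> x I) * Y (insert x I) K"
proof -
  interpret V: coaction_data "\<lambda>i j. j \<le> i" "\<lambda>i j. j < i" \<tau> "\<lambda>I. rev (sorted_list_of_set (I :: 'n set))" "FV \<tau>"
    "mr \<tau>" "ml \<tau>" "mu_r \<tau>" "mu_l \<tau>" "\<lambda>x i. tt \<tau> i x" "\<lambda>x i. t_el \<tau> i x" "\<lambda>\<alpha> \<beta>. F_comp \<tau> (\<beta>, \<alpha>)"
    "\<lambda>v x. fv_tens \<tau> x v" by (rule coaction_data_V) fact
  note el = ext_elements_V[OF \<tau>, where 'n = 'n]
  have "is_coaction_L \<tau> L \<longleftrightarrow> V.is_coaction L" for L
    unfolding is_coaction_L_def V.is_coaction_iff el ext_names ..
  then have C: "V.is_coaction (coaction_L \<tau>)"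
    using V.coaction_exists unfolding coaction_L_def by (metis someI_ex)
  note minor = V.minor[OF C]
  have "eta \<tau> = (\<lambda>I J. V.minor (coaction_L \<tau>) J I)"
    unfolding eta_def el
  proof (rule the_equality, goal_cases)
    case 1
    note m = iffD2[OF V.minor_characterization[OF C] refl]
    show ?case
    proof (intro conjI allI impI)
      show "\<exists>\<alpha>. V.minor (coaction_L \<tau>) J I \<in> F_comp \<tau> (\<alpha>, omega_set J)" for I J
        by (rule exI) (rule minor(1))
      show "coaction_L \<tau> (V.es I) = (\<Oplus>\<^bsub>FV \<tau>\<^esub>J\<in>{J. card J = card I}. fv_tens \<tau> (V.minor (coaction_L \<tau>) J I) (V.es J))" for I
        using m by blast
      show "V.minor (coaction_L \<tau>) J I = \<zero>\<^bsub>FR \<tau>\<^esub>" if "card I \<noteq> card J" for I J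
        using that by (intro minor(3)) simp
    qed
  next
    case (2 \<eta>)
    have "(\<lambda>J I. \<eta> I J) = V.minor (coaction_L \<tau>)"
    proof (rule iffD1[OF V.minor_characterization[OF C]], intro conjI allI impI)
      show "\<exists>\<beta>. \<eta> J I \<in> F_comp \<tau> (\<beta>, omega_set I)" if "card I = card J" for I J
        using 2 that by metis
      show "coaction_L \<tau> (V.es J) = (\<Oplus>\<^bsub>FV \<tau>\<^esub>I\<in>{I. card I = card J}. fv_tens \<tau> (\<eta> J I) (V.es I))" for J
        using 2 by blast
      show "\<eta> J I = \<zero>\<^bsub>FR \<tau>\<^esub>" if "card I \<noteq> card J" for I J
        using 2 that by metis
    qed
    then show ?case by (simp add: fun_eq_iff)
  qed
  then have eta: "eta \<tau> I J = V.minor (coaction_L \<tau>) J I" for I J by simp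
  have Y: "Y I J = V.X (coaction_L \<tau>) J I" for I J by (simp add: Y_def eta minor)
  show "eta \<tau> I J \<in> F_comp \<tau> (omega_set I, omega_set J)"
    "card I \<noteq> card J \<Longrightarrow> eta \<tau> I J = \<zero>\<^bsub>FR \<tau>\<^esub>" using minor by (simp_all add: eta)
  show "Y {} {} = ml \<tau> 1" unfolding Y by (rule V.X_empty[OF C])
  have "Qgr \<tau> = V.Q" by (intro ext) (simp add: Qgr_def V.Q_def)
  then show "x \<notin> I \<Longrightarrow> (\<Sum>j\<in>K. mr \<tau> (Qgr \<tau> j (K - {j})) * (tt \<tau> x j * Y I (K - {j}))) =
      ml \<tau> (Qgr \<tau> x I) * Y (insert x I) K"
    unfolding Y using V.laplace[OF C, of x I K] by simp
qed

theorem theorem3p17: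
  fixes \<tau> :: complex
    and I J :: "'n::{finite,linorder} set"
  assumes "\<tau> \<noteq> 0"
  shows "xi \<tau> I J = eta \<tau> I J"
proof (cases "card I = card J")
  case True
  interpret F: calg "FR \<tau> :: (complex, 'n frst) module" by (rule calg_FR)
  note xi = xi_properties[OF assms, where 'n = 'n] and eta = eta_properties[OF assms, where 'n = 'n]
  have FG: "emb (FR \<tau>) (xi \<tau> I J) \<in> FG \<tau> (omega_set I, omega_set J)"
    "emb (FR \<tau>) (eta \<tau> I J) \<in> FG \<tau> (omega_set I, omega_set J)" for I J :: "'n set"
    unfolding FG_def by (auto intro!: imageI xi(1) eta(1))
  have "mr \<tau> 1 = (ml \<tau> 1 :: 'n frst palg)" by (simp only: ml_simps(7) mr_simps(7))
  then have "emb (FR \<tau>) (xi \<tau> I J) = emb (FR \<tau>) (eta \<tau> I J)"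
    by (intro minors_agree[OF assms _ _ _ _ _ True, where \<xi> = "\<lambda>I J. emb (FR \<tau>) (xi \<tau> I J)"
          and \<eta> = "\<lambda>I J. emb (FR \<tau>) (eta \<tau> I J)"])
       (simp_all add: xi(3,4) eta(3,4) FG_unit[OF FG(1)] FG_unit[OF FG(2)])
  then show ?thesis
    using F.emb_inj F_comp_simps(1)[OF xi(1)[of I J]] F_comp_simps(1)[OF eta(1)[of I J]] by blast
next
  case False
  then show ?thesis using xi_properties(2)[OF assms] eta_properties(2)[OF assms] by metis
qed

end
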